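(* Let $A$ be a ring and let $T_1$ be a partial silting $A$-module with respect to a projective presentation $\sigma$ of $T_1$. Then the full subcategory $\mathcal{Y}:=\mathcal{D}_\sigma\cap T_1^{\circ}$ of $\mathrm{Mod}(A)$ is bireflective and extension-closed. Moreover, for every $A$-module $X$, the $\mathcal{Y}$-reflection of $X$ is given by the map $\psi_X:X\to M_X/\tau_{T_1}(M_X)$ defined in the context.
   Context: Rings are unital and modules are right modules; $\mathrm{Mod}(A)$ is the category of all $A$-modules. For a morphism $\sigma:P\to Q$ between projective $A$-modules put $\mathcal{D}_\sigma:=\{X\in \mathrm{Mod}(A)\mid \mathrm{Hom}_A(\sigma,X):\mathrm{Hom}_A(Q,X)\to \mathrm{Hom}_A(P,X)\text{ is surjective}\}$. An $A$-module $T_1$ is partial silting with respect to a projective presentation $\sigma$ of $T_1$ (i.e. $P\xrightarrow{\sigma}Q\to T_1\to 0$ exact with $P,Q$ projective) if $\mathcal{D}_\sigma$ is a torsion class and $T_1\in\mathcal{D}_\sigma$. $T_1^{\circ}:=\{X\in \mathrm{Mod}(A)\mid \mathrm{Hom}_A(T_1,X)=0\}$. Note $\mathcal{Y}=\{X\mid \mathrm{Hom}_A(\sigma,X)\text{ is bijective}\}$. A full subcategory of $\mathrm{Mod}(A)$ is bireflective if it is closed under products, coproducts, kernels and cokernels (equivalently, its inclusion functor has both a left and a right adjoint). For a class $\mathcal{X}$ of $A$-modules, a left $\mathcal{X}$-approximation of $M$ is a map $\psi:M\to X_M$ with $X_M\in\mathcal{X}$ such that $\mathrm{Hom}_A(\psi,X)$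 is surjective for all $X\in\mathcal{X}$; it is an $\mathcal{X}$-reflection if $\mathrm{Hom}_A(\psi,X)$ is bijective for all $X\in\mathcal{X}$. Construction of $\psi_X$: for an $A$-module $X$ let $I=\mathrm{Hom}_A(P,X)$ and let $\phi_X:X\to M_X$ be the pushout of $\sigma^{(I)}:P^{(I)}\to Q^{(I)}$ along the canonical map $P^{(I)}\to X$. This yields an exact sequence $X\xrightarrow{\phi_X}M_X\to T_1^{(I)}\to 0$ in which $\phi_X$ is a left $\mathcal{D}_\sigma$-approximation. Let $\tau_{T_1}(M)$ denote the trace of $T_1$ in $M$ (the sum of the images of all maps $T_1\to M$), and let $\psi_X$ be the composition of $\phi_X$ with the canonical projection $M_X\to M_X/\tau_{T_1}(M_X)$. *)

theory Defs
  imports "HOL-Algebra.AbelCoset"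
begin

section \<open>Right modules over a (not necessarily commutative) unital ring\<close>

text \<open>
  As for the record \<open>module\<close> of HOL-Algebra, the fields \<open>mult\<close> and \<open>one\<close> inherited from
  \<open>ring\<close> carry no meaning for a module and are never used below.
\<close>

record ('a, 'b) rmodule = "'b ring" +
  rsmult :: "'b \<Rightarrow> 'a \<Rightarrow> 'b"  (infixl "\<triangleleft>\<index>" 70)

locale right_module = R?: ring R + M?: abelian_group M
  for R (structure) and M :: "('a, 'b) rmodule" (structure) +
  assumes rsmult_closed:
      "\<lbrakk>x \<in> carrier M; a \<in> carrier R\<rbrakk> \<Longrightarrow> x \<triangleleft>\<^bsub>M\<^esub> a \<in> carrier M"
    and rsmult_add_ring:
      "\<lbrakk>x \<in> carrier M; a \<in> carrier R; b \<in> carrier R\<rbrakk> \<Longrightarrow>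
        x \<triangleleft>\<^bsub>M\<^esub> (a \<oplus>\<^bsub>R\<^esub> b) = x \<triangleleft>\<^bsub>M\<^esub> a \<oplus>\<^bsub>M\<^esub> x \<triangleleft>\<^bsub>M\<^esub> b"
    and rsmult_add:
      "\<lbrakk>x \<in> carrier M; y \<in> carrier M; a \<in> carrier R\<rbrakk> \<Longrightarrow>
        (x \<oplus>\<^bsub>M\<^esub> y) \<triangleleft>\<^bsub>M\<^esub> a = x \<triangleleft>\<^bsub>M\<^esub> a \<oplus>\<^bsub>M\<^esub> y \<triangleleft>\<^bsub>M\<^esub> a"
    and rsmult_assoc:
      "\<lbrakk>x \<in> carrier M; a \<in> carrier R; b \<in> carrier R\<rbrakk> \<Longrightarrow>
        x \<triangleleft>\<^bsub>M\<^esub> (a \<otimes>\<^bsub>R\<^esub> b) = (x \<triangleleft>\<^bsub>M\<^esub> a) \<triangleleft>\<^bsub>M\<^esub> b"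
    and rsmult_one:
      "x \<in> carrier M \<Longrightarrow> x \<triangleleft>\<^bsub>M\<^esub> \<one>\<^bsub>R\<^esub> = x"

text \<open>
  Homomorphisms are extensional functions, so that \<open>Hom A M N\<close> contains each module
  homomorphism exactly once; it is used as an index set below. Composites are formed with
  \<^const>\<open>compose\<close>.
\<close>

definition Hom :: "'a ring \<Rightarrow> ('a, 'm) rmodule \<Rightarrow> ('a, 'n) rmodule \<Rightarrow> ('m \<Rightarrow> 'n) set" where
  "Hom A M N = {f \<in> carrier M \<rightarrow>\<^sub>E carrier N.
     (\<forall>x\<in>carrier M. \<forall>y\<in>carrier M. f (x \<oplus>\<^bsub>M\<^esub> y) = f x \<oplus>\<^bsub>N\<^esub> f y) \<and>
     (\<forall>x\<in>carrier M. \<forall>a\<in>carrier A. f (x \<triangleleft>\<^bsub>M\<^esub> a) = f x \<triangleleft>\<^bsub>N\<^esub> a)}"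

definition zero_hom :: "('a, 'm) rmodule \<Rightarrow> ('a, 'n) rmodule \<Rightarrow> 'm \<Rightarrow> 'n" where
  "zero_hom M N = (\<lambda>x\<in>carrier M. \<zero>\<^bsub>N\<^esub>)"

definition surj_hom :: "'a ring \<Rightarrow> ('a, 'm) rmodule \<Rightarrow> ('a, 'n) rmodule \<Rightarrow> ('m \<Rightarrow> 'n) \<Rightarrow> bool" where
  "surj_hom A M N f \<longleftrightarrow> f \<in> Hom A M N \<and> f ` carrier M = carrier N"

definition inj_hom :: "'a ring \<Rightarrow> ('a, 'm) rmodule \<Rightarrow> ('a, 'n) rmodule \<Rightarrow> ('m \<Rightarrow> 'n) \<Rightarrow> bool" where
  "inj_hom A M N f \<longleftrightarrow> f \<in> Hom A M N \<and> inj_on f (carrier M)"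

definition module_iso :: "'a ring \<Rightarrow> ('a, 'm) rmodule \<Rightarrow> ('a, 'n) rmodule \<Rightarrow> bool" where
  "module_iso A M N \<longleftrightarrow> (\<exists>f\<in>Hom A M N. bij_betw f (carrier M) (carrier N))"

definition short_exact ::
    "'a ring \<Rightarrow> ('a, 'l) rmodule \<Rightarrow> ('a, 'm) rmodule \<Rightarrow> ('a, 'n) rmodule \<Rightarrow>
      ('l \<Rightarrow> 'm) \<Rightarrow> ('m \<Rightarrow> 'n) \<Rightarrow> bool" where
  "short_exact A L M N f g \<longleftrightarrow>
     inj_hom A L M f \<and> surj_hom A M N g \<and> f ` carrier L = a_kernel M N g"


section \<open>Constructions of modules\<close>

definition direct_product :: "'i set \<Rightarrow> ('i \<Rightarrow> ('a, 'm) rmodule) \<Rightarrow> ('a, 'i \<Rightarrow> 'm) rmodule" where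
  "direct_product I X =
    \<lparr>carrier = (\<Pi>\<^sub>E i\<in>I. carrier (X i)), mult = undefined, one = undefined,
     zero = (\<lambda>i\<in>I. \<zero>\<^bsub>X i\<^esub>), add = (\<lambda>u v. \<lambda>i\<in>I. u i \<oplus>\<^bsub>X i\<^esub> v i),
     rsmult = (\<lambda>u a. \<lambda>i\<in>I. u i \<triangleleft>\<^bsub>X i\<^esub> a)\<rparr>"

definition direct_sum :: "'i set \<Rightarrow> ('i \<Rightarrow> ('a, 'm) rmodule) \<Rightarrow> ('a, 'i \<Rightarrow> 'm) rmodule" where
  "direct_sum I X = (direct_product I X)
    \<lparr>carrier := {u \<in> \<Pi>\<^sub>E i\<in>I. carrier (X i). finite {i \<in> I. u i \<noteq> \<zero>\<^bsub>X i\<^esub>}}\<rparr>"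

definition binary_sum :: "('a, 'm) rmodule \<Rightarrow> ('a, 'n) rmodule \<Rightarrow> ('a, 'm \<times> 'n) rmodule" where
  "binary_sum M N =
    \<lparr>carrier = carrier M \<times> carrier N, mult = undefined, one = undefined,
     zero = (\<zero>\<^bsub>M\<^esub>, \<zero>\<^bsub>N\<^esub>), add = (\<lambda>(x, y) (x', y'). (x \<oplus>\<^bsub>M\<^esub> x', y \<oplus>\<^bsub>N\<^esub> y')),
     rsmult = (\<lambda>(x, y) a. (x \<triangleleft>\<^bsub>M\<^esub> a, y \<triangleleft>\<^bsub>N\<^esub> a))\<rparr>"

text \<open>The quotient of \<open>M\<close> by (the carrier of) a submodule \<open>S\<close>, consisting of cosets.\<close>

definition quotient_module :: "('a, 'm) rmodule \<Rightarrow> 'm set \<Rightarrow> ('a, 'm set) rmodule" where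
  "quotient_module M S =
    \<lparr>carrier = a_rcosets\<^bsub>M\<^esub> S, mult = undefined, one = undefined,
     zero = S, add = set_add M,
     rsmult = (\<lambda>K a. \<Union>x\<in>K. S +>\<^bsub>M\<^esub> (x \<triangleleft>\<^bsub>M\<^esub> a))\<rparr>"

definition quotient_map :: "('a, 'm) rmodule \<Rightarrow> 'm set \<Rightarrow> 'm \<Rightarrow> 'm set" where
  "quotient_map M S = (\<lambda>x\<in>carrier M. S +>\<^bsub>M\<^esub> x)"

text \<open>The pushout of \<open>f : L \<rightarrow> M\<close> and \<open>g : L \<rightarrow> N\<close>, with its structure map from \<open>M\<close>.\<close>

definition pushout_rel ::
    "('a, 'l) rmodule \<Rightarrow> ('a, 'n) rmodule \<Rightarrow> ('l \<Rightarrow> 'm) \<Rightarrow> ('l \<Rightarrow> 'n) \<Rightarrow> ('m \<times> 'n) set" where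
  "pushout_rel L N f g = (\<lambda>x. (f x, \<ominus>\<^bsub>N\<^esub> g x)) ` carrier L"

definition pushout ::
    "('a, 'l) rmodule \<Rightarrow> ('a, 'm) rmodule \<Rightarrow> ('a, 'n) rmodule \<Rightarrow>
      ('l \<Rightarrow> 'm) \<Rightarrow> ('l \<Rightarrow> 'n) \<Rightarrow> ('a, ('m \<times> 'n) set) rmodule" where
  "pushout L M N f g = quotient_module (binary_sum M N) (pushout_rel L N f g)"

definition pushout_map ::
    "('a, 'l) rmodule \<Rightarrow> ('a, 'm) rmodule \<Rightarrow> ('a, 'n) rmodule \<Rightarrow>
      ('l \<Rightarrow> 'm) \<Rightarrow> ('l \<Rightarrow> 'n) \<Rightarrow> 'm \<Rightarrow> ('m \<times> 'n) set" where
  "pushout_map L M N f g =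
    (\<lambda>x\<in>carrier M. quotient_map (binary_sum M N) (pushout_rel L N f g) (x, \<zero>\<^bsub>N\<^esub>))"

text \<open>
  The coproduct \<open>P\<^sup>(\<^sup>I\<^sup>)\<close> for \<open>I = Hom(P, X)\<close> and the canonical map \<open>P\<^sup>(\<^sup>I\<^sup>) \<rightarrow> X\<close> whose component
  at \<open>f \<in> I\<close> is \<open>f\<close>.
\<close>

definition hom_copower ::
    "'a ring \<Rightarrow> ('a, 'p) rmodule \<Rightarrow> ('a, 'x) rmodule \<Rightarrow> ('a, 'q) rmodule \<Rightarrow>
      ('a, ('p \<Rightarrow> 'x) \<Rightarrow> 'q) rmodule" where
  "hom_copower A P X Q = direct_sum (Hom A P X) (\<lambda>_. Q)"

definition canonical_map ::
    "'a ring \<Rightarrow> ('a, 'p) rmodule \<Rightarrow> ('a, 'x) rmodule \<Rightarrow> (('p \<Rightarrow> 'x) \<Rightarrow> 'p) \<Rightarrow> 'x" where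
  "canonical_map A P X =
    (\<lambda>u\<in>carrier (hom_copower A P X P).
       \<Oplus>\<^bsub>X\<^esub>f\<in>{f \<in> Hom A P X. u f \<noteq> \<zero>\<^bsub>P\<^esub>}. f (u f))"

text \<open>
  The trace of \<open>T\<close> in \<open>M\<close>: the sum of the images of all \<open>f : T \<rightarrow> M\<close> consists of the finite sums
  of elements \<open>f (t\<^sub>f)\<close>.
\<close>

definition trace :: "'a ring \<Rightarrow> ('a, 't) rmodule \<Rightarrow> ('a, 'm) rmodule \<Rightarrow> 'm set" where
  "trace A T M = canonical_map A T M ` carrier (hom_copower A T M T)"


section \<open>Classes of modules\<close>

text \<open>
  A class of \<open>A\<close>-modules is given by a set of modules carried by subsets of a type \<open>'u\<close>, which
  plays the role of the universe in which \<open>Mod(A)\<close> is formed. The closure conditions refer to all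
  modules in \<open>'u\<close> that are kernels, products etc. up to isomorphism. Index sets are
  taken from \<open>'u\<close> as well; this is no restriction, since a product or coproduct over \<open>I\<close> of nonzero
  modules that fits into \<open>'u\<close> has at least as many elements as \<open>I\<close>.
\<close>

definition Modules :: "'a ring \<Rightarrow> ('a, 'u) rmodule set" where
  "Modules A = {X. right_module A X}"

definition closed_under_quotients :: "'a ring \<Rightarrow> ('a, 'u) rmodule set \<Rightarrow> bool" where
  "closed_under_quotients A C \<longleftrightarrow>
    (\<forall>X\<in>C. \<forall>Z\<in>Modules A. \<forall>f. surj_hom A X Z f \<longrightarrow> Z \<in> C)"

definition extension_closed :: "'a ring \<Rightarrow> ('a, 'u) rmodule set \<Rightarrow> bool" where
  "extension_closed A C \<longleftrightarrow>
    (\<forall>X\<in>C. \<forall>Z\<in>C. \<forall>E\<in>Modules A. \<forall>f g. short_exact A X E Z f g \<longrightarrow> E \<in> C)"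

definition closed_under_products :: "'a ring \<Rightarrow> ('a, 'u) rmodule set \<Rightarrow> bool" where
  "closed_under_products A C \<longleftrightarrow>
    (\<forall>(I :: 'u set) X. (\<forall>i\<in>I. X i \<in> C) \<longrightarrow>
       (\<forall>Z\<in>Modules A. module_iso A (direct_product I X) Z \<longrightarrow> Z \<in> C))"

definition closed_under_coproducts :: "'a ring \<Rightarrow> ('a, 'u) rmodule set \<Rightarrow> bool" where
  "closed_under_coproducts A C \<longleftrightarrow>
    (\<forall>(I :: 'u set) X. (\<forall>i\<in>I. X i \<in> C) \<longrightarrow>
       (\<forall>Z\<in>Modules A. module_iso A (direct_sum I X) Z \<longrightarrow> Z \<in> C))"

definition closed_under_kernels :: "'a ring \<Rightarrow> ('a, 'u) rmodule set \<Rightarrow> bool" where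
  "closed_under_kernels A C \<longleftrightarrow>
    (\<forall>X\<in>C. \<forall>Y\<in>C. \<forall>f\<in>Hom A X Y. \<forall>K\<in>Modules A. \<forall>k.
       inj_hom A K X k \<and> k ` carrier K = a_kernel X Y f \<longrightarrow> K \<in> C)"

definition closed_under_cokernels :: "'a ring \<Rightarrow> ('a, 'u) rmodule set \<Rightarrow> bool" where
  "closed_under_cokernels A C \<longleftrightarrow>
    (\<forall>X\<in>C. \<forall>Y\<in>C. \<forall>f\<in>Hom A X Y. \<forall>Z\<in>Modules A. \<forall>c.
       surj_hom A Y Z c \<and> a_kernel Y Z c = f ` carrier X \<longrightarrow> Z \<in> C)"

definition torsion_class :: "'a ring \<Rightarrow> ('a, 'u) rmodule set \<Rightarrow> bool" where
  "torsion_class A C \<longleftrightarrow>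
    C \<subseteq> Modules A \<and> closed_under_quotients A C \<and> extension_closed A C \<and> closed_under_coproducts A C"

definition bireflective :: "'a ring \<Rightarrow> ('a, 'u) rmodule set \<Rightarrow> bool" where
  "bireflective A C \<longleftrightarrow>
    C \<subseteq> Modules A \<and> closed_under_products A C \<and> closed_under_coproducts A C \<and>
    closed_under_kernels A C \<and> closed_under_cokernels A C"

text \<open>
  The two class arguments are the instances of one polymorphic class of modules at the type of the
  target \<open>Z\<close> and at an arbitrary type of test modules \<open>N\<close>.
\<close>

definition is_reflection ::
    "'a ring \<Rightarrow> ('a, 'z) rmodule set \<Rightarrow> ('a, 'n) rmodule set \<Rightarrow>
      ('a, 'x) rmodule \<Rightarrow> ('a, 'z) rmodule \<Rightarrow> ('x \<Rightarrow> 'z) \<Rightarrow> bool" where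
  "is_reflection A C C' X Z \<psi> \<longleftrightarrow>
    Z \<in> C \<and> \<psi> \<in> Hom A X Z \<and>
    (\<forall>N\<in>C'. bij_betw (\<lambda>g. compose (carrier X) g \<psi>) (Hom A Z N) (Hom A X N))"


section \<open>Partial silting modules\<close>

definition projective :: "'u itself \<Rightarrow> 'a ring \<Rightarrow> ('a, 'p) rmodule \<Rightarrow> bool" where
  "projective U A P \<longleftrightarrow>
    P \<in> Modules A \<and>
    (\<forall>(M :: ('a, 'u) rmodule)\<in>Modules A. \<forall>(N :: ('a, 'u) rmodule)\<in>Modules A. \<forall>g. surj_hom A M N g \<longrightarrow>
       (\<forall>f\<in>Hom A P N. \<exists>h\<in>Hom A P M. compose (carrier P) g h = f))"

definition D_class ::
    "'a ring \<Rightarrow> ('a, 'p) rmodule \<Rightarrow> ('a, 'q) rmodule \<Rightarrow> ('p \<Rightarrow> 'q) \<Rightarrow> ('a, 'u) rmodule set" where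
  "D_class A P Q \<sigma> =
    {X \<in> Modules A. (\<lambda>g. compose (carrier P) g \<sigma>) ` Hom A Q X = Hom A P X}"

definition perp_class :: "'a ring \<Rightarrow> ('a, 't) rmodule \<Rightarrow> ('a, 'u) rmodule set" where
  "perp_class A T = {X \<in> Modules A. Hom A T X = {zero_hom T X}}"

definition Y_class ::
    "'a ring \<Rightarrow> ('a, 'p) rmodule \<Rightarrow> ('a, 'q) rmodule \<Rightarrow> ('p \<Rightarrow> 'q) \<Rightarrow> ('a, 't) rmodule \<Rightarrow>
      ('a, 'u) rmodule set" where
  "Y_class A P Q \<sigma> T = D_class A P Q \<sigma> \<inter> perp_class A T"

text \<open>
  A hypothesis cannot quantify over types. Projectivity of \<open>P\<close> and \<open>Q\<close> and the condition that
  \<open>\<D>\<^sub>\<sigma>\<close> is a torsion class are therefore required in one universe that depends only on the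
  data; both follow from the corresponding conditions for all modules. Conversely nothing is lost.
  The universe has \<open>2\<^sup>\<kappa>\<close> elements for \<open>\<kappa> = max(\<aleph>\<^sub>0, |'a|, |'p|, |'q|)\<close>. It
  contains copies of \<open>A\<^sup>(\<^sup>P\<^sup>)\<close> and \<open>A\<^sup>(\<^sup>Q\<^sup>)\<close>, which decide projectivity. A map from \<open>P\<close> to a coproduct
  of modules \<open>X\<^sub>i\<close> in \<open>\<D>\<^sub>\<sigma>\<close> has at most \<open>\<kappa>\<close> nonzero components, and the image of each of them lies
  in a submodule of \<open>X\<^sub>i\<close> which again belongs to \<open>\<D>\<^sub>\<sigma>\<close> and has at most \<open>2\<^sup>\<kappa>\<close> elements (close
  the image under chosen extensions along \<open>\<sigma>\<close>); so closure under coproducts in the universe implies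
  closure under all coproducts. Closure under quotients and extensions holds for every \<open>\<D>\<^sub>\<sigma>\<close>.
\<close>

type_synonym ('a, 'p, 'q) universe = "('a + 'p + 'q) list set"

definition projective_presentation ::
    "'a ring \<Rightarrow> ('a, 'p) rmodule \<Rightarrow> ('a, 'q) rmodule \<Rightarrow> ('a, 't) rmodule \<Rightarrow>
      ('p \<Rightarrow> 'q) \<Rightarrow> ('q \<Rightarrow> 't) \<Rightarrow> bool" where
  "projective_presentation A P Q T \<sigma> \<pi> \<longleftrightarrow>
    projective TYPE(('a, 'p, 'q) universe) A P \<and>
    projective TYPE(('a, 'p, 'q) universe) A Q \<and>
    T \<in> Modules A \<and> \<sigma> \<in> Hom A P Q \<and> surj_hom A Q T \<pi> \<and> \<sigma> ` carrier P = a_kernel Q T \<pi>"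

definition partial_silting ::
    "'a ring \<Rightarrow> ('a, 'p) rmodule \<Rightarrow> ('a, 'q) rmodule \<Rightarrow> ('a, 't) rmodule \<Rightarrow>
      ('p \<Rightarrow> 'q) \<Rightarrow> ('q \<Rightarrow> 't) \<Rightarrow> bool" where
  "partial_silting A P Q T \<sigma> \<pi> \<longleftrightarrow>
    projective_presentation A P Q T \<sigma> \<pi> \<and>
    torsion_class A (D_class A P Q \<sigma> :: ('a, ('a, 'p, 'q) universe) rmodule set) \<and>
    T \<in> D_class A P Q \<sigma>"


section \<open>The reflection map\<close>

text \<open>The map \<open>\<sigma>\<^sup>(\<^sup>I\<^sup>) : P\<^sup>(\<^sup>I\<^sup>) \<rightarrow> Q\<^sup>(\<^sup>I\<^sup>)\<close> for \<open>I = Hom(P, X)\<close>.\<close>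

definition copower_map ::
    "'a ring \<Rightarrow> ('a, 'p) rmodule \<Rightarrow> ('a, 'x) rmodule \<Rightarrow> ('p \<Rightarrow> 'q) \<Rightarrow>
      (('p \<Rightarrow> 'x) \<Rightarrow> 'p) \<Rightarrow> (('p \<Rightarrow> 'x) \<Rightarrow> 'q)" where
  "copower_map A P X \<sigma> =
    (\<lambda>u\<in>carrier (hom_copower A P X P). \<lambda>f\<in>Hom A P X. \<sigma> (u f))"

definition approx_module ::
    "'a ring \<Rightarrow> ('a, 'p) rmodule \<Rightarrow> ('a, 'q) rmodule \<Rightarrow> ('p \<Rightarrow> 'q) \<Rightarrow> ('a, 'x) rmodule \<Rightarrow>
      ('a, ('x \<times> (('p \<Rightarrow> 'x) \<Rightarrow> 'q)) set) rmodule" where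
  "approx_module A P Q \<sigma> X =
    pushout (hom_copower A P X P) X (hom_copower A P X Q)
      (canonical_map A P X) (copower_map A P X \<sigma>)"

definition approx_map ::
    "'a ring \<Rightarrow> ('a, 'p) rmodule \<Rightarrow> ('a, 'q) rmodule \<Rightarrow> ('p \<Rightarrow> 'q) \<Rightarrow> ('a, 'x) rmodule \<Rightarrow>
      'x \<Rightarrow> ('x \<times> (('p \<Rightarrow> 'x) \<Rightarrow> 'q)) set" where
  "approx_map A P Q \<sigma> X =
    pushout_map (hom_copower A P X P) X (hom_copower A P X Q)
      (canonical_map A P X) (copower_map A P X \<sigma>)"

definition reflection_module ::
    "'a ring \<Rightarrow> ('a, 'p) rmodule \<Rightarrow> ('a, 'q) rmodule \<Rightarrow> ('p \<Rightarrow> 'q) \<Rightarrow> ('a, 't) rmodule \<Rightarrow>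
      ('a, 'x) rmodule \<Rightarrow> ('a, ('x \<times> (('p \<Rightarrow> 'x) \<Rightarrow> 'q)) set set) rmodule" where
  "reflection_module A P Q \<sigma> T X =
    quotient_module (approx_module A P Q \<sigma> X) (trace A T (approx_module A P Q \<sigma> X))"

definition reflection_map ::
    "'a ring \<Rightarrow> ('a, 'p) rmodule \<Rightarrow> ('a, 'q) rmodule \<Rightarrow> ('p \<Rightarrow> 'q) \<Rightarrow> ('a, 't) rmodule \<Rightarrow>
      ('a, 'x) rmodule \<Rightarrow> 'x \<Rightarrow> ('x \<times> (('p \<Rightarrow> 'x) \<Rightarrow> 'q)) set set" where
  "reflection_map A P Q \<sigma> T X =
    compose (carrier X)
      (quotient_map (approx_module A P Q \<sigma> X) (trace A T (approx_module A P Q \<sigma> X)))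
      (approx_map A P Q \<sigma> X)"

end

theory Submission
  imports Defs
begin

text \<open>
  Put \<open>\<D> = \<D>\<^sub>\<sigma>\<close> and \<open>\<Y> = \<D> \<inter> T\<^sup>\<circ>\<close>, where \<open>T\<close> is the cokernel of \<open>\<sigma>\<close>. Membership in \<open>\<D>\<close> means that
  homomorphisms from \<open>P\<close> extend along \<open>\<sigma>\<close>, membership in \<open>T\<^sup>\<circ>\<close> that such extensions are unique. With
  projectivity of \<open>P\<close> and \<open>Q\<close>, which lifts homomorphisms along epimorphisms, diagram chases show that
  \<open>\<Y>\<close> is closed under kernels and cokernels (\<open>Y_class_kernel\<close>, \<open>Y_class_cokernel\<close>), products and
  extensions. Closure under coproducts is where the silting hypothesis enters; for \<open>T\<^sup>\<circ>\<close> it holds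
  because coproducts embed into products.

  For the reflection of \<open>X\<close>, the cokernel of \<open>X \<rightarrow> M\<^sub>X\<close> is a copower of \<open>T\<close>, which lies in \<open>\<D>\<close>, and
  homomorphisms from \<open>P\<close> to \<open>X\<close> extend along \<open>\<sigma>\<close> into \<open>M\<^sub>X\<close> by construction; so \<open>M\<^sub>X\<close> lies in \<open>\<D>\<close>. The
  trace of \<open>T\<close> in \<open>M\<^sub>X\<close> is a quotient of a copower of \<open>T\<close>, hence in \<open>\<D>\<close>, and this forces the quotient
  by the trace into \<open>T\<^sup>\<circ>\<close> (\<open>quotient_by_trace_Y_class\<close>). A homomorphism from \<open>X\<close> to a module \<open>N\<close> of \<open>\<Y>\<close>
  extends to \<open>M\<^sub>X\<close>, kills the trace, and does so uniquely because there are no nonzero homomorphisms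
  from copowers of \<open>T\<close> to \<open>N\<close> (\<open>reflection\<close>).

  The hypotheses speak about modules in one universe, the conclusions about modules on arbitrary
  types. Two observations bridge the gap. A projective module in the universe splits off a free
  module, and this property provides lifts everywhere (\<open>projective_imp_free_retract\<close>,
  \<open>free_retract_lift\<close>). For coproducts (\<open>D_class_direct_sum\<close>), a homomorphism from \<open>P\<close> to a coproduct of
  modules in \<open>\<D>\<close> has few nonzero components, and each component factors through the approximation
  \<open>M\<^sub>P\<close> of \<open>P\<close> itself. This module is small and belongs to \<open>\<D>\<close>; its images in the summands are small
  submodules in \<open>\<D>\<close> (\<open>small_image_cover\<close>), and to their coproduct the hypothesis applies.
\<close>


section \<open>Modules and homomorphisms\<close>

lemma right_moduleI:
  assumes "ring A"
    and "\<And>x y. x \<in> carrier M \<Longrightarrow> y \<in> carrier M \<Longrightarrow> x \<oplus>\<^bsub>M\<^esub> y \<in> carrier M"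
    and "\<zero>\<^bsub>M\<^esub> \<in> carrier M"
    and "\<And>x y z. x \<in> carrier M \<Longrightarrow> y \<in> carrier M \<Longrightarrow> z \<in> carrier M \<Longrightarrow>
      (x \<oplus>\<^bsub>M\<^esub> y) \<oplus>\<^bsub>M\<^esub> z = x \<oplus>\<^bsub>M\<^esub> (y \<oplus>\<^bsub>M\<^esub> z)"
    and "\<And>x y. x \<in> carrier M \<Longrightarrow> y \<in> carrier M \<Longrightarrow> x \<oplus>\<^bsub>M\<^esub> y = y \<oplus>\<^bsub>M\<^esub> x"
    and "\<And>x. x \<in> carrier M \<Longrightarrow> \<zero>\<^bsub>M\<^esub> \<oplus>\<^bsub>M\<^esub> x = x"
    and "\<And>x. x \<in> carrier M \<Longrightarrow> \<exists>y\<in>carrier M. y \<oplus>\<^bsub>M\<^esub> x = \<zero>\<^bsub>M\<^esub>"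
    and "\<And>x a. x \<in> carrier M \<Longrightarrow> a \<in> carrier A \<Longrightarrow> x \<triangleleft>\<^bsub>M\<^esub> a \<in> carrier M"
    and "\<And>x a b. x \<in> carrier M \<Longrightarrow> a \<in> carrier A \<Longrightarrow> b \<in> carrier A \<Longrightarrow>
      x \<triangleleft>\<^bsub>M\<^esub> (a \<oplus>\<^bsub>A\<^esub> b) = x \<triangleleft>\<^bsub>M\<^esub> a \<oplus>\<^bsub>M\<^esub> x \<triangleleft>\<^bsub>M\<^esub> b"
    and "\<And>x y a. x \<in> carrier M \<Longrightarrow> y \<in> carrier M \<Longrightarrow> a \<in> carrier A \<Longrightarrow>
      (x \<oplus>\<^bsub>M\<^esub> y) \<triangleleft>\<^bsub>M\<^esub> a = x \<triangleleft>\<^bsub>M\<^esub> a \<oplus>\<^bsub>M\<^esub> y \<triangleleft>\<^bsub>M\<^esub> a"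
    and "\<And>x a b. x \<in> carrier M \<Longrightarrow> a \<in> carrier A \<Longrightarrow> b \<in> carrier A \<Longrightarrow>
      x \<triangleleft>\<^bsub>M\<^esub> (a \<otimes>\<^bsub>A\<^esub> b) = (x \<triangleleft>\<^bsub>M\<^esub> a) \<triangleleft>\<^bsub>M\<^esub> b"
    and "\<And>x. x \<in> carrier M \<Longrightarrow> x \<triangleleft>\<^bsub>M\<^esub> \<one>\<^bsub>A\<^esub> = x"
  shows "right_module A M"
  by (intro right_module.intro right_module_axioms.intro abelian_groupI) (fact assms)+

lemma (in right_module) rsmult_zero:
  assumes "a \<in> carrier R"
  shows "\<zero>\<^bsub>M\<^esub> \<triangleleft>\<^bsub>M\<^esub> a = \<zero>\<^bsub>M\<^esub>"
proof -
  have "\<zero>\<^bsub>M\<^esub> \<triangleleft>\<^bsub>M\<^esub> a \<oplus>\<^bsub>M\<^esub> \<zero>\<^bsub>M\<^esub> \<triangleleft>\<^bsub>M\<^esub> a = (\<zero>\<^bsub>M\<^esub> \<oplus>\<^bsub>M\<^esub> \<zero>\<^bsub>M\<^esub>) \<triangleleft>\<^bsub>M\<^esub> a"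
    by (rule rsmult_add[symmetric]) (use assms in auto)
  then show ?thesis
    using assms by (metis M.add.r_cancel_one' M.l_zero M.zero_closed rsmult_closed)
qed

lemma (in right_module) rsmult_a_inv:
  assumes "x \<in> carrier M" "a \<in> carrier R"
  shows "(\<ominus>\<^bsub>M\<^esub> x) \<triangleleft>\<^bsub>M\<^esub> a = \<ominus>\<^bsub>M\<^esub> (x \<triangleleft>\<^bsub>M\<^esub> a)"
proof -
  have "(\<ominus>\<^bsub>M\<^esub> x) \<triangleleft>\<^bsub>M\<^esub> a \<oplus>\<^bsub>M\<^esub> x \<triangleleft>\<^bsub>M\<^esub> a = \<zero>\<^bsub>M\<^esub>"
    using assms rsmult_add[of "\<ominus>\<^bsub>M\<^esub> x" x a] by (simp add: M.l_neg rsmult_zero)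
  then show ?thesis
    using assms by (intro M.minus_equality[symmetric]) (auto intro: rsmult_closed)
qed

lemma (in right_module) rsmult_minus_one:
  assumes "x \<in> carrier M"
  shows "x \<triangleleft>\<^bsub>M\<^esub> (\<ominus>\<^bsub>R\<^esub> \<one>\<^bsub>R\<^esub>) = \<ominus>\<^bsub>M\<^esub> x"
proof -
  have z: "x \<triangleleft>\<^bsub>M\<^esub> \<zero>\<^bsub>R\<^esub> = \<zero>\<^bsub>M\<^esub>"
    using assms rsmult_add_ring[of x "\<zero>\<^bsub>R\<^esub>" "\<zero>\<^bsub>R\<^esub>"]
    by (metis M.add.r_cancel_one' R.l_zero R.zero_closed rsmult_closed)
  have "x \<triangleleft>\<^bsub>M\<^esub> (\<ominus>\<^bsub>R\<^esub> \<one>\<^bsub>R\<^esub>) \<oplus>\<^bsub>M\<^esub> x = \<zero>\<^bsub>M\<^esub>"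
    using assms rsmult_add_ring[of x "\<ominus>\<^bsub>R\<^esub> \<one>\<^bsub>R\<^esub>" "\<one>\<^bsub>R\<^esub>"]
    by (simp add: R.l_neg z rsmult_one)
  then show ?thesis
    using assms by (intro M.minus_equality[symmetric]) (auto intro: rsmult_closed)
qed

lemma (in right_module) a_swap:
  assumes "x \<in> carrier M" "y \<in> carrier M" "x' \<in> carrier M" "y' \<in> carrier M"
  shows "(x \<oplus>\<^bsub>M\<^esub> y) \<oplus>\<^bsub>M\<^esub> (x' \<oplus>\<^bsub>M\<^esub> y') = (x \<oplus>\<^bsub>M\<^esub> x') \<oplus>\<^bsub>M\<^esub> (y \<oplus>\<^bsub>M\<^esub> y')"
  using assms by (simp add: M.a_ac)

lemma (in right_module) minus_eq_zeroD:
  assumes "x \<ominus>\<^bsub>M\<^esub> y = \<zero>\<^bsub>M\<^esub>" "x \<in> carrier M" "y \<in> carrier M"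
  shows "x = y"
proof -
  have "x = (x \<ominus>\<^bsub>M\<^esub> y) \<oplus>\<^bsub>M\<^esub> y"
    using assms(2,3) by (simp add: a_minus_def M.a_assoc M.l_neg)
  then show ?thesis using assms by simp
qed

lemma (in right_module) minus_minus_cancel:
  assumes "x \<in> carrier M" "y \<in> carrier M"
  shows "x \<ominus>\<^bsub>M\<^esub> (x \<ominus>\<^bsub>M\<^esub> y) = y"
proof -
  have "x \<ominus>\<^bsub>M\<^esub> (x \<ominus>\<^bsub>M\<^esub> y) = x \<oplus>\<^bsub>M\<^esub> (\<ominus>\<^bsub>M\<^esub> x \<oplus>\<^bsub>M\<^esub> y)"
    using assms by (simp add: a_minus_def M.minus_add)
  also have "\<dots> = y"
    using assms by (simp add: M.r_neg2)
  finally show ?thesis .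
qed

lemma HomI:
  assumes "\<And>x. x \<in> carrier M \<Longrightarrow> f x \<in> carrier N"
    and "\<And>x y. x \<in> carrier M \<Longrightarrow> y \<in> carrier M \<Longrightarrow> f (x \<oplus>\<^bsub>M\<^esub> y) = f x \<oplus>\<^bsub>N\<^esub> f y"
    and "\<And>x a. x \<in> carrier M \<Longrightarrow> a \<in> carrier A \<Longrightarrow> f (x \<triangleleft>\<^bsub>M\<^esub> a) = f x \<triangleleft>\<^bsub>N\<^esub> a"
    and "f \<in> extensional (carrier M)"
  shows "f \<in> Hom A M N"
  using assms by (auto simp: Hom_def PiE_def)

lemma restrict_HomI:
  assumes "right_module A M"
    and "\<And>x. x \<in> carrier M \<Longrightarrow> f x \<in> carrier N"
    and "\<And>x y. x \<in> carrier M \<Longrightarrow> y \<in> carrier M \<Longrightarrow> f (x \<oplus>\<^bsub>M\<^esub> y) = f x \<oplus>\<^bsub>N\<^esub> f y"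
    and "\<And>x a. x \<in> carrier M \<Longrightarrow> a \<in> carrier A \<Longrightarrow> f (x \<triangleleft>\<^bsub>M\<^esub> a) = f x \<triangleleft>\<^bsub>N\<^esub> a"
  shows "(\<lambda>x\<in>carrier M. f x) \<in> Hom A M N"
proof -
  interpret M: right_module A M by fact
  show ?thesis
    using assms by (intro HomI) (auto intro: M.rsmult_closed)
qed

lemma Hom_closed: "f \<in> Hom A M N \<Longrightarrow> x \<in> carrier M \<Longrightarrow> f x \<in> carrier N"
  by (auto simp: Hom_def)

lemma Hom_add:
  "f \<in> Hom A M N \<Longrightarrow> x \<in> carrier M \<Longrightarrow> y \<in> carrier M \<Longrightarrow> f (x \<oplus>\<^bsub>M\<^esub> y) = f x \<oplus>\<^bsub>N\<^esub> f y"
  by (auto simp: Hom_def)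

lemma Hom_rsmult:
  "f \<in> Hom A M N \<Longrightarrow> x \<in> carrier M \<Longrightarrow> a \<in> carrier A \<Longrightarrow> f (x \<triangleleft>\<^bsub>M\<^esub> a) = f x \<triangleleft>\<^bsub>N\<^esub> a"
  by (auto simp: Hom_def)

lemma Hom_eqI:
  assumes "f \<in> Hom A M N" "g \<in> Hom A M N" "\<And>x. x \<in> carrier M \<Longrightarrow> f x = g x"
  shows "f = g"
  using assms by (auto simp: Hom_def intro: PiE_ext)

lemma Hom_zero:
  assumes "f \<in> Hom A M N" "right_module A M" "right_module A N"
  shows "f \<zero>\<^bsub>M\<^esub> = \<zero>\<^bsub>N\<^esub>"
proof -
  interpret M: right_module A M by fact
  interpret N: right_module A N by fact
  have "f \<zero>\<^bsub>M\<^esub> \<oplus>\<^bsub>N\<^esub> f \<zero>\<^bsub>M\<^esub> = f \<zero>\<^bsub>M\<^esub>"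
    using Hom_add[OF assms(1), of "\<zero>\<^bsub>M\<^esub>" "\<zero>\<^bsub>M\<^esub>"] by simp
  then show ?thesis
    using Hom_closed[OF assms(1) M.zero_closed] by (metis N.add.r_cancel_one')
qed

lemma Hom_a_inv:
  assumes "f \<in> Hom A M N" "right_module A M" "right_module A N" "x \<in> carrier M"
  shows "f (\<ominus>\<^bsub>M\<^esub> x) = \<ominus>\<^bsub>N\<^esub> f x"
proof -
  interpret M: right_module A M by fact
  interpret N: right_module A N by fact
  have "f (\<ominus>\<^bsub>M\<^esub> x) \<oplus>\<^bsub>N\<^esub> f x = \<zero>\<^bsub>N\<^esub>"
    using Hom_add[OF assms(1), of "\<ominus>\<^bsub>M\<^esub> x" x] assms(4) Hom_zero[OF assms(1-3)] by (simp add: M.l_neg)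
  then show ?thesis
    using assms Hom_closed[OF assms(1)] by (intro N.minus_equality[symmetric]) auto
qed

lemma Hom_minus:
  assumes "f \<in> Hom A M N" "right_module A M" "right_module A N" "x \<in> carrier M" "y \<in> carrier M"
  shows "f (x \<ominus>\<^bsub>M\<^esub> y) = f x \<ominus>\<^bsub>N\<^esub> f y"
proof -
  interpret M: right_module A M by fact
  show ?thesis
    using assms by (simp add: a_minus_def Hom_add[OF assms(1)] Hom_a_inv[OF assms(1-3)])
qed

lemma Hom_finsum:
  assumes "f \<in> Hom A M N" "right_module A M" "right_module A N"
    and "finite F" "\<And>i. i \<in> F \<Longrightarrow> u i \<in> carrier M"
  shows "f (\<Oplus>\<^bsub>M\<^esub>i\<in>F. u i) = (\<Oplus>\<^bsub>N\<^esub>i\<in>F. f (u i))"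
  using assms(4,5)
proof (induction F rule: finite_induct)
  interpret M: right_module A M by fact
  interpret N: right_module A N by fact
  case empty
  then show ?case using Hom_zero[OF assms(1-3)] by simp
next
  interpret M: right_module A M by fact
  interpret N: right_module A N by fact
  case (insert i F)
  then show ?case
    using Hom_closed[OF assms(1)]
    by (simp add: M.finsum_insert N.finsum_insert Pi_def Hom_add[OF assms(1)] M.finsum_closed)
qed

lemma Hom_compose:
  assumes "f \<in> Hom A L M" "g \<in> Hom A M N" "right_module A L"
  shows "compose (carrier L) g f \<in> Hom A L N"
proof -
  interpret L: right_module A L by fact
  show ?thesis
    using assms(1,2) unfolding compose_def
    by (intro restrict_HomI assms(3))
       (auto simp: Hom_add[OF assms(1)] Hom_rsmult[OF assms(1)] intro: Hom_closed Hom_add Hom_rsmult)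
qed

lemma Hom_minus_Hom:
  assumes "f \<in> Hom A M N" "g \<in> Hom A M N" "right_module A M" "right_module A N"
  shows "(\<lambda>x\<in>carrier M. f x \<ominus>\<^bsub>N\<^esub> g x) \<in> Hom A M N"
proof -
  interpret M: right_module A M by fact
  interpret N: right_module A N by fact
  show ?thesis
    using assms(3)
  proof (rule restrict_HomI)
    show "f x \<ominus>\<^bsub>N\<^esub> g x \<in> carrier N" if "x \<in> carrier M" for x
      using Hom_closed[OF assms(1) that] Hom_closed[OF assms(2) that] by simp
  next
    fix x y assume x: "x \<in> carrier M" and y: "y \<in> carrier M"
    note cl = Hom_closed[OF assms(1) x] Hom_closed[OF assms(2) x]
      Hom_closed[OF assms(1) y] Hom_closed[OF assms(2) y]
    show "f (x \<oplus>\<^bsub>M\<^esub> y) \<ominus>\<^bsub>N\<^esub> g (x \<oplus>\<^bsub>M\<^esub> y) = (f x \<ominus>\<^bsub>N\<^esub> g x) \<oplus>\<^bsub>N\<^esub> (f y \<ominus>\<^bsub>N\<^esub> g y)"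
      unfolding Hom_add[OF assms(1) x y] Hom_add[OF assms(2) x y] a_minus_def N.minus_add[OF cl(2,4)]
      by (rule N.a_swap) (use cl in auto)
  next
    fix x a assume x: "x \<in> carrier M" and a: "a \<in> carrier A"
    note cl = Hom_closed[OF assms(1) x] Hom_closed[OF assms(2) x]
    show "f (x \<triangleleft>\<^bsub>M\<^esub> a) \<ominus>\<^bsub>N\<^esub> g (x \<triangleleft>\<^bsub>M\<^esub> a) = (f x \<ominus>\<^bsub>N\<^esub> g x) \<triangleleft>\<^bsub>N\<^esub> a"
      using cl a by (simp add: Hom_rsmult[OF assms(1) x a] Hom_rsmult[OF assms(2) x a] a_minus_def
          N.rsmult_add N.rsmult_a_inv)
  qed
qed

lemma zero_hom_Hom:
  assumes "right_module A M" "right_module A N"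
  shows "zero_hom M N \<in> Hom A M N"
proof -
  interpret N: right_module A N by fact
  show ?thesis
    unfolding zero_hom_def by (intro restrict_HomI assms) (auto simp: N.rsmult_zero)
qed

lemma id_Hom:
  assumes "right_module A M"
  shows "(\<lambda>x\<in>carrier M. x) \<in> Hom A M M"
  by (intro restrict_HomI assms) auto

lemma Hom_factor_surj:
  assumes "surj_hom A M Z c" "f \<in> Hom A M N"
    and "right_module A M" "right_module A Z" "right_module A N"
    and ker: "\<And>x. x \<in> carrier M \<Longrightarrow> c x = \<zero>\<^bsub>Z\<^esub> \<Longrightarrow> f x = \<zero>\<^bsub>N\<^esub>"
  obtains h where "h \<in> Hom A Z N" "\<And>x. x \<in> carrier M \<Longrightarrow> h (c x) = f x"
proof -
  interpret M: right_module A M by fact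
  interpret N: right_module A N by fact
  interpret Z: right_module A Z by fact
  have c: "c \<in> Hom A M Z" and onto: "c ` carrier M = carrier Z"
    using assms(1) by (auto simp: surj_hom_def)
  define h where "h = (\<lambda>z\<in>carrier Z. f (inv_into (carrier M) c z))"
  have h: "h (c x) = f x" if x: "x \<in> carrier M" for x
  proof -
    have cx: "c x \<in> carrier Z" using Hom_closed[OF c x] .
    define y where "y = inv_into (carrier M) c (c x)"
    have y: "y \<in> carrier M" "c y = c x" and hy: "h (c x) = f y"
      using x cx by (simp_all add: y_def h_def inv_into_into f_inv_into_f)
    have "c (y \<ominus>\<^bsub>M\<^esub> x) = \<zero>\<^bsub>Z\<^esub>"
      using x y cx Hom_minus[OF c assms(3,4), of y x] by (simp add: Z.r_neg a_minus_def[of Z])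
    then have "f (y \<ominus>\<^bsub>M\<^esub> x) = \<zero>\<^bsub>N\<^esub>" using ker x y(1) by simp
    then have "f y \<ominus>\<^bsub>N\<^esub> f x = \<zero>\<^bsub>N\<^esub>"
      using Hom_minus[OF assms(2,3,5) y(1) x] by simp
    then show ?thesis
      using hy N.minus_eq_zeroD Hom_closed[OF assms(2)] x y(1) by simp
  qed
  have "h \<in> Hom A Z N"
  proof (rule HomI)
    show "h \<in> extensional (carrier Z)" by (simp add: h_def)
  next
    fix z assume "z \<in> carrier Z"
    then obtain x where "x \<in> carrier M" "z = c x" using onto by auto
    then show "h z \<in> carrier N" using h Hom_closed[OF assms(2)] by simp
  next
    fix z z' assume "z \<in> carrier Z" "z' \<in> carrier Z"
    then have "z \<in> c ` carrier M" "z' \<in> c ` carrier M" by (simp_all only: onto)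
    then obtain x x' where x: "x \<in> carrier M" "x' \<in> carrier M" and z: "z = c x" "z' = c x'" by blast
    then show "h (z \<oplus>\<^bsub>Z\<^esub> z') = h z \<oplus>\<^bsub>N\<^esub> h z'"
      by (simp add: h Hom_add[OF c, symmetric] Hom_add[OF assms(2)])
  next
    fix z a assume "z \<in> carrier Z" and a: "a \<in> carrier A"
    then obtain x where x: "x \<in> carrier M" and z: "z = c x"
      using onto by auto
    then show "h (z \<triangleleft>\<^bsub>Z\<^esub> a) = h z \<triangleleft>\<^bsub>N\<^esub> a"
      using a by (simp add: h Hom_rsmult[OF c, symmetric] Hom_rsmult[OF assms(2)] M.rsmult_closed)
  qed
  then show thesis using h that by blast
qed

lemma Hom_factor_inj:
  assumes "inj_hom A K M k" "f \<in> Hom A L M"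
    and "right_module A L" "right_module A K"
    and im: "\<And>x. x \<in> carrier L \<Longrightarrow> f x \<in> k ` carrier K"
  obtains h where "h \<in> Hom A L K" "\<And>x. x \<in> carrier L \<Longrightarrow> k (h x) = f x"
proof -
  interpret K: right_module A K by fact
  interpret L: right_module A L by fact
  have k: "k \<in> Hom A K M" and inj: "inj_on k (carrier K)"
    using assms(1) by (auto simp: inj_hom_def)
  define h where "h = (\<lambda>x\<in>carrier L. inv_into (carrier K) k (f x))"
  have h: "h x \<in> carrier K" "k (h x) = f x" if "x \<in> carrier L" for x
    using im[OF that] that by (auto simp: h_def inv_into_into f_inv_into_f)
  have "h \<in> Hom A L K"
  proof (rule HomI)
    show "h \<in> extensional (carrier L)" by (simp add: h_def)
    show "h x \<in> carrier K" if "x \<in> carrier L" for x using h that by simp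
    show "h (x \<oplus>\<^bsub>L\<^esub> y) = h x \<oplus>\<^bsub>K\<^esub> h y" if "x \<in> carrier L" "y \<in> carrier L" for x y
      using that h by (intro inj_onD[OF inj]) (auto simp: Hom_add[OF k] Hom_add[OF assms(2)])
    show "h (x \<triangleleft>\<^bsub>L\<^esub> a) = h x \<triangleleft>\<^bsub>K\<^esub> a" if "x \<in> carrier L" "a \<in> carrier A" for x a
      using that h
      by (intro inj_onD[OF inj])
         (auto simp: Hom_rsmult[OF k] Hom_rsmult[OF assms(2)] K.rsmult_closed L.rsmult_closed)
  qed
  then show thesis using h that by blast
qed

text \<open>
  The axioms pass along \<open>f\<close> one by one. This yields the module axioms for quotients and for copies of
  a module on another set.
\<close>

lemma right_module_image:
  assumes "right_module A M" "f ` carrier M = carrier N"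
    and add: "\<And>x y. x \<in> carrier M \<Longrightarrow> y \<in> carrier M \<Longrightarrow> f (x \<oplus>\<^bsub>M\<^esub> y) = f x \<oplus>\<^bsub>N\<^esub> f y"
    and sm: "\<And>x a. x \<in> carrier M \<Longrightarrow> a \<in> carrier A \<Longrightarrow> f (x \<triangleleft>\<^bsub>M\<^esub> a) = f x \<triangleleft>\<^bsub>N\<^esub> a"
    and zero: "f \<zero>\<^bsub>M\<^esub> = \<zero>\<^bsub>N\<^esub>"
  shows "right_module A N"
proof -
  interpret M: right_module A M by fact
  have ex: "\<exists>x\<in>carrier M. z = f x" if "z \<in> carrier N" for z using assms(2) that by auto
  have cl: "f x \<in> carrier N" if "x \<in> carrier M" for x using assms(2) that by auto
  show ?thesis
  proof (rule right_moduleI)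
    show "ring A" by (rule M.R.ring_axioms)
    show "\<zero>\<^bsub>N\<^esub> \<in> carrier N" using cl[OF M.zero_closed] zero by simp
    show "u \<oplus>\<^bsub>N\<^esub> v \<in> carrier N" if "u \<in> carrier N" "v \<in> carrier N" for u v
      using that by (auto dest!: ex simp: add[symmetric] cl)
    show "u \<oplus>\<^bsub>N\<^esub> v \<oplus>\<^bsub>N\<^esub> w = u \<oplus>\<^bsub>N\<^esub> (v \<oplus>\<^bsub>N\<^esub> w)"
      if "u \<in> carrier N" "v \<in> carrier N" "w \<in> carrier N" for u v w
      using that by (auto dest!: ex simp: add[symmetric] M.a_assoc)
    show "u \<oplus>\<^bsub>N\<^esub> v = v \<oplus>\<^bsub>N\<^esub> u" if "u \<in> carrier N" "v \<in> carrier N" for u v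
      using that by (auto dest!: ex simp: add[symmetric] M.a_comm)
    show "\<zero>\<^bsub>N\<^esub> \<oplus>\<^bsub>N\<^esub> u = u" if "u \<in> carrier N" for u
      using that by (auto dest!: ex simp: add[symmetric] zero[symmetric])
    show "\<exists>v\<in>carrier N. v \<oplus>\<^bsub>N\<^esub> u = \<zero>\<^bsub>N\<^esub>" if u: "u \<in> carrier N" for u
    proof -
      obtain x where x: "x \<in> carrier M" "u = f x" using ex[OF u] by auto
      then have "f (\<ominus>\<^bsub>M\<^esub> x) \<oplus>\<^bsub>N\<^esub> u = \<zero>\<^bsub>N\<^esub>"
        by (simp add: add[symmetric] zero[symmetric] M.l_neg)
      then show ?thesis using cl x by auto
    qed
    show "u \<triangleleft>\<^bsub>N\<^esub> a \<in> carrier N" if "u \<in> carrier N" "a \<in> carrier A" for u a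
      using that by (auto dest!: ex simp: sm[symmetric] M.rsmult_closed cl)
    show "u \<triangleleft>\<^bsub>N\<^esub> (a \<oplus>\<^bsub>A\<^esub> b) = u \<triangleleft>\<^bsub>N\<^esub> a \<oplus>\<^bsub>N\<^esub> u \<triangleleft>\<^bsub>N\<^esub> b"
      if "u \<in> carrier N" "a \<in> carrier A" "b \<in> carrier A" for u a b
      using that by (auto dest!: ex simp: sm[symmetric] add[symmetric] M.rsmult_closed M.rsmult_add_ring)
    show "(u \<oplus>\<^bsub>N\<^esub> v) \<triangleleft>\<^bsub>N\<^esub> a = u \<triangleleft>\<^bsub>N\<^esub> a \<oplus>\<^bsub>N\<^esub> v \<triangleleft>\<^bsub>N\<^esub> a"
      if "u \<in> carrier N" "v \<in> carrier N" "a \<in> carrier A" for u v a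
      using that by (auto dest!: ex simp: sm[symmetric] add[symmetric] M.rsmult_closed M.rsmult_add)
    show "u \<triangleleft>\<^bsub>N\<^esub> (a \<otimes>\<^bsub>A\<^esub> b) = (u \<triangleleft>\<^bsub>N\<^esub> a) \<triangleleft>\<^bsub>N\<^esub> b"
      if "u \<in> carrier N" "a \<in> carrier A" "b \<in> carrier A" for u a b
      using that by (auto dest!: ex simp: sm[symmetric] M.rsmult_closed M.rsmult_assoc)
    show "u \<triangleleft>\<^bsub>N\<^esub> \<one>\<^bsub>A\<^esub> = u" if "u \<in> carrier N" for u
      using that by (auto dest!: ex simp: sm[symmetric] M.rsmult_one)
  qed
qed


section \<open>Submodules and quotients\<close>

text \<open>
  Closure under negatives is not listed since the action of \<open>- 1\<close> provides it.
\<close>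

definition rsubmodule :: "'a ring \<Rightarrow> ('a, 'm) rmodule \<Rightarrow> 'm set \<Rightarrow> bool" where
  "rsubmodule A M S \<longleftrightarrow> S \<subseteq> carrier M \<and> \<zero>\<^bsub>M\<^esub> \<in> S \<and>
    (\<forall>x\<in>S. \<forall>y\<in>S. x \<oplus>\<^bsub>M\<^esub> y \<in> S) \<and> (\<forall>x\<in>S. \<forall>a\<in>carrier A. x \<triangleleft>\<^bsub>M\<^esub> a \<in> S)"

lemma rsubmodule_a_inv:
  assumes "rsubmodule A M S" "right_module A M" "x \<in> S"
  shows "\<ominus>\<^bsub>M\<^esub> x \<in> S"
proof -
  interpret M: right_module A M by fact
  have "x \<in> carrier M" using assms by (auto simp: rsubmodule_def)
  then have "\<ominus>\<^bsub>M\<^esub> x = x \<triangleleft>\<^bsub>M\<^esub> (\<ominus>\<^bsub>A\<^esub> \<one>\<^bsub>A\<^esub>)" by (simp add: M.rsmult_minus_one)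
  then show ?thesis using assms by (simp add: rsubmodule_def)
qed

lemma right_module_submodule:
  assumes "rsubmodule A M S" "right_module A M"
  shows "right_module A (M\<lparr>carrier := S\<rparr>)"
proof -
  interpret M: right_module A M by fact
  have S: "x \<in> carrier M" if "x \<in> S" for x using assms(1) that by (auto simp: rsubmodule_def)
  note inv = rsubmodule_a_inv[OF assms]
  have l_neg: "\<exists>y\<in>S. y \<oplus>\<^bsub>M\<^esub> x = \<zero>\<^bsub>M\<^esub>" if "x \<in> S" for x
    using S inv M.l_neg that by blast
  have a_comm: "x \<oplus>\<^bsub>M\<^esub> y = y \<oplus>\<^bsub>M\<^esub> x" if "x \<in> S" "y \<in> S" for x y
    using S M.a_comm that by blast
  show ?thesis
    using assms(1)
    by (intro right_moduleI)
       (auto simp: rsubmodule_def S l_neg M.R.ring_axioms M.a_assoc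
          M.rsmult_add M.rsmult_add_ring M.rsmult_assoc M.rsmult_one intro: a_comm)
qed

lemma Hom_into_submodule:
  assumes "f \<in> Hom A L M" "\<And>x. x \<in> carrier L \<Longrightarrow> f x \<in> S"
  shows "f \<in> Hom A L (M\<lparr>carrier := S\<rparr>)"
  using assms by (auto simp: Hom_def PiE_def)

lemma Hom_from_submodule:
  assumes "f \<in> Hom A L (M\<lparr>carrier := S\<rparr>)" "S \<subseteq> carrier M"
  shows "f \<in> Hom A L M"
  using assms by (auto simp: Hom_def PiE_def)

lemma rsubmodule_image:
  assumes "f \<in> Hom A M N" "right_module A M" "right_module A N"
  shows "rsubmodule A N (f ` carrier M)"
proof -
  interpret M: right_module A M by fact
  show ?thesis
    unfolding rsubmodule_def
  proof (intro conjI ballI)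
    show "f ` carrier M \<subseteq> carrier N" using Hom_closed[OF assms(1)] by auto
    show "\<zero>\<^bsub>N\<^esub> \<in> f ` carrier M" using Hom_zero[OF assms] M.zero_closed by (metis image_eqI)
  next
    fix u v assume "u \<in> f ` carrier M" "v \<in> f ` carrier M"
    then show "u \<oplus>\<^bsub>N\<^esub> v \<in> f ` carrier M" by (auto simp: Hom_add[OF assms(1), symmetric])
  next
    fix u a assume "u \<in> f ` carrier M" "a \<in> carrier A"
    then show "u \<triangleleft>\<^bsub>N\<^esub> a \<in> f ` carrier M"
      by (auto simp: Hom_rsmult[OF assms(1), symmetric] M.rsmult_closed)
  qed
qed

lemma surj_hom_onto_image:
  assumes "f \<in> Hom A M N"
  shows "surj_hom A M (N\<lparr>carrier := f ` carrier M\<rparr>) f"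
  using Hom_into_submodule[OF assms, of "f ` carrier M"] by (auto simp: surj_hom_def)

lemma quotient_module:
  assumes S: "rsubmodule A M S" and M: "right_module A M"
  shows "right_module A (quotient_module M S)"
    and "surj_hom A M (quotient_module M S) (quotient_map M S)"
    and "a_kernel M (quotient_module M S) (quotient_map M S) = S"
proof -
  interpret M: right_module A M by fact
  have sub: "S \<subseteq> carrier M" using S by (simp add: rsubmodule_def)
  have "additive_subgroup S M"
  proof (intro additive_subgroup.intro M.add.subgroupI)
    show "\<ominus>\<^bsub>M\<^esub> x \<in> S" if "x \<in> S" for x
      using rsubmodule_a_inv[OF S M that] .
  qed (use S in \<open>auto simp: rsubmodule_def\<close>)
  then interpret S: abelian_subgroup S M
    by (rule abelian_subgroupI3) (rule M.abelian_group_axioms)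
  let ?Q = "quotient_module M S" and ?q = "\<lambda>x. S +>\<^bsub>M\<^esub> x"
  have onto: "?q ` carrier M = carrier ?Q"
    by (auto simp: quotient_module_def A_RCOSETS_def')
  have add: "?q (x \<oplus>\<^bsub>M\<^esub> y) = ?q x \<oplus>\<^bsub>?Q\<^esub> ?q y" if "x \<in> carrier M" "y \<in> carrier M" for x y
    using that by (simp add: quotient_module_def S.a_rcos_sum)
  have sm: "?q (x \<triangleleft>\<^bsub>M\<^esub> a) = ?q x \<triangleleft>\<^bsub>?Q\<^esub> a" if x: "x \<in> carrier M" and a: "a \<in> carrier A" for x a
  proof -
    have coset: "?q (y \<triangleleft>\<^bsub>M\<^esub> a) = ?q (x \<triangleleft>\<^bsub>M\<^esub> a)" if y: "y \<in> ?q x" for y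
    proof -
      have yc: "y \<in> carrier M" using S.a_elemrcos_carrier x y by blast
      have "y \<oplus>\<^bsub>M\<^esub> \<ominus>\<^bsub>M\<^esub> x \<in> S" using S.a_rcos_module_imp x y by blast
      then have "(y \<oplus>\<^bsub>M\<^esub> \<ominus>\<^bsub>M\<^esub> x) \<triangleleft>\<^bsub>M\<^esub> a \<in> S" using S a by (auto simp: rsubmodule_def)
      then have "y \<triangleleft>\<^bsub>M\<^esub> a \<oplus>\<^bsub>M\<^esub> \<ominus>\<^bsub>M\<^esub> (x \<triangleleft>\<^bsub>M\<^esub> a) \<in> S"
        using x yc a by (simp add: M.rsmult_add M.rsmult_a_inv)
      then have "y \<triangleleft>\<^bsub>M\<^esub> a \<in> ?q (x \<triangleleft>\<^bsub>M\<^esub> a)"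
        using x yc a by (intro S.a_rcos_module_rev) (auto intro: M.rsmult_closed)
      then show ?thesis using x a by (intro S.a_repr_independence'[symmetric]) (auto intro: M.rsmult_closed)
    qed
    have "(\<Union>y\<in>?q x. ?q (y \<triangleleft>\<^bsub>M\<^esub> a)) = (\<Union>y\<in>?q x. ?q (x \<triangleleft>\<^bsub>M\<^esub> a))"
      by (rule SUP_cong) (simp_all add: coset)
    also have "\<dots> = ?q (x \<triangleleft>\<^bsub>M\<^esub> a)"
      using S.a_rcos_self[OF x] by (intro SUP_const) blast
    finally show ?thesis by (simp add: quotient_module_def)
  qed
  have zero: "?q \<zero>\<^bsub>M\<^esub> = \<zero>\<^bsub>?Q\<^esub>"
    using sub by (simp add: quotient_module_def)
  show "right_module A ?Q"
    using M onto add sm zero by (rule right_module_image)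
  have "(\<lambda>x\<in>carrier M. ?q x) \<in> Hom A M ?Q"
    using M _ add sm by (rule restrict_HomI) (use onto in blast)
  then show "surj_hom A M ?Q (quotient_map M S)"
    using onto by (simp add: surj_hom_def quotient_map_def)
  show "a_kernel M ?Q (quotient_map M S) = S"
  proof -
    have "?q x = S \<longleftrightarrow> x \<in> S" if "x \<in> carrier M" for x
      using S.a_rcos_const S.a_rcos_self that by blast
    then show ?thesis using sub by (auto simp: a_kernel_def' quotient_map_def quotient_module_def)
  qed
qed

section \<open>Direct products, direct sums and pushouts\<close>

lemma direct_product_simps [simp]:
  "carrier (direct_product I X) = (\<Pi>\<^sub>E i\<in>I. carrier (X i))"
  "\<zero>\<^bsub>direct_product I X\<^esub> = (\<lambda>i\<in>I. \<zero>\<^bsub>X i\<^esub>)"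
  "u \<oplus>\<^bsub>direct_product I X\<^esub> v = (\<lambda>i\<in>I. u i \<oplus>\<^bsub>X i\<^esub> v i)"
  "u \<triangleleft>\<^bsub>direct_product I X\<^esub> a = (\<lambda>i\<in>I. u i \<triangleleft>\<^bsub>X i\<^esub> a)"
  by (simp_all add: direct_product_def)

lemma direct_sum_simps [simp]:
  "carrier (direct_sum I X) = {u \<in> \<Pi>\<^sub>E i\<in>I. carrier (X i). finite {i \<in> I. u i \<noteq> \<zero>\<^bsub>X i\<^esub>}}"
  "\<zero>\<^bsub>direct_sum I X\<^esub> = (\<lambda>i\<in>I. \<zero>\<^bsub>X i\<^esub>)"
  "u \<oplus>\<^bsub>direct_sum I X\<^esub> v = (\<lambda>i\<in>I. u i \<oplus>\<^bsub>X i\<^esub> v i)"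
  "u \<triangleleft>\<^bsub>direct_sum I X\<^esub> a = (\<lambda>i\<in>I. u i \<triangleleft>\<^bsub>X i\<^esub> a)"
  by (simp_all add: direct_sum_def direct_product_def)

lemma right_module_direct_product:
  fixes A :: "'a ring"
  assumes "ring A" "\<And>i. i \<in> I \<Longrightarrow> right_module A (X i)"
  shows "right_module A (direct_product I X)"
proof -
  have grp: "abelian_group (X i)" if "i \<in> I" for i
    using assms(2)[OF that] by (simp add: right_module_def)
  note abelian = abelian_groupE[OF grp]
  note mod = right_module.rsmult_closed[OF assms(2)] right_module.rsmult_add[OF assms(2)]
    right_module.rsmult_add_ring[OF assms(2)] right_module.rsmult_assoc[OF assms(2)]
    right_module.rsmult_one[OF assms(2)]
  have mem: "u i \<in> carrier (X i)" if "u \<in> carrier (direct_product I X)" "i \<in> I" for u i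
    using that by auto
  have ext: "u = v" if "u \<in> carrier (direct_product I X)" "v \<in> carrier (direct_product I X)"
    "\<And>i. i \<in> I \<Longrightarrow> u i = v i" for u v
    using that by (auto intro: PiE_ext)
  have add: "u \<oplus>\<^bsub>direct_product I X\<^esub> v \<in> carrier (direct_product I X)"
    if "u \<in> carrier (direct_product I X)" "v \<in> carrier (direct_product I X)" for u v
    using abelian(1)[OF _ mem[OF that(1)] mem[OF that(2)]] by simp
  have sm: "u \<triangleleft>\<^bsub>direct_product I X\<^esub> a \<in> carrier (direct_product I X)"
    if "u \<in> carrier (direct_product I X)" "a \<in> carrier A" for u a
    using mod(1)[OF _ mem[OF that(1)] that(2)] by simp
  have zero: "\<zero>\<^bsub>direct_product I X\<^esub> \<in> carrier (direct_product I X)"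
    using abelian(2) by simp
  show ?thesis
  proof (rule right_moduleI)
    show "\<exists>v\<in>carrier (direct_product I X). v \<oplus>\<^bsub>direct_product I X\<^esub> u = \<zero>\<^bsub>direct_product I X\<^esub>"
      if u: "u \<in> carrier (direct_product I X)" for u
    proof
      show "(\<lambda>i\<in>I. \<ominus>\<^bsub>X i\<^esub> u i) \<oplus>\<^bsub>direct_product I X\<^esub> u = \<zero>\<^bsub>direct_product I X\<^esub>"
        by (auto intro!: restrict_ext simp: abelian_group.l_neg[OF grp mem[OF u]])
      show "(\<lambda>i\<in>I. \<ominus>\<^bsub>X i\<^esub> u i) \<in> carrier (direct_product I X)"
        using abelian_group.a_inv_closed[OF grp mem[OF u]] by simp
    qed
  next
    fix u v assume u: "u \<in> carrier (direct_product I X)" and v: "v \<in> carrier (direct_product I X)"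
    show "u \<oplus>\<^bsub>direct_product I X\<^esub> v = v \<oplus>\<^bsub>direct_product I X\<^esub> u"
      using abelian(4)[OF _ mem[OF u] mem[OF v]] by (intro ext add u v) simp
  next
    fix u v w assume u: "u \<in> carrier (direct_product I X)" and v: "v \<in> carrier (direct_product I X)"
      and w: "w \<in> carrier (direct_product I X)"
    show "u \<oplus>\<^bsub>direct_product I X\<^esub> v \<oplus>\<^bsub>direct_product I X\<^esub> w =
        u \<oplus>\<^bsub>direct_product I X\<^esub> (v \<oplus>\<^bsub>direct_product I X\<^esub> w)"
      using abelian(3)[OF _ mem[OF u] mem[OF v] mem[OF w]] by (intro ext add u v w) simp
  next
    fix u assume u: "u \<in> carrier (direct_product I X)"
    show "\<zero>\<^bsub>direct_product I X\<^esub> \<oplus>\<^bsub>direct_product I X\<^esub> u = u"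
      using abelian(5)[OF _ mem[OF u]] by (intro ext add zero u) simp
    show "u \<triangleleft>\<^bsub>direct_product I X\<^esub> \<one>\<^bsub>A\<^esub> = u"
      using mod(5)[OF _ mem[OF u]] ring.ring_simprules(6)[OF assms(1)] by (intro ext sm u) simp_all
  next
    fix u a b assume u: "u \<in> carrier (direct_product I X)" and a: "a \<in> carrier A" and b: "b \<in> carrier A"
    show "u \<triangleleft>\<^bsub>direct_product I X\<^esub> (a \<oplus>\<^bsub>A\<^esub> b) =
        u \<triangleleft>\<^bsub>direct_product I X\<^esub> a \<oplus>\<^bsub>direct_product I X\<^esub> u \<triangleleft>\<^bsub>direct_product I X\<^esub> b"
      using mod(3)[OF _ mem[OF u] a b] ring.ring_simprules(1)[OF assms(1) a b]
      by (intro ext add sm u a b) simp_all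
    show "u \<triangleleft>\<^bsub>direct_product I X\<^esub> (a \<otimes>\<^bsub>A\<^esub> b) =
        (u \<triangleleft>\<^bsub>direct_product I X\<^esub> a) \<triangleleft>\<^bsub>direct_product I X\<^esub> b"
      using mod(4)[OF _ mem[OF u] a b] ring.ring_simprules(5)[OF assms(1) a b]
      by (intro ext sm u a b) simp_all
  next
    fix u v a assume u: "u \<in> carrier (direct_product I X)" and v: "v \<in> carrier (direct_product I X)"
      and a: "a \<in> carrier A"
    show "(u \<oplus>\<^bsub>direct_product I X\<^esub> v) \<triangleleft>\<^bsub>direct_product I X\<^esub> a =
        u \<triangleleft>\<^bsub>direct_product I X\<^esub> a \<oplus>\<^bsub>direct_product I X\<^esub> v \<triangleleft>\<^bsub>direct_product I X\<^esub> a"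
      using mod(2)[OF _ mem[OF u] mem[OF v] a] by (intro ext add sm u v a) simp
  qed (fact assms(1) zero add sm)+
qed

lemma direct_sum_submodule:
  fixes A :: "'a ring"
  assumes "ring A" "\<And>i. i \<in> I \<Longrightarrow> right_module A (X i)"
  shows "rsubmodule A (direct_product I X) (carrier (direct_sum I X))"
proof -
  interpret D: right_module A "direct_product I X"
    using assms by (rule right_module_direct_product)
  have grp: "abelian_group (X i)" if "i \<in> I" for i
    using assms(2)[OF that] by (simp add: right_module_def)
  have zz: "\<zero>\<^bsub>X i\<^esub> \<oplus>\<^bsub>X i\<^esub> \<zero>\<^bsub>X i\<^esub> = \<zero>\<^bsub>X i\<^esub>" if "i \<in> I" for i
    using abelian_groupE(2,5)[OF grp[OF that]] by simp
  have za: "\<zero>\<^bsub>X i\<^esub> \<triangleleft>\<^bsub>X i\<^esub> a = \<zero>\<^bsub>X i\<^esub>" if "i \<in> I" "a \<in> carrier A" for i a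
    using right_module.rsmult_zero[OF assms(2)] that by blast
  show ?thesis
    unfolding rsubmodule_def
  proof (intro conjI ballI)
    show "carrier (direct_sum I X) \<subseteq> carrier (direct_product I X)" by auto
    have "finite {i \<in> I. \<zero>\<^bsub>direct_product I X\<^esub> i \<noteq> \<zero>\<^bsub>X i\<^esub>}"
      by (rule finite_subset[of _ "{}"]) auto
    then show "\<zero>\<^bsub>direct_product I X\<^esub> \<in> carrier (direct_sum I X)"
      using D.zero_closed by (simp only: direct_sum_simps(1) direct_product_simps(1) mem_Collect_eq)
  next
    fix u v assume u: "u \<in> carrier (direct_sum I X)" and v: "v \<in> carrier (direct_sum I X)"
    have "{i \<in> I. (u \<oplus>\<^bsub>direct_product I X\<^esub> v) i \<noteq> \<zero>\<^bsub>X i\<^esub>} \<subseteq>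
        {i \<in> I. u i \<noteq> \<zero>\<^bsub>X i\<^esub>} \<union> {i \<in> I. v i \<noteq> \<zero>\<^bsub>X i\<^esub>}"
      using zz by auto
    moreover have "finite \<dots>" using u v by simp
    ultimately have "finite {i \<in> I. (u \<oplus>\<^bsub>direct_product I X\<^esub> v) i \<noteq> \<zero>\<^bsub>X i\<^esub>}"
      by (rule finite_subset)
    then show "u \<oplus>\<^bsub>direct_product I X\<^esub> v \<in> carrier (direct_sum I X)"
      using D.a_closed[of u v] u v
      by (simp only: direct_sum_simps(1) direct_product_simps(1) mem_Collect_eq)
  next
    fix u a assume u: "u \<in> carrier (direct_sum I X)" and a: "a \<in> carrier A"
    have "{i \<in> I. (u \<triangleleft>\<^bsub>direct_product I X\<^esub> a) i \<noteq> \<zero>\<^bsub>X i\<^esub>} \<subseteq> {i \<in> I. u i \<noteq> \<zero>\<^bsub>X i\<^esub>}"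
      using za a by auto
    moreover have "finite \<dots>" using u by simp
    ultimately have "finite {i \<in> I. (u \<triangleleft>\<^bsub>direct_product I X\<^esub> a) i \<noteq> \<zero>\<^bsub>X i\<^esub>}"
      by (rule finite_subset)
    then show "u \<triangleleft>\<^bsub>direct_product I X\<^esub> a \<in> carrier (direct_sum I X)"
      using D.rsmult_closed[of u a] u a
      by (simp only: direct_sum_simps(1) direct_product_simps(1) mem_Collect_eq)
  qed
qed

lemma direct_sum_as_submodule:
  "direct_sum I X = (direct_product I X)\<lparr>carrier := carrier (direct_sum I X)\<rparr>"
  by (simp add: direct_sum_def)

lemma right_module_direct_sum:
  fixes A :: "'a ring"
  assumes "ring A" "\<And>i. i \<in> I \<Longrightarrow> right_module A (X i)"
  shows "right_module A (direct_sum I X)"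
  by (subst direct_sum_as_submodule)
     (intro right_module_submodule direct_sum_submodule right_module_direct_product assms)

lemma Hom_direct_sum_product:
  assumes "f \<in> Hom A M (direct_sum I X)"
  shows "f \<in> Hom A M (direct_product I X)"
  using assms by (subst (asm) direct_sum_as_submodule, elim Hom_from_submodule) auto

lemma Hom_direct_product_component:
  assumes "f \<in> Hom A M (direct_product I X)" "i \<in> I" "right_module A M"
  shows "(\<lambda>x\<in>carrier M. f x i) \<in> Hom A M (X i)"
  using assms(3)
proof (rule restrict_HomI)
  show "f x i \<in> carrier (X i)" if "x \<in> carrier M" for x
    using Hom_closed[OF assms(1) that] assms(2) by auto
qed (simp_all add: Hom_add[OF assms(1)] Hom_rsmult[OF assms(1)] assms(2))

lemma Hom_into_direct_product:
  assumes "\<And>i. i \<in> I \<Longrightarrow> f i \<in> Hom A M (X i)" "right_module A M"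
  shows "(\<lambda>x\<in>carrier M. \<lambda>i\<in>I. f i x) \<in> Hom A M (direct_product I X)"
  using assms(2)
  by (rule restrict_HomI)
     (auto intro!: restrict_ext simp: Hom_closed[OF assms(1)] Hom_add[OF assms(1)] Hom_rsmult[OF assms(1)])

lemma Hom_into_direct_sum:
  assumes "\<And>i. i \<in> I \<Longrightarrow> f i \<in> Hom A M (X i)" "right_module A M"
    and "\<And>x. x \<in> carrier M \<Longrightarrow> finite {i \<in> I. f i x \<noteq> \<zero>\<^bsub>X i\<^esub>}"
  shows "(\<lambda>x\<in>carrier M. \<lambda>i\<in>I. f i x) \<in> Hom A M (direct_sum I X)"
proof (subst direct_sum_as_submodule, rule Hom_into_submodule)
  show h: "(\<lambda>x\<in>carrier M. \<lambda>i\<in>I. f i x) \<in> Hom A M (direct_product I X)"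
    using assms(1,2) by (rule Hom_into_direct_product)
  fix x assume x: "x \<in> carrier M"
  have "{i \<in> I. (\<lambda>i\<in>I. f i x) i \<noteq> \<zero>\<^bsub>X i\<^esub>} = {i \<in> I. f i x \<noteq> \<zero>\<^bsub>X i\<^esub>}" by auto
  then show "(\<lambda>x\<in>carrier M. \<lambda>i\<in>I. f i x) x \<in> carrier (direct_sum I X)"
    using x Hom_closed[OF assms(1) x] assms(3)[OF x] by auto
qed

definition direct_sum_inj :: "'i set \<Rightarrow> ('i \<Rightarrow> ('a, 'm) rmodule) \<Rightarrow> 'i \<Rightarrow> 'm \<Rightarrow> 'i \<Rightarrow> 'm" where
  "direct_sum_inj I X i = (\<lambda>x\<in>carrier (X i). \<lambda>j\<in>I. if j = i then x else \<zero>\<^bsub>X j\<^esub>)"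

lemma direct_sum_inj_Hom:
  assumes "ring A" "\<And>i. i \<in> I \<Longrightarrow> right_module A (X i)" "i \<in> I"
  shows "direct_sum_inj I X i \<in> Hom A (X i) (direct_sum I X)"
proof -
  let ?f = "\<lambda>j x. if j = i then x else \<zero>\<^bsub>X j\<^esub>"
  have comp: "(\<lambda>x\<in>carrier (X i). ?f j x) \<in> Hom A (X i) (X j)" if "j \<in> I" for j
    using zero_hom_Hom[OF assms(2)[OF assms(3)] assms(2)[OF that]] id_Hom[OF assms(2)[OF that]]
    by (cases "j = i") (simp_all add: zero_hom_def)
  have fin: "finite {j \<in> I. (\<lambda>x\<in>carrier (X i). ?f j x) x \<noteq> \<zero>\<^bsub>X j\<^esub>}" if "x \<in> carrier (X i)" for x
    by (rule finite_subset[of _ "{i}"]) (use that in auto)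
  have "direct_sum_inj I X i = (\<lambda>x\<in>carrier (X i). \<lambda>j\<in>I. (\<lambda>x\<in>carrier (X i). ?f j x) x)"
    by (auto simp: direct_sum_inj_def intro!: restrict_ext)
  also have "\<dots> \<in> Hom A (X i) (direct_sum I X)"
    by (rule Hom_into_direct_sum[OF comp assms(2)[OF assms(3)] fin])
  finally show ?thesis .
qed

text \<open>
  Sums over the support realise the universal property of the coproduct. The canonical map from a
  copower of \<open>P\<close> to \<open>X\<close> is the instance in which the homomorphisms from \<open>P\<close> to \<open>X\<close> serve as
  indices and as components at once.
\<close>

definition copair ::
    "'i set \<Rightarrow> ('i \<Rightarrow> ('a, 'm) rmodule) \<Rightarrow> ('a, 'n) rmodule \<Rightarrow> ('i \<Rightarrow> 'm \<Rightarrow> 'n) \<Rightarrow> ('i \<Rightarrow> 'm) \<Rightarrow> 'n" where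
  "copair I X N g =
    (\<lambda>u\<in>carrier (direct_sum I X). \<Oplus>\<^bsub>N\<^esub>i\<in>{i \<in> I. u i \<noteq> \<zero>\<^bsub>X i\<^esub>}. g i (u i))"

lemma copair_eq_finsum:
  assumes u: "u \<in> carrier (direct_sum I X)" and F: "finite F" "F \<subseteq> I" "{i \<in> I. u i \<noteq> \<zero>\<^bsub>X i\<^esub>} \<subseteq> F"
    and X: "\<And>i. i \<in> I \<Longrightarrow> right_module A (X i)" and N: "right_module A N"
    and g: "\<And>i. i \<in> I \<Longrightarrow> g i \<in> Hom A (X i) N"
  shows "copair I X N g u = (\<Oplus>\<^bsub>N\<^esub>i\<in>F. g i (u i))"
proof -
  interpret N: right_module A N by fact
  have "(\<Oplus>\<^bsub>N\<^esub>i\<in>{i \<in> I. u i \<noteq> \<zero>\<^bsub>X i\<^esub>}. g i (u i)) = (\<Oplus>\<^bsub>N\<^esub>i\<in>F. g i (u i))"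
  proof (rule N.add.finprod_mono_neutral_cong_left)
    show "g i (u i) = \<zero>\<^bsub>N\<^esub>" if "i \<in> F - {i \<in> I. u i \<noteq> \<zero>\<^bsub>X i\<^esub>}" for i
    proof -
      have "i \<in> I" "u i = \<zero>\<^bsub>X i\<^esub>" using that F by auto
      then show ?thesis using Hom_zero[OF g X N] by simp
    qed
    show "(\<lambda>i. g i (u i)) \<in> F \<rightarrow> carrier N"
      using F(2) u Hom_closed[OF g] by (auto simp: PiE_mem subset_iff)
  qed (use F in auto)
  then show ?thesis using u by (simp add: copair_def)
qed

lemma copair_Hom:
  assumes "ring A" and X: "\<And>i. i \<in> I \<Longrightarrow> right_module A (X i)" and N: "right_module A N"
    and g: "\<And>i. i \<in> I \<Longrightarrow> g i \<in> Hom A (X i) N"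
  shows "copair I X N g \<in> Hom A (direct_sum I X) N"
proof -
  interpret N: right_module A N by fact
  interpret D: right_module A "direct_sum I X" using assms(1) X by (rule right_module_direct_sum)
  let ?supp = "\<lambda>u. {i \<in> I. u i \<noteq> \<zero>\<^bsub>X i\<^esub>}"
  have fin: "finite (?supp u)" if "u \<in> carrier (direct_sum I X)" for u using that by simp
  have cl: "g i (u i) \<in> carrier N" if "u \<in> carrier (direct_sum I X)" "i \<in> I" for u i
    using that Hom_closed[OF g] by (auto simp: PiE_mem)
  have mem: "u i \<in> carrier (X i)" if "u \<in> carrier (direct_sum I X)" "i \<in> I" for u i
    using that by (auto simp: PiE_mem)
  note eq = copair_eq_finsum[OF _ _ _ _ X N g]
  show ?thesis
  proof (rule HomI)
    show "copair I X N g \<in> extensional (carrier (direct_sum I X))" by (simp add: copair_def)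
    show "copair I X N g u \<in> carrier N" if "u \<in> carrier (direct_sum I X)" for u
      using that cl by (subst eq[OF that fin[OF that]]) (auto intro!: N.finsum_closed)
  next
    fix u v assume u: "u \<in> carrier (direct_sum I X)" and v: "v \<in> carrier (direct_sum I X)"
    \<comment> \<open>the three supports differ in general, so the sums are compared over their union\<close>
    have uv: "u \<oplus>\<^bsub>direct_sum I X\<^esub> v \<in> carrier (direct_sum I X)" using u v by (rule D.a_closed)
    let ?F = "?supp u \<union> ?supp v \<union> ?supp (u \<oplus>\<^bsub>direct_sum I X\<^esub> v)"
    have F: "finite ?F" "?F \<subseteq> I" using fin[OF u] fin[OF v] fin[OF uv] by auto
    have "copair I X N g (u \<oplus>\<^bsub>direct_sum I X\<^esub> v) = (\<Oplus>\<^bsub>N\<^esub>i\<in>?F. g i ((u \<oplus>\<^bsub>direct_sum I X\<^esub> v) i))"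
      using uv F by (rule eq) blast
    also have "\<dots> = (\<Oplus>\<^bsub>N\<^esub>i\<in>?F. g i (u i) \<oplus>\<^bsub>N\<^esub> g i (v i))"
    proof (rule N.finsum_cong')
      show "(\<lambda>i. g i (u i) \<oplus>\<^bsub>N\<^esub> g i (v i)) \<in> ?F \<rightarrow> carrier N" using cl[OF u] cl[OF v] by auto
      show "g i ((u \<oplus>\<^bsub>direct_sum I X\<^esub> v) i) = g i (u i) \<oplus>\<^bsub>N\<^esub> g i (v i)" if "i \<in> ?F" for i
        using that by (auto simp: Hom_add[OF g] mem[OF u] mem[OF v])
    qed simp
    also have "\<dots> = (\<Oplus>\<^bsub>N\<^esub>i\<in>?F. g i (u i)) \<oplus>\<^bsub>N\<^esub> (\<Oplus>\<^bsub>N\<^esub>i\<in>?F. g i (v i))"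
      by (rule N.finsum_addf) (use cl[OF u] cl[OF v] in auto)
    also have "(\<Oplus>\<^bsub>N\<^esub>i\<in>?F. g i (u i)) = copair I X N g u"
      using u F by (rule eq[symmetric]) blast
    also have "(\<Oplus>\<^bsub>N\<^esub>i\<in>?F. g i (v i)) = copair I X N g v"
      using v F by (rule eq[symmetric]) blast
    finally show "copair I X N g (u \<oplus>\<^bsub>direct_sum I X\<^esub> v) = copair I X N g u \<oplus>\<^bsub>N\<^esub> copair I X N g v" .
  next
    fix u a assume u: "u \<in> carrier (direct_sum I X)" and a: "a \<in> carrier A"
    have ua: "u \<triangleleft>\<^bsub>direct_sum I X\<^esub> a \<in> carrier (direct_sum I X)" using u a by (rule D.rsmult_closed)
    let ?F = "?supp u \<union> ?supp (u \<triangleleft>\<^bsub>direct_sum I X\<^esub> a)"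
    have F: "finite ?F" "?F \<subseteq> I" using fin[OF u] fin[OF ua] by auto
    have sum_act: "(\<Oplus>\<^bsub>N\<^esub>i\<in>F. w i) \<triangleleft>\<^bsub>N\<^esub> a = (\<Oplus>\<^bsub>N\<^esub>i\<in>F. w i \<triangleleft>\<^bsub>N\<^esub> a)"
      if "finite F" "\<And>i. i \<in> F \<Longrightarrow> w i \<in> carrier N" for F :: "'b set" and w
      using that
      by (induction F rule: finite_induct)
         (auto simp: N.rsmult_zero[OF a] N.finsum_insert Pi_def N.rsmult_add[OF _ _ a] N.rsmult_closed[OF _ a])
    have "copair I X N g (u \<triangleleft>\<^bsub>direct_sum I X\<^esub> a) = (\<Oplus>\<^bsub>N\<^esub>i\<in>?F. g i ((u \<triangleleft>\<^bsub>direct_sum I X\<^esub> a) i))"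
      using ua F by (rule eq) blast
    also have "\<dots> = (\<Oplus>\<^bsub>N\<^esub>i\<in>?F. g i (u i) \<triangleleft>\<^bsub>N\<^esub> a)"
    proof (rule N.finsum_cong')
      show "(\<lambda>i. g i (u i) \<triangleleft>\<^bsub>N\<^esub> a) \<in> ?F \<rightarrow> carrier N"
        using cl[OF u] N.rsmult_closed[OF _ a] by auto
      show "g i ((u \<triangleleft>\<^bsub>direct_sum I X\<^esub> a) i) = g i (u i) \<triangleleft>\<^bsub>N\<^esub> a" if "i \<in> ?F" for i
        using that by (auto simp: Hom_rsmult[OF g] mem[OF u] a)
    qed simp
    also have "\<dots> = (\<Oplus>\<^bsub>N\<^esub>i\<in>?F. g i (u i)) \<triangleleft>\<^bsub>N\<^esub> a"
      by (rule sum_act[symmetric]) (use F cl[OF u] in auto)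
    also have "(\<Oplus>\<^bsub>N\<^esub>i\<in>?F. g i (u i)) = copair I X N g u"
      using u F by (rule eq[symmetric]) blast
    finally show "copair I X N g (u \<triangleleft>\<^bsub>direct_sum I X\<^esub> a) = copair I X N g u \<triangleleft>\<^bsub>N\<^esub> a" .
  qed
qed

lemma copair_inj:
  assumes "ring A" and X: "\<And>i. i \<in> I \<Longrightarrow> right_module A (X i)" and N: "right_module A N"
    and g: "\<And>i. i \<in> I \<Longrightarrow> g i \<in> Hom A (X i) N" and i: "i \<in> I" "x \<in> carrier (X i)"
  shows "copair I X N g (direct_sum_inj I X i x) = g i x"
proof -
  interpret N: right_module A N by fact
  have u: "direct_sum_inj I X i x \<in> carrier (direct_sum I X)"
    using direct_sum_inj_Hom[OF assms(1) X i(1)] i(2) by (rule Hom_closed)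
  have "copair I X N g (direct_sum_inj I X i x) = (\<Oplus>\<^bsub>N\<^esub>j\<in>{i}. g j (direct_sum_inj I X i x j))"
    by (rule copair_eq_finsum[OF u _ _ _ X N g]) (use i in \<open>auto simp: direct_sum_inj_def\<close>)
  also have "\<dots> = g i x"
    using i Hom_closed[OF g[OF i(1)] i(2)] by (simp add: direct_sum_inj_def)
  finally show ?thesis .
qed

lemma Hom_copair:
  assumes f: "f \<in> Hom A M N" and u: "u \<in> carrier (direct_sum I X)"
    and X: "\<And>i. i \<in> I \<Longrightarrow> right_module A (X i)" and M: "right_module A M" and N: "right_module A N"
    and g: "\<And>i. i \<in> I \<Longrightarrow> g i \<in> Hom A (X i) M"
    and h: "\<And>i. i \<in> I \<Longrightarrow> h i \<in> Hom A (X i) N"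
    and eq: "\<And>i x. i \<in> I \<Longrightarrow> x \<in> carrier (X i) \<Longrightarrow> f (g i x) = h i x"
  shows "f (copair I X M g u) = copair I X N h u"
proof -
  interpret M: right_module A M by fact
  interpret N: right_module A N by fact
  let ?F = "{i \<in> I. u i \<noteq> \<zero>\<^bsub>X i\<^esub>}"
  have mem: "u i \<in> carrier (X i)" if "i \<in> I" for i using u that by (auto simp: PiE_mem)
  have "f (copair I X M g u) = f (\<Oplus>\<^bsub>M\<^esub>i\<in>?F. g i (u i))"
    using u by (simp add: copair_def)
  also have "\<dots> = (\<Oplus>\<^bsub>N\<^esub>i\<in>?F. f (g i (u i)))"
    by (rule Hom_finsum[OF f M N]) (use u mem Hom_closed[OF g] in auto)
  also have "\<dots> = (\<Oplus>\<^bsub>N\<^esub>i\<in>?F. h i (u i))"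
    by (rule N.finsum_cong') (use mem eq Hom_closed[OF h] in auto)
  also have "\<dots> = copair I X N h u" using u by (simp add: copair_def)
  finally show ?thesis .
qed

text \<open>
  Both sides have the same image under each projection. This equation makes homomorphisms out of a
  coproduct determined by their components.
\<close>

lemma copair_direct_sum_inj:
  fixes A :: "'a ring"
  assumes "ring A" and X: "\<And>i. i \<in> I \<Longrightarrow> right_module A (X i)" and u: "u \<in> carrier (direct_sum I X)"
  shows "copair I X (direct_sum I X) (direct_sum_inj I X) u = u"
proof -
  interpret D: right_module A "direct_sum I X" using assms(1) X by (rule right_module_direct_sum)
  have inj: "direct_sum_inj I X i \<in> Hom A (X i) (direct_sum I X)" if "i \<in> I" for i
    using assms(1) X that by (rule direct_sum_inj_Hom)
  note D = D.right_module_axioms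
  let ?v = "copair I X (direct_sum I X) (direct_sum_inj I X) u"
  let ?F = "{i \<in> I. u i \<noteq> \<zero>\<^bsub>X i\<^esub>}"
  have mem: "u i \<in> carrier (X i)" if "i \<in> I" for i using u that by (auto simp: PiE_mem)
  have v: "?v \<in> carrier (direct_sum I X)"
    using copair_Hom[OF assms(1) X D inj] u by (rule Hom_closed)
  have comp: "?v j = u j" if j: "j \<in> I" for j
  proof -
    interpret Xj: right_module A "X j" using X[OF j] .
    define p where "p = (\<lambda>w\<in>carrier (direct_sum I X). w j)"
    have "(\<lambda>w\<in>carrier (direct_sum I X). (\<lambda>w\<in>carrier (direct_sum I X). w) w j) \<in> Hom A (direct_sum I X) (X j)"
      by (rule Hom_direct_product_component[OF Hom_direct_sum_product[OF id_Hom[OF D]] j D])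
    also have "(\<lambda>w\<in>carrier (direct_sum I X). (\<lambda>w\<in>carrier (direct_sum I X). w) w j) = p"
      by (auto simp: p_def)
    finally have p: "p \<in> Hom A (direct_sum I X) (X j)" .
    have pinj: "p (direct_sum_inj I X i x) = (if i = j then x else \<zero>\<^bsub>X j\<^esub>)"
      if "i \<in> I" "x \<in> carrier (X i)" for i x
    proof -
      have "p (direct_sum_inj I X i x) = direct_sum_inj I X i x j"
        using Hom_closed[OF inj[OF that(1)] that(2)] by (simp only: p_def restrict_apply if_True)
      then show ?thesis using that j by (auto simp: direct_sum_inj_def)
    qed
    have "?v = (\<Oplus>\<^bsub>direct_sum I X\<^esub>i\<in>insert j ?F. direct_sum_inj I X i (u i))"
      by (rule copair_eq_finsum[OF u _ _ _ X D inj]) (use u j in auto)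
    then have "?v j = p (\<Oplus>\<^bsub>direct_sum I X\<^esub>i\<in>insert j ?F. direct_sum_inj I X i (u i))"
      using v by (simp only: p_def restrict_apply if_True)
    also have "\<dots> = (\<Oplus>\<^bsub>X j\<^esub>i\<in>insert j ?F. p (direct_sum_inj I X i (u i)))"
      by (rule Hom_finsum[OF p D X[OF j]]) (use u j mem Hom_closed[OF inj] in auto)
    also have "\<dots> = (\<Oplus>\<^bsub>X j\<^esub>i\<in>{j}. u j)"
      by (rule Xj.add.finprod_mono_neutral_cong_right)
         (use u j mem in \<open>auto simp: pinj\<close>)
    also have "\<dots> = u j" using mem[OF j] by simp
    finally show ?thesis .
  qed
  show ?thesis
    using u v comp by (auto intro!: PiE_ext[of _ I "\<lambda>i. carrier (X i)"])
qed

definition direct_sum_map ::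
    "'i set \<Rightarrow> ('i \<Rightarrow> ('a, 'm) rmodule) \<Rightarrow> ('i \<Rightarrow> 'm \<Rightarrow> 'n) \<Rightarrow> ('i \<Rightarrow> 'm) \<Rightarrow> 'i \<Rightarrow> 'n" where
  "direct_sum_map I X s = (\<lambda>u\<in>carrier (direct_sum I X). \<lambda>i\<in>I. s i (u i))"

lemma direct_sum_map_Hom:
  fixes A :: "'a ring"
  assumes "ring A" and X: "\<And>i. i \<in> I \<Longrightarrow> right_module A (X i)" and Y: "\<And>i. i \<in> I \<Longrightarrow> right_module A (Y i)"
    and s: "\<And>i. i \<in> I \<Longrightarrow> s i \<in> Hom A (X i) (Y i)"
  shows "direct_sum_map I X s \<in> Hom A (direct_sum I X) (direct_sum I Y)"
proof -
  interpret D: right_module A "direct_sum I X" using assms(1) X by (rule right_module_direct_sum)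
  note D = D.right_module_axioms
  let ?f = "\<lambda>i. compose (carrier (direct_sum I X)) (s i) (\<lambda>u\<in>carrier (direct_sum I X). u i)"
  have f: "?f i \<in> Hom A (direct_sum I X) (Y i)" if i: "i \<in> I" for i
  proof (rule Hom_compose[OF _ s[OF i] D])
    have "(\<lambda>w\<in>carrier (direct_sum I X). (\<lambda>w\<in>carrier (direct_sum I X). w) w i) \<in> Hom A (direct_sum I X) (X i)"
      by (rule Hom_direct_product_component[OF Hom_direct_sum_product[OF id_Hom[OF D]] i D])
    also have "(\<lambda>w\<in>carrier (direct_sum I X). (\<lambda>w\<in>carrier (direct_sum I X). w) w i) =
        (\<lambda>u\<in>carrier (direct_sum I X). u i)"
      by (rule restrict_ext) (simp only: restrict_apply if_True)
    finally show "(\<lambda>u\<in>carrier (direct_sum I X). u i) \<in> Hom A (direct_sum I X) (X i)" .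
  qed
  have fu: "?f i u = s i (u i)" if "u \<in> carrier (direct_sum I X)" for i u
    using that by (simp only: compose_def restrict_apply if_True)
  have "(\<lambda>u\<in>carrier (direct_sum I X). \<lambda>i\<in>I. ?f i u) \<in> Hom A (direct_sum I X) (direct_sum I Y)"
  proof (rule Hom_into_direct_sum[OF f D])
    fix u assume u: "u \<in> carrier (direct_sum I X)"
    have "s i \<zero>\<^bsub>X i\<^esub> = \<zero>\<^bsub>Y i\<^esub>" if "i \<in> I" for i
      by (rule Hom_zero[OF s[OF that] X[OF that] Y[OF that]])
    then have "{i \<in> I. ?f i u \<noteq> \<zero>\<^bsub>Y i\<^esub>} \<subseteq> {i \<in> I. u i \<noteq> \<zero>\<^bsub>X i\<^esub>}"
      unfolding fu[OF u] by auto
    then show "finite {i \<in> I. ?f i u \<noteq> \<zero>\<^bsub>Y i\<^esub>}"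
      using u by (elim finite_subset) simp
  qed
  also have "(\<lambda>u\<in>carrier (direct_sum I X). \<lambda>i\<in>I. ?f i u) = direct_sum_map I X s"
    unfolding direct_sum_map_def by (rule restrict_ext) (simp only: fu)
  finally show ?thesis .
qed

lemma copair_direct_sum_map:
  fixes A :: "'a ring"
  assumes "ring A" and X: "\<And>i. i \<in> I \<Longrightarrow> right_module A (X i)" and Y: "\<And>i. i \<in> I \<Longrightarrow> right_module A (Y i)"
    and N: "right_module A N"
    and s: "\<And>i. i \<in> I \<Longrightarrow> s i \<in> Hom A (X i) (Y i)"
    and g: "\<And>i. i \<in> I \<Longrightarrow> g i \<in> Hom A (Y i) N"
    and h: "\<And>i. i \<in> I \<Longrightarrow> h i \<in> Hom A (X i) N"
    and eq: "\<And>i x. i \<in> I \<Longrightarrow> x \<in> carrier (X i) \<Longrightarrow> g i (s i x) = h i x"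
    and u: "u \<in> carrier (direct_sum I X)"
  shows "copair I Y N g (direct_sum_map I X s u) = copair I X N h u"
proof -
  interpret N: right_module A N by fact
  let ?v = "direct_sum_map I X s u"
  have v: "?v \<in> carrier (direct_sum I Y)"
    using direct_sum_map_Hom[OF assms(1) X Y s] u by (rule Hom_closed)
  have vi: "?v i = s i (u i)" if "i \<in> I" for i
    using u that by (simp only: direct_sum_map_def restrict_apply if_True)
  have ui: "u i \<in> carrier (X i)" if "i \<in> I" for i using u that by auto
  let ?F = "{i \<in> I. u i \<noteq> \<zero>\<^bsub>X i\<^esub>} \<union> {i \<in> I. ?v i \<noteq> \<zero>\<^bsub>Y i\<^esub>}"
  have F: "finite ?F" "?F \<subseteq> I" using u v by auto
  have "copair I Y N g ?v = (\<Oplus>\<^bsub>N\<^esub>i\<in>?F. g i (?v i))"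
    by (rule copair_eq_finsum[OF v F _ Y N g]) auto
  also have "\<dots> = (\<Oplus>\<^bsub>N\<^esub>i\<in>?F. h i (u i))"
    by (rule N.finsum_cong') (use F(2) Hom_closed[OF h ui] in \<open>auto simp: vi eq ui\<close>)
  also have "\<dots> = copair I X N h u"
    by (rule copair_eq_finsum[OF u F _ X N h, symmetric]) auto
  finally show ?thesis .
qed

text \<open>
  Preimages of the entries form an element of finite support as soon as zero is chosen as the
  preimage of zero.
\<close>

lemma direct_sum_map_exact:
  fixes A :: "'a ring"
  assumes "ring A" and X: "\<And>i. i \<in> I \<Longrightarrow> right_module A (X i)"
    and Y: "\<And>i. i \<in> I \<Longrightarrow> right_module A (Y i)"
    and s: "\<And>i. i \<in> I \<Longrightarrow> s i \<in> Hom A (X i) (Y i)"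
    and v: "v \<in> carrier (direct_sum I Y)" and im: "\<And>i. i \<in> I \<Longrightarrow> v i \<in> s i ` carrier (X i)"
  obtains u where "u \<in> carrier (direct_sum I X)" "direct_sum_map I X s u = v"
proof -
  define u where "u = (\<lambda>i\<in>I. if v i = \<zero>\<^bsub>Y i\<^esub> then \<zero>\<^bsub>X i\<^esub> else inv_into (carrier (X i)) (s i) (v i))"
  have zX: "\<zero>\<^bsub>X i\<^esub> \<in> carrier (X i)" if "i \<in> I" for i
    using X[OF that] by (simp add: right_module_def abelian_groupE(2))
  have ui: "u i \<in> carrier (X i)" "s i (u i) = v i" if "i \<in> I" for i
    using im[OF that] zX[OF that] Hom_zero[OF s[OF that] X[OF that] Y[OF that]] that
    by (auto simp: u_def inv_into_into f_inv_into_f)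
  have "{i \<in> I. u i \<noteq> \<zero>\<^bsub>X i\<^esub>} \<subseteq> {i \<in> I. v i \<noteq> \<zero>\<^bsub>Y i\<^esub>}"
    by (auto simp: u_def)
  then have "finite {i \<in> I. u i \<noteq> \<zero>\<^bsub>X i\<^esub>}" using v by (elim finite_subset) simp
  moreover have "u \<in> extensional I" by (simp add: u_def)
  ultimately have u: "u \<in> carrier (direct_sum I X)" using ui(1) by (simp add: PiE_def Pi_def)
  have "direct_sum_map I X s u = (\<lambda>i\<in>I. s i (u i))"
    using u by (simp only: direct_sum_map_def restrict_apply if_True)
  also have "\<dots> = (\<lambda>i\<in>I. v i)" by (rule restrict_ext) (rule ui(2))
  also have "\<dots> = v" using v by (auto intro: PiE_restrict)
  finally show thesis using that u by blast
qed

lemma binary_sum_simps [simp]: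
  "carrier (binary_sum M N) = carrier M \<times> carrier N"
  "\<zero>\<^bsub>binary_sum M N\<^esub> = (\<zero>\<^bsub>M\<^esub>, \<zero>\<^bsub>N\<^esub>)"
  "(x, y) \<oplus>\<^bsub>binary_sum M N\<^esub> (x', y') = (x \<oplus>\<^bsub>M\<^esub> x', y \<oplus>\<^bsub>N\<^esub> y')"
  "(x, y) \<triangleleft>\<^bsub>binary_sum M N\<^esub> a = (x \<triangleleft>\<^bsub>M\<^esub> a, y \<triangleleft>\<^bsub>N\<^esub> a)"
  by (simp_all add: binary_sum_def)

lemma right_module_binary_sum:
  assumes "right_module A M" "right_module A N"
  shows "right_module A (binary_sum M N)"
proof -
  interpret M: right_module A M by fact
  interpret N: right_module A N by fact
  show ?thesis
  proof (rule right_moduleI)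
    show "ring A" by (rule M.R.ring_axioms)
    show "\<exists>w\<in>carrier (binary_sum M N). w \<oplus>\<^bsub>binary_sum M N\<^esub> z = \<zero>\<^bsub>binary_sum M N\<^esub>"
      if "z \<in> carrier (binary_sum M N)" for z
      using that
      by (intro bexI[of _ "(\<ominus>\<^bsub>M\<^esub> fst z, \<ominus>\<^bsub>N\<^esub> snd z)"]) (auto simp: M.l_neg N.l_neg)
  next
    fix z w assume "z \<in> carrier (binary_sum M N)" "w \<in> carrier (binary_sum M N)"
    then show "z \<oplus>\<^bsub>binary_sum M N\<^esub> w = w \<oplus>\<^bsub>binary_sum M N\<^esub> z"
      by (cases z; cases w) (simp add: M.a_comm N.a_comm)
  qed (auto simp: M.a_assoc N.a_assoc M.rsmult_closed N.rsmult_closed M.rsmult_add N.rsmult_add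
      M.rsmult_add_ring N.rsmult_add_ring M.rsmult_assoc N.rsmult_assoc M.rsmult_one N.rsmult_one)
qed

lemma binary_sum_copair_Hom:
  assumes f: "f \<in> Hom A M Z" and g: "g \<in> Hom A N Z"
    and "right_module A M" "right_module A N" "right_module A Z"
  shows "(\<lambda>z\<in>carrier (binary_sum M N). f (fst z) \<oplus>\<^bsub>Z\<^esub> g (snd z)) \<in> Hom A (binary_sum M N) Z"
proof -
  interpret Z: right_module A Z by fact
  note cl = Hom_closed[OF f] Hom_closed[OF g]
  show ?thesis
  proof (rule restrict_HomI)
    show "right_module A (binary_sum M N)" using assms(3,4) by (rule right_module_binary_sum)
    show "f (fst z) \<oplus>\<^bsub>Z\<^esub> g (snd z) \<in> carrier Z" if "z \<in> carrier (binary_sum M N)" for z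
      using that cl by auto
  next
    fix z w assume "z \<in> carrier (binary_sum M N)" "w \<in> carrier (binary_sum M N)"
    then obtain x y x' y' where z: "z = (x, y)" "w = (x', y')"
      and x: "x \<in> carrier M" "x' \<in> carrier M" and y: "y \<in> carrier N" "y' \<in> carrier N"
      by (cases z; cases w) auto
    show "f (fst (z \<oplus>\<^bsub>binary_sum M N\<^esub> w)) \<oplus>\<^bsub>Z\<^esub> g (snd (z \<oplus>\<^bsub>binary_sum M N\<^esub> w)) =
        f (fst z) \<oplus>\<^bsub>Z\<^esub> g (snd z) \<oplus>\<^bsub>Z\<^esub> (f (fst w) \<oplus>\<^bsub>Z\<^esub> g (snd w))"
      unfolding z binary_sum_simps fst_conv snd_conv Hom_add[OF f x] Hom_add[OF g y]
      by (rule Z.a_swap) (use cl x y in auto)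
  next
    fix z a assume "z \<in> carrier (binary_sum M N)" "a \<in> carrier A"
    then show "f (fst (z \<triangleleft>\<^bsub>binary_sum M N\<^esub> a)) \<oplus>\<^bsub>Z\<^esub> g (snd (z \<triangleleft>\<^bsub>binary_sum M N\<^esub> a)) =
        (f (fst z) \<oplus>\<^bsub>Z\<^esub> g (snd z)) \<triangleleft>\<^bsub>Z\<^esub> a"
      by (cases z) (simp add: Hom_rsmult[OF f] Hom_rsmult[OF g] Z.rsmult_add cl)
  qed
qed

text \<open>
  Arguments about the pushout take place in the biproduct \<open>B\<close> of \<open>M\<close> and \<open>N\<close>, of which the pushout
  is the quotient by the relations \<open>(f x, - g x)\<close>; \<open>c\<close> denotes the projection.
\<close>

locale pushout_data =
  fixes A :: "'a ring" and L :: "('a, 'l) rmodule" and M :: "('a, 'm) rmodule"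
    and N :: "('a, 'n) rmodule" and f :: "'l \<Rightarrow> 'm" and g :: "'l \<Rightarrow> 'n"
  assumes L: "right_module A L" and M: "right_module A M" and N: "right_module A N"
    and f: "f \<in> Hom A L M" and g: "g \<in> Hom A L N"
begin

abbreviation B where "B \<equiv> binary_sum M N"
abbreviation PO where "PO \<equiv> pushout L M N f g"
abbreviation c where "c \<equiv> quotient_map B (pushout_rel L N f g)"

lemma rel_submodule: "rsubmodule A B (pushout_rel L N f g)"
proof -
  interpret N: right_module A N by (rule N)
  have "(\<lambda>x\<in>carrier L. (f x, \<ominus>\<^bsub>N\<^esub> g x)) \<in> Hom A L B"
    by (rule restrict_HomI[OF L])
       (auto simp: Hom_closed[OF f] Hom_closed[OF g] Hom_add[OF f] Hom_add[OF g] N.minus_add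
          Hom_rsmult[OF f] Hom_rsmult[OF g] N.rsmult_a_inv)
  then have "rsubmodule A B ((\<lambda>x\<in>carrier L. (f x, \<ominus>\<^bsub>N\<^esub> g x)) ` carrier L)"
    using L right_module_binary_sum[OF M N] by (rule rsubmodule_image)
  then show ?thesis by (simp add: pushout_rel_def)
qed

lemma right_module_B: "right_module A B"
  using M N by (rule right_module_binary_sum)

lemma right_module_pushout: "right_module A PO"
  unfolding pushout_def by (rule quotient_module(1)[OF rel_submodule right_module_B])

lemma c_surj: "surj_hom A B PO c"
  unfolding pushout_def by (rule quotient_module(2)[OF rel_submodule right_module_B])

lemma c_Hom: "c \<in> Hom A B PO"
  using c_surj by (simp add: surj_hom_def)

lemma c_eq_zero_iff:
  assumes "z \<in> carrier B"
  shows "c z = \<zero>\<^bsub>PO\<^esub> \<longleftrightarrow> (\<exists>x\<in>carrier L. z = (f x, \<ominus>\<^bsub>N\<^esub> g x))"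
proof -
  have "a_kernel B PO c = pushout_rel L N f g"
    unfolding pushout_def by (rule quotient_module(3)[OF rel_submodule right_module_B])
  then have "z \<in> a_kernel B PO c \<longleftrightarrow> (\<exists>x\<in>carrier L. z = (f x, \<ominus>\<^bsub>N\<^esub> g x))"
    by (auto simp: pushout_rel_def)
  then show ?thesis using assms by (simp add: a_kernel_def')
qed

lemma pushout_map_Hom: "pushout_map L M N f g \<in> Hom A M PO"
proof -
  interpret N: right_module A N by (rule N)
  show ?thesis
    unfolding pushout_map_def
    by (rule restrict_HomI[OF M])
       (auto simp: Hom_add[OF c_Hom, symmetric] Hom_rsmult[OF c_Hom, symmetric] N.rsmult_zero
          intro!: Hom_closed[OF c_Hom])
qed

definition cospan_map :: "'n \<Rightarrow> ('m \<times> 'n) set" where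
  "cospan_map = (\<lambda>y\<in>carrier N. c (\<zero>\<^bsub>M\<^esub>, y))"

lemma cospan_map_Hom: "cospan_map \<in> Hom A N PO"
proof -
  interpret M: right_module A M by (rule M)
  show ?thesis
    unfolding cospan_map_def
    by (rule restrict_HomI[OF N])
       (auto simp: Hom_add[OF c_Hom, symmetric] Hom_rsmult[OF c_Hom, symmetric] M.rsmult_zero
          intro!: Hom_closed[OF c_Hom])
qed

lemma c_split:
  assumes "x \<in> carrier M" "y \<in> carrier N"
  shows "c (x, y) = pushout_map L M N f g x \<oplus>\<^bsub>PO\<^esub> cospan_map y"
proof -
  interpret M: right_module A M by (rule M)
  interpret N: right_module A N by (rule N)
  show ?thesis
    using assms by (simp add: pushout_map_def cospan_map_def Hom_add[OF c_Hom, symmetric])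
qed

lemma pushout_commutes:
  assumes "x \<in> carrier L"
  shows "pushout_map L M N f g (f x) = cospan_map (g x)"
proof -
  interpret N: right_module A N by (rule N)
  interpret PO: right_module A PO by (rule right_module_pushout)
  note cl = Hom_closed[OF f assms] Hom_closed[OF g assms]
  note pcl = Hom_closed[OF pushout_map_Hom cl(1)] Hom_closed[OF cospan_map_Hom cl(2)]
  have "c (f x, \<ominus>\<^bsub>N\<^esub> g x) = \<zero>\<^bsub>PO\<^esub>"
    using assms cl by (subst c_eq_zero_iff) auto
  then have "\<zero>\<^bsub>PO\<^esub> = c (f x, \<ominus>\<^bsub>N\<^esub> g x)" by simp
  also have "\<dots> = pushout_map L M N f g (f x) \<oplus>\<^bsub>PO\<^esub> cospan_map (\<ominus>\<^bsub>N\<^esub> g x)"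
    using cl by (intro c_split) auto
  also have "\<dots> = pushout_map L M N f g (f x) \<ominus>\<^bsub>PO\<^esub> cospan_map (g x)"
    using Hom_a_inv[OF cospan_map_Hom N right_module_pushout cl(2)] by (simp add: a_minus_def)
  finally show ?thesis
    using PO.minus_eq_zeroD pcl by metis
qed

lemma pushout_universal:
  assumes h: "h \<in> Hom A M Z" and k: "k \<in> Hom A N Z" and Z: "right_module A Z"
    and eq: "\<And>x. x \<in> carrier L \<Longrightarrow> h (f x) = k (g x)"
  obtains e where "e \<in> Hom A PO Z" "\<And>x. x \<in> carrier M \<Longrightarrow> e (pushout_map L M N f g x) = h x"
    "\<And>y. y \<in> carrier N \<Longrightarrow> e (cospan_map y) = k y"
proof -
  interpret M: right_module A M by (rule M)
  interpret N: right_module A N by (rule N)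
  interpret Z: right_module A Z by fact
  let ?hk = "\<lambda>z\<in>carrier B. h (fst z) \<oplus>\<^bsub>Z\<^esub> k (snd z)"
  have hk: "?hk \<in> Hom A B Z" using h k M N Z by (rule binary_sum_copair_Hom)
  have "?hk z = \<zero>\<^bsub>Z\<^esub>" if z: "z \<in> carrier B" "c z = \<zero>\<^bsub>PO\<^esub>" for z
  proof -
    obtain x where x: "x \<in> carrier L" "z = (f x, \<ominus>\<^bsub>N\<^esub> g x)"
      using c_eq_zero_iff z by auto
    note cl = Hom_closed[OF g x(1)]
    have "?hk z = k (g x) \<oplus>\<^bsub>Z\<^esub> \<ominus>\<^bsub>Z\<^esub> k (g x)"
      using x z(1) cl by (simp add: eq Hom_a_inv[OF k N Z])
    then show ?thesis using Hom_closed[OF k cl] by (simp add: Z.r_neg)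
  qed
  then obtain e where e: "e \<in> Hom A PO Z" "\<And>z. z \<in> carrier B \<Longrightarrow> e (c z) = ?hk z"
    using Hom_factor_surj[OF c_surj hk right_module_B right_module_pushout Z] by blast
  show thesis
  proof (rule that[OF e(1)])
    show "e (pushout_map L M N f g x) = h x" if "x \<in> carrier M" for x
      using that e(2)[of "(x, \<zero>\<^bsub>N\<^esub>)"] Hom_zero[OF k N Z] Hom_closed[OF h] by (simp add: pushout_map_def)
    show "e (cospan_map y) = k y" if "y \<in> carrier N" for y
      using that e(2)[of "(\<zero>\<^bsub>M\<^esub>, y)"] Hom_zero[OF h M Z] Hom_closed[OF k] by (simp add: cospan_map_def)
  qed
qed

text \<open>
  This is why opposite sides of a pushout square have the same cokernel: modulo the image of \<open>M\<close> every class is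
  represented by some \<open>y\<close> in \<open>N\<close>, and if \<open>y = g l\<close>, then its class is that of \<open>f l\<close>.
\<close>

lemma pushout_cokernel:
  assumes d: "surj_hom A N W d" and W: "right_module A W"
    and ker: "\<And>y. y \<in> carrier N \<Longrightarrow> d y = \<zero>\<^bsub>W\<^esub> \<longleftrightarrow> y \<in> g ` carrier L"
  obtains e where "surj_hom A PO W e"
    "\<And>m. m \<in> carrier PO \<Longrightarrow> e m = \<zero>\<^bsub>W\<^esub> \<longleftrightarrow> m \<in> pushout_map L M N f g ` carrier M"
proof -
  interpret M: right_module A M by (rule M)
  interpret W: right_module A W by fact
  have dH: "d \<in> Hom A N W" and onto: "d ` carrier N = carrier W"
    using d by (auto simp: surj_hom_def)
  have "zero_hom M W (f x) = d (g x)" if x: "x \<in> carrier L" for x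
    using ker[OF Hom_closed[OF g x]] Hom_closed[OF f x] x by (simp add: zero_hom_def)
  then obtain e where e: "e \<in> Hom A PO W"
      "\<And>x. x \<in> carrier M \<Longrightarrow> e (pushout_map L M N f g x) = zero_hom M W x"
      "\<And>y. y \<in> carrier N \<Longrightarrow> e (cospan_map y) = d y"
    using pushout_universal[OF zero_hom_Hom[OF M W] dH W] by metis
  have "w \<in> e ` carrier PO" if "w \<in> carrier W" for w
  proof -
    obtain y where y: "y \<in> carrier N" "w = d y" using onto \<open>w \<in> carrier W\<close> by auto
    then show ?thesis
      using e(3)[OF y(1)] Hom_closed[OF cospan_map_Hom y(1)] by (metis imageI)
  qed
  then have "surj_hom A PO W e"
    using e(1) Hom_closed[OF e(1)] by (auto simp: surj_hom_def)
  moreover have "e m = \<zero>\<^bsub>W\<^esub> \<longleftrightarrow> m \<in> pushout_map L M N f g ` carrier M" if m: "m \<in> carrier PO" for m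
  proof
    assume "m \<in> pushout_map L M N f g ` carrier M"
    then show "e m = \<zero>\<^bsub>W\<^esub>" using e(2) by (auto simp: zero_hom_def)
  next
    assume em: "e m = \<zero>\<^bsub>W\<^esub>"
    have "m \<in> c ` carrier B" using m c_surj by (simp only: surj_hom_def)
    then obtain x y where xy: "x \<in> carrier M" "y \<in> carrier N" and m': "m = c (x, y)" by auto
    note cl = Hom_closed[OF pushout_map_Hom xy(1)] Hom_closed[OF cospan_map_Hom xy(2)]
    have "e m = d y"
      using Hom_closed[OF dH xy(2)]
      by (simp add: m' c_split xy Hom_add[OF e(1)] cl e(2,3) zero_hom_def)
    then obtain l where l: "l \<in> carrier L" "y = g l"
      using em ker[OF xy(2)] by auto
    have "m = pushout_map L M N f g (x \<oplus>\<^bsub>M\<^esub> f l)"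
      using xy l by (simp add: m' c_split pushout_commutes[symmetric] Hom_add[OF pushout_map_Hom] Hom_closed[OF f])
    then show "m \<in> pushout_map L M N f g ` carrier M"
      using xy(1) Hom_closed[OF f l(1)] by auto
  qed
  ultimately show thesis by (rule that)
qed

end


section \<open>Projective modules as retracts of free modules\<close>

definition regular_module :: "'a ring \<Rightarrow> ('a, 'a) rmodule" where
  "regular_module A = \<lparr>carrier = carrier A, mult = undefined, one = undefined,
     zero = \<zero>\<^bsub>A\<^esub>, add = add A, rsmult = mult A\<rparr>"

lemma regular_module_simps [simp]:
  "carrier (regular_module A) = carrier A"
  "\<zero>\<^bsub>regular_module A\<^esub> = \<zero>\<^bsub>A\<^esub>"
  "x \<oplus>\<^bsub>regular_module A\<^esub> y = x \<oplus>\<^bsub>A\<^esub> y"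
  "x \<triangleleft>\<^bsub>regular_module A\<^esub> a = x \<otimes>\<^bsub>A\<^esub> a"
  by (simp_all add: regular_module_def)

lemma right_module_regular:
  assumes "ring A"
  shows "right_module A (regular_module A)"
proof -
  interpret ring A by fact
  show ?thesis
    by (rule right_moduleI[OF assms])
       (use a_inv_closed l_neg in \<open>auto simp: a_assoc r_distr l_distr m_assoc intro: a_comm\<close>)
qed

definition free_module :: "'a ring \<Rightarrow> 'b set \<Rightarrow> ('a, 'b \<Rightarrow> 'a) rmodule" where
  "free_module A S = direct_sum S (\<lambda>_. regular_module A)"

definition free_extend ::
    "'a ring \<Rightarrow> 'b set \<Rightarrow> ('a, 'm) rmodule \<Rightarrow> ('b \<Rightarrow> 'm) \<Rightarrow> ('b \<Rightarrow> 'a) \<Rightarrow> 'm" where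
  "free_extend A S M m = copair S (\<lambda>_. regular_module A) M (\<lambda>b. \<lambda>r\<in>carrier A. m b \<triangleleft>\<^bsub>M\<^esub> r)"

text \<open>
  Lifting against the modules of one type is turned into this property, which no longer mentions
  test modules and therefore provides lifts between modules of every type.
\<close>

definition free_retract :: "'a ring \<Rightarrow> ('a, 'p) rmodule \<Rightarrow> bool" where
  "free_retract A P \<longleftrightarrow>
    (\<exists>s\<in>Hom A P (free_module A (carrier P)).
      \<forall>x\<in>carrier P. free_extend A (carrier P) P (\<lambda>b. b) (s x) = x)"

lemma right_module_free:
  assumes "ring A"
  shows "right_module A (free_module A S)"
  unfolding free_module_def by (intro right_module_direct_sum right_module_regular assms)

lemma act_Hom:
  assumes "right_module A M" "x \<in> carrier M"
  shows "(\<lambda>r\<in>carrier A. x \<triangleleft>\<^bsub>M\<^esub> r) \<in> Hom A (regular_module A) M"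
proof -
  interpret M: right_module A M by fact
  have "(\<lambda>r\<in>carrier (regular_module A). x \<triangleleft>\<^bsub>M\<^esub> r) \<in> Hom A (regular_module A) M"
    by (rule restrict_HomI[OF right_module_regular])
       (use assms(2) in \<open>auto simp: M.R.ring_axioms M.rsmult_closed M.rsmult_add_ring M.rsmult_assoc\<close>)
  then show ?thesis by simp
qed

lemma free_extend_Hom:
  assumes "right_module A M" "\<And>b. b \<in> S \<Longrightarrow> m b \<in> carrier M"
  shows "free_extend A S M m \<in> Hom A (free_module A S) M"
proof -
  interpret M: right_module A M by fact
  show ?thesis
    unfolding free_extend_def free_module_def
    by (rule copair_Hom[OF M.R.ring_axioms right_module_regular[OF M.R.ring_axioms] assms(1)])
       (rule act_Hom[OF assms(1) assms(2)])
qed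

lemma Hom_free_extend:
  assumes f: "f \<in> Hom A M N" and M: "right_module A M" and N: "right_module A N"
    and m: "\<And>b. b \<in> S \<Longrightarrow> m b \<in> carrier M" and u: "u \<in> carrier (free_module A S)"
    and n: "\<And>b. b \<in> S \<Longrightarrow> f (m b) = n b"
  shows "f (free_extend A S M m u) = free_extend A S N n u"
proof -
  interpret M: right_module A M by fact
  have nc: "n b \<in> carrier N" if "b \<in> S" for b using Hom_closed[OF f m[OF that]] n[OF that] by simp
  show ?thesis
    unfolding free_extend_def
    by (rule Hom_copair[OF f u[unfolded free_module_def] right_module_regular[OF M.R.ring_axioms] M N
          act_Hom[OF M m] act_Hom[OF N nc]])
       (simp_all add: Hom_rsmult[OF f] m n)
qed

text \<open>
  The lift sends each generator to an arbitrary preimage; freeness makes this choice a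
  homomorphism on the free module, and the section \<open>s\<close> restricts it to \<open>P\<close>.
\<close>

lemma free_retract_lift:
  assumes "free_retract A P" and P: "right_module A P" and M: "right_module A M" and N: "right_module A N"
    and g: "surj_hom A M N g" and f: "f \<in> Hom A P N"
  obtains h where "h \<in> Hom A P M" "\<And>x. x \<in> carrier P \<Longrightarrow> g (h x) = f x"
proof -
  obtain s where s: "s \<in> Hom A P (free_module A (carrier P))"
    and sx: "\<And>x. x \<in> carrier P \<Longrightarrow> free_extend A (carrier P) P (\<lambda>b. b) (s x) = x"
    using assms(1) unfolding free_retract_def by blast
  have gH: "g \<in> Hom A M N" and onto: "g ` carrier M = carrier N" using g by (auto simp: surj_hom_def)
  define m where "m b = inv_into (carrier M) g (f b)" for b
  have m: "m b \<in> carrier M" "g (m b) = f b" if "b \<in> carrier P" for b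
    using Hom_closed[OF f that] onto by (auto simp: m_def inv_into_into f_inv_into_f)
  define h where "h = compose (carrier P) (free_extend A (carrier P) M m) s"
  show thesis
  proof (rule that)
    show "h \<in> Hom A P M"
      unfolding h_def by (rule Hom_compose[OF s free_extend_Hom[OF M m(1)] P])
    show "g (h x) = f x" if x: "x \<in> carrier P" for x
    proof -
      have "g (h x) = g (free_extend A (carrier P) M m (s x))" using x by (simp add: h_def compose_def)
      also have "\<dots> = free_extend A (carrier P) N f (s x)"
        by (rule Hom_free_extend[OF gH M N m(1) Hom_closed[OF s x] m(2)])
      also have "\<dots> = f (free_extend A (carrier P) P (\<lambda>b. b) (s x))"
        by (rule Hom_free_extend[OF f P N _ Hom_closed[OF s x], symmetric]) auto
      also have "\<dots> = f x" by (simp add: sx[OF x])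
      finally show ?thesis .
    qed
  qed
qed

lemma free_extend_generator:
  assumes P: "right_module A P" and x: "x \<in> carrier P"
  shows "x \<in> free_extend A (carrier P) P (\<lambda>b. b) ` carrier (free_module A (carrier P))"
proof -
  interpret P: right_module A P by fact
  let ?X = "\<lambda>_. regular_module A" and ?g = "\<lambda>b. \<lambda>r\<in>carrier A. b \<triangleleft>\<^bsub>P\<^esub> r"
  let ?u = "direct_sum_inj (carrier P) ?X x \<one>\<^bsub>A\<^esub>"
  have R: "right_module A (regular_module A)" by (rule right_module_regular[OF P.R.ring_axioms])
  have "free_extend A (carrier P) P (\<lambda>b. b) ?u = ?g x \<one>\<^bsub>A\<^esub>"
    unfolding free_extend_def
    by (rule copair_inj[OF P.R.ring_axioms R P act_Hom[OF P] x]) auto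
  also have "\<dots> = x" using x by (simp add: P.rsmult_one)
  finally have "x = free_extend A (carrier P) P (\<lambda>b. b) ?u" by simp
  moreover have "?u \<in> carrier (free_module A (carrier P))"
    unfolding free_module_def
    by (rule Hom_closed[OF direct_sum_inj_Hom[OF P.R.ring_axioms R x]]) simp
  ultimately show ?thesis by (rule image_eqI)
qed

unbundle cardinal_syntax

section \<open>Cardinalities and copies of small modules\<close>

lemma card_of_finite_ordLeq_infinite:
  assumes "finite A" "infinite B"
  shows "|A| \<le>o |B|"
proof (rule ccontr)
  assume "\<not> |A| \<le>o |B|"
  then have "|B| \<le>o |A|"
    using ordLeq_total[OF card_of_Well_order[of A] card_of_Well_order[of B]] by blast
  then show False using assms card_of_ordLeq_finite by blast
qed

lemma card_of_finite_subsets: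
  assumes inf: "infinite B" and A: "|A| \<le>o |B|"
  shows "|{F. F \<subseteq> A \<and> finite F}| \<le>o |B|"
proof -
  let ?S = "\<lambda>n. {F. F \<subseteq> A \<and> finite F \<and> card F = n}"
  have S: "|?S n| \<le>o |B|" for n
  proof (induction n)
    case 0
    have "?S 0 = {{}}" by auto
    then show ?case
      using inf by (metis card_of_singl_ordLeq finite.emptyI)
  next
    case (Suc n)
    have "?S (Suc n) \<subseteq> (\<lambda>(x, F). insert x F) ` (A \<times> ?S n)"
    proof
      fix F assume "F \<in> ?S (Suc n)"
      then have F: "F \<subseteq> A" "finite F" "card F = Suc n" by auto
      then obtain x where x: "x \<in> F" by fastforce
      then have "(x, F - {x}) \<in> A \<times> ?S n" "insert x (F - {x}) = F"
        using F by auto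
      then show "F \<in> (\<lambda>(x, F). insert x F) ` (A \<times> ?S n)" by (metis (mono_tags, lifting) case_prod_conv image_eqI)
    qed
    then have "|?S (Suc n)| \<le>o |(\<lambda>(x, F). insert x F) ` (A \<times> ?S n)|" by (rule card_of_mono1)
    also have "|(\<lambda>(x, F). insert x F) ` (A \<times> ?S n)| \<le>o |A \<times> ?S n|" by (rule card_of_image)
    also have "|A \<times> ?S n| \<le>o |B|"
      by (rule card_of_Sigma_ordLeq_infinite[OF inf A]) (use Suc in auto)
    finally show ?case .
  qed
  have "{F. F \<subseteq> A \<and> finite F} = (\<Union>n\<in>(UNIV :: nat set). ?S n)" by auto
  moreover have "|\<Union>n\<in>(UNIV :: nat set). ?S n| \<le>o |B|"
    by (rule card_of_UNION_ordLeq_infinite[OF inf]) (use inf S in \<open>auto simp: infinite_iff_card_of_nat\<close>)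
  ultimately show ?thesis by simp
qed

text \<open>
  An element of a coproduct is determined by the finite graph of its restriction to the support.
\<close>

lemma card_of_direct_sum:
  assumes inf: "infinite B" and I: "|I| \<le>o |B|" and X: "|\<Union>i\<in>I. carrier (X i)| \<le>o |B|"
  shows "|carrier (direct_sum I X)| \<le>o |B|"
proof -
  let ?C = "\<Union>i\<in>I. carrier (X i)"
  define gr where "gr u = (\<lambda>i. (i, u i)) ` {i \<in> I. u i \<noteq> \<zero>\<^bsub>X i\<^esub>}" for u
  have IC: "|I \<times> ?C| \<le>o |B|"
    by (rule card_of_Sigma_ordLeq_infinite[OF inf I]) (use X in auto)
  have "|carrier (direct_sum I X)| \<le>o |{F. F \<subseteq> I \<times> ?C \<and> finite F}|"
  proof (rule card_of_ordLeqI)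
    show "inj_on gr (carrier (direct_sum I X))"
    proof (rule inj_onI)
      fix u v assume u: "u \<in> carrier (direct_sum I X)" and v: "v \<in> carrier (direct_sum I X)"
        and eq: "gr u = gr v"
      have gr: "(i, x) \<in> gr w \<longleftrightarrow> i \<in> I \<and> w i = x \<and> x \<noteq> \<zero>\<^bsub>X i\<^esub>" for i x w by (auto simp: gr_def)
      have "u i = v i" if "i \<in> I" for i
        using gr[of i "u i" u] gr[of i "u i" v] gr[of i "v i" u] gr[of i "v i" v] eq that by metis
      then show "u = v" using u v by (auto intro: PiE_ext)
    qed
    show "gr u \<in> {F. F \<subseteq> I \<times> ?C \<and> finite F}" if "u \<in> carrier (direct_sum I X)" for u
      using that by (auto simp: gr_def)
  qed
  also have "|{F. F \<subseteq> I \<times> ?C \<and> finite F}| \<le>o |B|"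
    by (rule card_of_finite_subsets[OF inf IC])
  finally show ?thesis .
qed

lemma card_of_surj_hom:
  assumes "surj_hom A M N f" "|carrier M| \<le>o |B|"
  shows "|carrier N| \<le>o |B|"
proof -
  have "|carrier N| \<le>o |carrier M|" using assms(1) card_of_image[of f "carrier M"] by (simp add: surj_hom_def)
  then show ?thesis using assms(2) by (rule ordLeq_transitive)
qed

definition transport :: "('m \<Rightarrow> 'u) \<Rightarrow> ('a, 'm) rmodule \<Rightarrow> ('a, 'u) rmodule" where
  "transport e M =
    \<lparr>carrier = e ` carrier M, mult = undefined, one = undefined, zero = e \<zero>\<^bsub>M\<^esub>,
     add = (\<lambda>x y. e (inv_into (carrier M) e x \<oplus>\<^bsub>M\<^esub> inv_into (carrier M) e y)),
     rsmult = (\<lambda>x a. e (inv_into (carrier M) e x \<triangleleft>\<^bsub>M\<^esub> a))\<rparr>"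

lemma small_module_copy:
  fixes M :: "('a, 'm) rmodule"
  assumes M: "right_module A M" and small: "|carrier M| \<le>o |UNIV :: 'u set|"
  obtains M' :: "('a, 'u) rmodule" and e e' where "right_module A M'" "surj_hom A M M' e"
    "surj_hom A M' M e'" "\<And>x. x \<in> carrier M \<Longrightarrow> e' (e x) = x"
proof -
  interpret M: right_module A M by fact
  obtain e :: "'m \<Rightarrow> 'u" where e: "inj_on e (carrier M)"
    using small by (auto simp: card_of_ordLeq[symmetric])
  let ?M' = "transport e M" and ?e = "\<lambda>x\<in>carrier M. e x"
    and ?e' = "\<lambda>y\<in>carrier (transport e M). inv_into (carrier M) e y"
  have carrier: "carrier ?M' = e ` carrier M" by (simp add: transport_def)
  have add: "e (x \<oplus>\<^bsub>M\<^esub> y) = e x \<oplus>\<^bsub>?M'\<^esub> e y" if "x \<in> carrier M" "y \<in> carrier M" for x y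
    using that e by (simp add: transport_def)
  have sm: "e (x \<triangleleft>\<^bsub>M\<^esub> a) = e x \<triangleleft>\<^bsub>?M'\<^esub> a" if "x \<in> carrier M" "a \<in> carrier A" for x a
    using that e by (simp add: transport_def)
  have zero: "e \<zero>\<^bsub>M\<^esub> = \<zero>\<^bsub>?M'\<^esub>" by (simp add: transport_def)
  have M': "right_module A ?M'"
    using M carrier[symmetric] add sm zero by (rule right_module_image)
  have eH: "?e \<in> Hom A M ?M'"
    using M _ add sm by (rule restrict_HomI) (simp add: carrier)
  have e'H: "?e' \<in> Hom A ?M' M"
    by (rule restrict_HomI[OF M'])
       (use e in \<open>auto simp: carrier add[symmetric] sm[symmetric] M.rsmult_closed\<close>)
  have e'e: "?e' (?e x) = x" if "x \<in> carrier M" for x using that e by (simp add: carrier)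
  have "surj_hom A M ?M' ?e" using eH by (simp add: surj_hom_def carrier)
  moreover have "surj_hom A ?M' M ?e'"
    unfolding surj_hom_def
  proof (intro conjI e'H subset_antisym subsetI)
    show "x \<in> carrier M" if "x \<in> ?e' ` carrier ?M'" for x
      using that Hom_closed[OF e'H] by blast
    show "x \<in> ?e' ` carrier ?M'" if "x \<in> carrier M" for x
      using e'e[OF that] Hom_closed[OF eH that] by (metis imageI)
  qed
  ultimately show thesis using that M' e'e by blast
qed

text \<open>
  Copies of \<open>P\<close> and of the free module on the elements of \<open>P\<close> live on the type \<open>'u\<close>. The canonical
  epimorphism between these copies splits, and the splitting is carried back.
\<close>

lemma projective_imp_free_retract:
  fixes A :: "'a ring" and P :: "('a, 'p) rmodule"
  assumes ring: "ring A" and proj: "projective TYPE('u) A P"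
    and small_P: "|carrier P| \<le>o |UNIV :: 'u set|"
    and small_F: "|carrier (free_module A (carrier P))| \<le>o |UNIV :: 'u set|"
  shows "free_retract A P"
proof -
  have P: "right_module A P" using proj by (simp add: projective_def Modules_def)
  let ?F = "free_module A (carrier P)"
  let ?c = "free_extend A (carrier P) P (\<lambda>b. b)"
  have F: "right_module A ?F" by (rule right_module_free[OF ring])
  have c: "?c \<in> Hom A ?F P" by (rule free_extend_Hom[OF P])
  obtain P' :: "('a, 'u) rmodule" and e e' where P': "right_module A P'" "surj_hom A P P' e"
    "\<And>x. x \<in> carrier P \<Longrightarrow> e' (e x) = x"
    using small_module_copy[OF P small_P] by metis
  obtain F' :: "('a, 'u) rmodule" and i i' where F': "right_module A F'" "surj_hom A F' ?F i'"
    using small_module_copy[OF F small_F] by metis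
  have i': "i' \<in> Hom A F' ?F" "i' ` carrier F' = carrier ?F" and e: "e \<in> Hom A P P'" "e ` carrier P = carrier P'"
    using F'(2) P'(2) by (auto simp: surj_hom_def)
  have c_onto: "?c ` carrier ?F = carrier P"
    using free_extend_generator[OF P] Hom_closed[OF c] by blast
  let ?g = "compose (carrier F') (compose (carrier ?F) e ?c) i'"
  have gH: "?g \<in> Hom A F' P'"
    by (intro Hom_compose[OF i'(1) _ F'(1)] Hom_compose[OF c e(1) F])
  have gx: "?g y = e (?c (i' y))" if "y \<in> carrier F'" for y
    using that Hom_closed[OF i'(1) that] by (simp add: compose_def)
  have "?g ` carrier F' = (\<lambda>y. e (?c (i' y))) ` carrier F'" by (rule image_cong) (simp_all only: gx)
  also have "\<dots> = e ` ?c ` i' ` carrier F'" by (simp only: image_image)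
  also have "\<dots> = carrier P'" by (simp only: i'(2) c_onto e(2))
  finally have "surj_hom A F' P' ?g" using gH by (simp add: surj_hom_def)
  then obtain h where h: "h \<in> Hom A P F'" "compose (carrier P) ?g h = e"
    using proj[unfolded projective_def, THEN conjunct2, rule_format, of F' P' ?g e] F'(1) P'(1) e(1)
    by (auto simp: Modules_def)
  have "?c (compose (carrier P) i' h x) = x" if x: "x \<in> carrier P" for x
  proof -
    note hx = Hom_closed[OF h(1) x]
    have "e (?c (i' (h x))) = e x"
      using fun_cong[OF h(2), of x] unfolding compose_eq[OF x] gx[OF hx] .
    then have "e' (e (?c (i' (h x)))) = e' (e x)" by simp
    then show ?thesis
      using P'(3) x Hom_closed[OF c Hom_closed[OF i'(1) hx]] by (simp add: compose_def)
  qed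
  moreover have "compose (carrier P) i' h \<in> Hom A P ?F" by (rule Hom_compose[OF h(1) i'(1) P])
  ultimately show ?thesis unfolding free_retract_def by blast
qed

lemma infinite_universe: "infinite (UNIV :: ('a, 'p, 'q) universe set)"
  by (simp add: Finite_Set.finite_set infinite_UNIV_listI)

lemma small_ring_elements: "|S| \<le>o |UNIV :: ('a, 'p, 'q) universe set|" for S :: "'a set"
  by (rule card_of_ordLeqI[of "\<lambda>x. {[Inl x]}"]) (auto intro: inj_onI)

lemma small_P_elements: "|S| \<le>o |UNIV :: ('a, 'p, 'q) universe set|" for S :: "'p set"
  by (rule card_of_ordLeqI[of "\<lambda>x. {[Inr (Inl x)]}"]) (auto intro: inj_onI)

lemma small_Q_elements: "|S| \<le>o |UNIV :: ('a, 'p, 'q) universe set|" for S :: "'q set"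
  by (rule card_of_ordLeqI[of "\<lambda>x. {[Inr (Inr x)]}"]) (auto intro: inj_onI)

text \<open>A function is coded by its graph, written as a set of words of length two.\<close>

lemma small_endofunctions: "|S| \<le>o |UNIV :: ('a, 'p, 'q) universe set|" for S :: "('p \<Rightarrow> 'p) set"
proof (rule card_of_ordLeqI)
  show "inj_on (\<lambda>f. range (\<lambda>x. [Inr (Inl x), Inr (Inl (f x))]) :: ('a, 'p, 'q) universe) S"
  proof (intro inj_onI ext)
    fix f g :: "'p \<Rightarrow> 'p" and x
    assume "(range (\<lambda>x. [Inr (Inl x), Inr (Inl (f x))]) :: ('a, 'p, 'q) universe) =
      range (\<lambda>x. [Inr (Inl x), Inr (Inl (g x))])"
    then have "([Inr (Inl x), Inr (Inl (f x))] :: ('a + 'p + 'q) list) \<in>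
        range (\<lambda>x. [Inr (Inl x), Inr (Inl (g x))])"
      by blast
    then show "f x = g x" by auto
  qed
qed simp

section \<open>The classes cut out by a projective presentation\<close>

text \<open>
  Projectivity is expressed by retractions of free modules, so that the lemmas below apply to
  modules of arbitrary and varying types.
\<close>

locale presentation =
  fixes A :: "'a ring" and P :: "('a, 'p) rmodule" and Q :: "('a, 'q) rmodule"
    and T :: "('a, 't) rmodule" and \<sigma> :: "'p \<Rightarrow> 'q" and \<pi> :: "'q \<Rightarrow> 't"
  assumes ring: "ring A" and P: "right_module A P" and Q: "right_module A Q" and T: "right_module A T"
    and free_P: "free_retract A P" and free_Q: "free_retract A Q"
    and \<sigma>: "\<sigma> \<in> Hom A P Q" and \<pi>_surj: "surj_hom A Q T \<pi>"
    and exact: "\<And>q. q \<in> carrier Q \<Longrightarrow> \<pi> q = \<zero>\<^bsub>T\<^esub> \<longleftrightarrow> q \<in> \<sigma> ` carrier P"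
begin

lemma \<pi>: "\<pi> \<in> Hom A Q T"
  using \<pi>_surj by (simp add: surj_hom_def)

lemma D_class_iff:
  "X \<in> D_class A P Q \<sigma> \<longleftrightarrow> right_module A X \<and>
    (\<forall>f\<in>Hom A P X. \<exists>g\<in>Hom A Q X. \<forall>p\<in>carrier P. g (\<sigma> p) = f p)"
proof -
  have eq: "compose (carrier P) g \<sigma> = f \<longleftrightarrow> (\<forall>p\<in>carrier P. g (\<sigma> p) = f p)"
    if "f \<in> Hom A P X" "g \<in> Hom A Q X" for f g
    using Hom_eqI[OF Hom_compose[OF \<sigma> that(2) P] that(1)] by (auto simp: compose_def)
  have sub: "(\<lambda>g. compose (carrier P) g \<sigma>) ` Hom A Q X \<subseteq> Hom A P X"
    using Hom_compose[OF \<sigma> _ P] by blast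
  have "(\<lambda>g. compose (carrier P) g \<sigma>) ` Hom A Q X = Hom A P X \<longleftrightarrow>
      (\<forall>f\<in>Hom A P X. \<exists>g\<in>Hom A Q X. compose (carrier P) g \<sigma> = f)"
  proof
    assume *: "(\<lambda>g. compose (carrier P) g \<sigma>) ` Hom A Q X = Hom A P X"
    show "\<forall>f\<in>Hom A P X. \<exists>g\<in>Hom A Q X. compose (carrier P) g \<sigma> = f"
      unfolding *[symmetric] by blast
  next
    assume *: "\<forall>f\<in>Hom A P X. \<exists>g\<in>Hom A Q X. compose (carrier P) g \<sigma> = f"
    have "Hom A P X \<subseteq> (\<lambda>g. compose (carrier P) g \<sigma>) ` Hom A Q X"
    proof
      fix f assume "f \<in> Hom A P X"
      then obtain g where "g \<in> Hom A Q X" "compose (carrier P) g \<sigma> = f" using * by blast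
      then show "f \<in> (\<lambda>g. compose (carrier P) g \<sigma>) ` Hom A Q X" by (metis imageI)
    qed
    then show "(\<lambda>g. compose (carrier P) g \<sigma>) ` Hom A Q X = Hom A P X"
      using sub by (rule subset_antisym[rotated])
  qed
  also have "\<dots> \<longleftrightarrow> (\<forall>f\<in>Hom A P X. \<exists>g\<in>Hom A Q X. \<forall>p\<in>carrier P. g (\<sigma> p) = f p)"
    by (intro ball_cong bex_cong refl) (rule eq)
  finally show ?thesis unfolding D_class_def Modules_def by blast
qed

lemma D_class_module: "X \<in> D_class A P Q \<sigma> \<Longrightarrow> right_module A X"
  by (simp add: D_class_iff)

lemma D_class_extend:
  assumes "X \<in> D_class A P Q \<sigma>" "f \<in> Hom A P X"
  obtains g where "g \<in> Hom A Q X" "\<And>p. p \<in> carrier P \<Longrightarrow> g (\<sigma> p) = f p"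
  using assms unfolding D_class_iff by blast

lemma perp_class_iff:
  "X \<in> perp_class A T \<longleftrightarrow> right_module A X \<and> (\<forall>f\<in>Hom A T X. \<forall>t\<in>carrier T. f t = \<zero>\<^bsub>X\<^esub>)"
proof (cases "right_module A X")
  case True
  have z: "zero_hom T X \<in> Hom A T X" by (rule zero_hom_Hom[OF T True])
  have "f = zero_hom T X \<longleftrightarrow> (\<forall>t\<in>carrier T. f t = \<zero>\<^bsub>X\<^esub>)" if "f \<in> Hom A T X" for f
    using Hom_eqI[OF that z] by (auto simp: zero_hom_def)
  then show ?thesis using z True by (auto simp: perp_class_def Modules_def)
qed (simp add: perp_class_def Modules_def)

lemma perp_class_vanish:
  assumes "X \<in> perp_class A T" "f \<in> Hom A T X" "t \<in> carrier T"
  shows "f t = \<zero>\<^bsub>X\<^esub>"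
  using assms by (simp add: perp_class_iff)

lemma Hom_kills_\<sigma>_factor:
  assumes g: "g \<in> Hom A Q X" and X: "right_module A X"
    and zero: "\<And>p. p \<in> carrier P \<Longrightarrow> g (\<sigma> p) = \<zero>\<^bsub>X\<^esub>"
  obtains t where "t \<in> Hom A T X" "\<And>q. q \<in> carrier Q \<Longrightarrow> t (\<pi> q) = g q"
proof -
  have "g q = \<zero>\<^bsub>X\<^esub>" if "q \<in> carrier Q" "\<pi> q = \<zero>\<^bsub>T\<^esub>" for q
    using that exact zero by auto
  then show thesis using Hom_factor_surj[OF \<pi>_surj g Q T X] that by blast
qed

text \<open>
  Since \<open>T\<close> is the cokernel of \<open>\<sigma>\<close>, a homomorphism that vanishes on the image of \<open>\<sigma>\<close> factors through
  \<open>T\<close>. Hence the orthogonality condition says that extensions along \<open>\<sigma>\<close> are unique, while membership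
  in \<open>\<D>\<^sub>\<sigma>\<close> says that they exist.
\<close>

lemma perp_class_cancel_\<sigma>:
  assumes "X \<in> perp_class A T" "g \<in> Hom A Q X" "\<And>p. p \<in> carrier P \<Longrightarrow> g (\<sigma> p) = \<zero>\<^bsub>X\<^esub>" "q \<in> carrier Q"
  shows "g q = \<zero>\<^bsub>X\<^esub>"
proof -
  have X: "right_module A X" using assms(1) by (simp add: perp_class_iff)
  obtain t where "t \<in> Hom A T X" "\<And>q. q \<in> carrier Q \<Longrightarrow> t (\<pi> q) = g q"
    using Hom_kills_\<sigma>_factor[OF assms(2) X assms(3)] by blast
  then show ?thesis using perp_class_vanish[OF assms(1)] Hom_closed[OF \<pi>] assms(4) by metis
qed

text \<open>
  A homomorphism from \<open>P\<close> to the quotient is lifted, extended along \<open>\<sigma>\<close>, and projected back.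
\<close>

lemma D_class_quotient:
  assumes X: "X \<in> D_class A P Q \<sigma>" and c: "surj_hom A X Z c" and Z: "right_module A Z"
  shows "Z \<in> D_class A P Q \<sigma>"
  unfolding D_class_iff
proof (intro conjI ballI Z)
  note XM = D_class_module[OF X]
  have cH: "c \<in> Hom A X Z" using c by (simp add: surj_hom_def)
  fix f assume f: "f \<in> Hom A P Z"
  obtain h where h: "h \<in> Hom A P X" "\<And>p. p \<in> carrier P \<Longrightarrow> c (h p) = f p"
    using free_retract_lift[OF free_P P XM Z c f] by blast
  obtain k where k: "k \<in> Hom A Q X" "\<And>p. p \<in> carrier P \<Longrightarrow> k (\<sigma> p) = h p"
    using D_class_extend[OF X h(1)] by blast
  have "compose (carrier Q) c k (\<sigma> p) = f p" if "p \<in> carrier P" for p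
    using that h k Hom_closed[OF \<sigma>] by (simp add: compose_def)
  then show "\<exists>g\<in>Hom A Q Z. \<forall>p\<in>carrier P. g (\<sigma> p) = f p"
    using Hom_compose[OF k(1) cH Q] by blast
qed

text \<open>
  A homomorphism \<open>f\<close> from \<open>P\<close> to \<open>E\<close> extends along \<open>\<sigma>\<close> after passing to \<open>W\<close>, and the extension lifts to
  \<open>E\<close> as \<open>Q\<close> is projective; the error made along \<open>\<sigma>\<close> comes from \<open>K\<close>. This form covers extensions as well
  as the approximation \<open>X \<rightarrow> M\<^sub>X\<close> of an arbitrary module, where \<open>K\<close> is \<open>X\<close>.
\<close>

lemma D_class_extension:
  assumes K: "right_module A K" and E: "right_module A E" and W: "W \<in> D_class A P Q \<sigma>"
    and i: "i \<in> Hom A K E" and e: "surj_hom A E W e"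
    and ker: "\<And>x. x \<in> carrier E \<Longrightarrow> e x = \<zero>\<^bsub>W\<^esub> \<Longrightarrow> x \<in> i ` carrier K"
    and ext: "\<And>h. h \<in> Hom A P K \<Longrightarrow> \<exists>k\<in>Hom A Q E. \<forall>p\<in>carrier P. k (\<sigma> p) = i (h p)"
  shows "E \<in> D_class A P Q \<sigma>"
  unfolding D_class_iff
proof (intro conjI ballI E)
  interpret E: right_module A E by (rule E)
  interpret W: right_module A W by (rule D_class_module[OF W])
  note WM = D_class_module[OF W]
  have eH: "e \<in> Hom A E W" using e by (simp add: surj_hom_def)
  fix f assume f: "f \<in> Hom A P E"
  obtain w where w: "w \<in> Hom A Q W" "\<And>p. p \<in> carrier P \<Longrightarrow> w (\<sigma> p) = compose (carrier P) e f p"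
    using D_class_extend[OF W Hom_compose[OF f eH P]] by blast
  obtain v where v: "v \<in> Hom A Q E" "\<And>q. q \<in> carrier Q \<Longrightarrow> e (v q) = w q"
    using free_retract_lift[OF free_Q Q E WM e w(1)] by blast
  let ?v\<sigma> = "compose (carrier P) v \<sigma>"
  have v\<sigma>: "?v\<sigma> \<in> Hom A P E" by (rule Hom_compose[OF \<sigma> v(1) P])
  \<comment> \<open>\<open>v\<close> extends \<open>f\<close> up to an error in the image of \<open>K\<close>; the error extends by assumption\<close>
  define d where "d = (\<lambda>p\<in>carrier P. ?v\<sigma> p \<ominus>\<^bsub>E\<^esub> f p)"
  have d: "d \<in> Hom A P E" unfolding d_def by (rule Hom_minus_Hom[OF v\<sigma> f P E])
  have dp: "d p = v (\<sigma> p) \<ominus>\<^bsub>E\<^esub> f p" if "p \<in> carrier P" for p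
    using that by (simp add: d_def compose_def)
  have d_im: "d p \<in> i ` carrier K" if p: "p \<in> carrier P" for p
  proof (rule ker[OF Hom_closed[OF d p]])
    note cl = Hom_closed[OF v(1) Hom_closed[OF \<sigma> p]] Hom_closed[OF f p]
    have "e (v (\<sigma> p)) = e (f p)"
      using p w(2) v(2)[OF Hom_closed[OF \<sigma> p]] by (simp add: compose_def)
    then show "e (d p) = \<zero>\<^bsub>W\<^esub>"
      using p Hom_closed[OF eH cl(2)]
      by (simp add: dp Hom_minus[OF eH E WM cl] a_minus_def[of W] W.r_neg)
  qed
  have iK: "surj_hom A K (E\<lparr>carrier := i ` carrier K\<rparr>) i" by (rule surj_hom_onto_image[OF i])
  have im: "rsubmodule A E (i ` carrier K)" by (rule rsubmodule_image[OF i K E])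
  obtain h where h: "h \<in> Hom A P K" "\<And>p. p \<in> carrier P \<Longrightarrow> i (h p) = d p"
    using free_retract_lift[OF free_P P K right_module_submodule[OF im E] iK
        Hom_into_submodule[OF d d_im]] by blast
  obtain k where k: "k \<in> Hom A Q E" "\<And>p. p \<in> carrier P \<Longrightarrow> k (\<sigma> p) = i (h p)"
    using ext[OF h(1)] by blast
  let ?g = "\<lambda>q\<in>carrier Q. v q \<ominus>\<^bsub>E\<^esub> k q"
  have "?g \<in> Hom A Q E" by (rule Hom_minus_Hom[OF v(1) k(1) Q E])
  moreover have "?g (\<sigma> p) = f p" if p: "p \<in> carrier P" for p
  proof -
    note \<sigma>p = Hom_closed[OF \<sigma> p]
    have "?g (\<sigma> p) = v (\<sigma> p) \<ominus>\<^bsub>E\<^esub> (v (\<sigma> p) \<ominus>\<^bsub>E\<^esub> f p)"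
      using \<sigma>p by (simp add: k(2)[OF p] h(2)[OF p] dp[OF p])
    also have "\<dots> = f p"
      by (rule E.minus_minus_cancel[OF Hom_closed[OF v(1) \<sigma>p] Hom_closed[OF f p]])
    finally show ?thesis .
  qed
  ultimately show "\<exists>g\<in>Hom A Q E. \<forall>p\<in>carrier P. g (\<sigma> p) = f p" by blast
qed

lemma D_class_product:
  assumes X: "\<And>i. i \<in> I \<Longrightarrow> X i \<in> D_class A P Q \<sigma>"
  shows "direct_product I X \<in> D_class A P Q \<sigma>"
  unfolding D_class_iff
proof (intro conjI ballI)
  show "right_module A (direct_product I X)"
    using ring X by (intro right_module_direct_product D_class_module)
  fix f assume f: "f \<in> Hom A P (direct_product I X)"
  have "\<exists>g. g \<in> Hom A Q (X i) \<and> (\<forall>p\<in>carrier P. g (\<sigma> p) = f p i)" if i: "i \<in> I" for i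
  proof -
    obtain g where "g \<in> Hom A Q (X i)" "\<And>p. p \<in> carrier P \<Longrightarrow> g (\<sigma> p) = (\<lambda>p\<in>carrier P. f p i) p"
      using D_class_extend[OF X[OF i] Hom_direct_product_component[OF f i P]] by blast
    then show ?thesis by auto
  qed
  then obtain g where g: "\<And>i. i \<in> I \<Longrightarrow> g i \<in> Hom A Q (X i)"
    "\<And>i p. i \<in> I \<Longrightarrow> p \<in> carrier P \<Longrightarrow> g i (\<sigma> p) = f p i" by metis
  have "(\<lambda>i\<in>I. g i (\<sigma> p)) = f p" if p: "p \<in> carrier P" for p
  proof -
    have "(\<lambda>i\<in>I. g i (\<sigma> p)) = (\<lambda>i\<in>I. f p i)" by (rule restrict_ext) (rule g(2)[OF _ p])
    also have "\<dots> = f p" using Hom_closed[OF f p] by (auto intro: PiE_restrict)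
    finally show ?thesis .
  qed
  then have "\<forall>p\<in>carrier P. (\<lambda>q\<in>carrier Q. \<lambda>i\<in>I. g i q) (\<sigma> p) = f p"
    using Hom_closed[OF \<sigma>] by simp
  then show "\<exists>g\<in>Hom A Q (direct_product I X). \<forall>p\<in>carrier P. g (\<sigma> p) = f p"
    by (rule bexI[where x = "\<lambda>q\<in>carrier Q. \<lambda>i\<in>I. g i q"])
       (rule Hom_into_direct_product[OF g(1) Q])
qed

lemma perp_class_inj:
  assumes X: "X \<in> perp_class A T" and k: "inj_hom A K X k" and K: "right_module A K"
  shows "K \<in> perp_class A T"
  unfolding perp_class_iff
proof (intro conjI ballI K)
  have XM: "right_module A X" using X by (simp add: perp_class_iff)
  have kH: "k \<in> Hom A K X" and inj: "inj_on k (carrier K)" using k by (auto simp: inj_hom_def)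
  interpret K: right_module A K by (rule K)
  fix f t assume f: "f \<in> Hom A T K" and t: "t \<in> carrier T"
  have "k (f t) = k \<zero>\<^bsub>K\<^esub>"
    using perp_class_vanish[OF X Hom_compose[OF f kH T] t] t Hom_zero[OF kH K XM] by (simp add: compose_def)
  then show "f t = \<zero>\<^bsub>K\<^esub>" using inj Hom_closed[OF f t] by (simp add: inj_on_eq_iff)
qed

lemma perp_class_product:
  assumes X: "\<And>i. i \<in> I \<Longrightarrow> X i \<in> perp_class A T"
  shows "direct_product I X \<in> perp_class A T"
  unfolding perp_class_iff
proof (intro conjI ballI)
  show "right_module A (direct_product I X)"
    using ring X by (intro right_module_direct_product) (auto simp: perp_class_iff)
  fix f t assume f: "f \<in> Hom A T (direct_product I X)" and t: "t \<in> carrier T"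
  have "f t i = \<zero>\<^bsub>X i\<^esub>" if i: "i \<in> I" for i
    using perp_class_vanish[OF X[OF i] Hom_direct_product_component[OF f i T] t] t by simp
  moreover have "(\<lambda>i\<in>I. f t i) = f t" using Hom_closed[OF f t] by (auto intro: PiE_restrict)
  ultimately show "f t = \<zero>\<^bsub>direct_product I X\<^esub>" by (metis (no_types, lifting) direct_product_simps(2) restrict_ext)
qed

lemma perp_class_direct_sum:
  assumes X: "\<And>i. i \<in> I \<Longrightarrow> X i \<in> perp_class A T"
  shows "direct_sum I X \<in> perp_class A T"
proof (rule perp_class_inj[OF perp_class_product[OF X]])
  have M: "\<And>i. i \<in> I \<Longrightarrow> right_module A (X i)" using X by (simp add: perp_class_iff)
  show D: "right_module A (direct_sum I X)" using ring M by (rule right_module_direct_sum)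
  have "(\<lambda>u\<in>carrier (direct_sum I X). u) \<in> Hom A (direct_sum I X) (direct_product I X)"
    by (rule Hom_direct_sum_product[OF id_Hom[OF D]])
  then show "inj_hom A (direct_sum I X) (direct_product I X) (\<lambda>u\<in>carrier (direct_sum I X). u)"
    unfolding inj_hom_def by (auto intro!: inj_onI)
qed

lemma perp_class_extension:
  assumes K: "K \<in> perp_class A T" and E: "right_module A E" and W: "W \<in> perp_class A T"
    and exact: "short_exact A K E W i e"
  shows "E \<in> perp_class A T"
  unfolding perp_class_iff
proof (intro conjI ballI E)
  have KM: "right_module A K" and WM: "right_module A W" using K W by (simp_all add: perp_class_iff)
  have i: "inj_hom A K E i" "i \<in> Hom A K E" and e: "e \<in> Hom A E W"
    and ker: "i ` carrier K = a_kernel E W e"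
    using exact by (auto simp: short_exact_def inj_hom_def surj_hom_def)
  fix f t assume f: "f \<in> Hom A T E" and t: "t \<in> carrier T"
  have "f x \<in> i ` carrier K" if x: "x \<in> carrier T" for x
    using perp_class_vanish[OF W Hom_compose[OF f e T] x] x Hom_closed[OF f x]
    unfolding ker by (simp add: a_kernel_def' compose_def)
  then obtain h where h: "h \<in> Hom A T K" "\<And>x. x \<in> carrier T \<Longrightarrow> i (h x) = f x"
    using Hom_factor_inj[OF i(1) f T KM] by blast
  show "f t = \<zero>\<^bsub>E\<^esub>"
    using h(2)[OF t] perp_class_vanish[OF K h(1) t] Hom_zero[OF i(2) KM E] by simp
qed

text \<open>
  A homomorphism from \<open>P\<close> to the kernel extends to one from \<open>Q\<close> to \<open>X\<close>. Followed by \<open>f\<close> this extension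
  vanishes on the image of \<open>\<sigma>\<close>, hence it vanishes, so the extension takes values in the kernel.
\<close>

lemma Y_class_kernel:
  assumes X: "X \<in> Y_class A P Q \<sigma> T" and Z: "Z \<in> perp_class A T" and f: "f \<in> Hom A X Z"
    and K: "right_module A K" and k: "inj_hom A K X k" and ker: "k ` carrier K = a_kernel X Z f"
  shows "K \<in> Y_class A P Q \<sigma> T"
proof -
  have XD: "X \<in> D_class A P Q \<sigma>" and Xp: "X \<in> perp_class A T" using X by (auto simp: Y_class_def)
  have ZM: "right_module A Z" using Z by (simp add: perp_class_iff)
  have kH: "k \<in> Hom A K X" and inj: "inj_on k (carrier K)" using k by (auto simp: inj_hom_def)
  have "K \<in> D_class A P Q \<sigma>"
    unfolding D_class_iff
  proof (intro conjI ballI K)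
    fix u assume u: "u \<in> Hom A P K"
    obtain g where g: "g \<in> Hom A Q X" "\<And>p. p \<in> carrier P \<Longrightarrow> g (\<sigma> p) = compose (carrier P) k u p"
      using D_class_extend[OF XD Hom_compose[OF u kH P]] by blast
    have "compose (carrier Q) f g (\<sigma> p) = \<zero>\<^bsub>Z\<^esub>" if p: "p \<in> carrier P" for p
    proof -
      have "k (u p) \<in> a_kernel X Z f" using Hom_closed[OF u p] ker by blast
      then show ?thesis
        using p g(2)[OF p] Hom_closed[OF \<sigma> p] by (simp add: compose_def a_kernel_def')
    qed
    then have "f (g q) = \<zero>\<^bsub>Z\<^esub>" if "q \<in> carrier Q" for q
      using perp_class_cancel_\<sigma>[OF Z Hom_compose[OF g(1) f Q]] that by (simp add: compose_def)
    then have "g q \<in> k ` carrier K" if "q \<in> carrier Q" for q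
      using that Hom_closed[OF g(1)] unfolding ker by (simp add: a_kernel_def')
    then obtain h where h: "h \<in> Hom A Q K" "\<And>q. q \<in> carrier Q \<Longrightarrow> k (h q) = g q"
      using Hom_factor_inj[OF k g(1) Q K] by blast
    have "h (\<sigma> p) = u p" if p: "p \<in> carrier P" for p
    proof (rule inj_onD[OF inj])
      show "k (h (\<sigma> p)) = k (u p)"
        using g(2)[OF p] h(2)[OF Hom_closed[OF \<sigma> p]] p by (simp add: compose_def)
    qed (use Hom_closed[OF h(1) Hom_closed[OF \<sigma> p]] Hom_closed[OF u p] in auto)
    then show "\<exists>g\<in>Hom A Q K. \<forall>p\<in>carrier P. g (\<sigma> p) = u p" using h(1) by blast
  qed
  then show ?thesis using perp_class_inj[OF Xp k K] by (simp add: Y_class_def)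
qed

text \<open>
  A homomorphism from \<open>T\<close> to the cokernel \<open>C\<close> lifts to \<open>h\<close> from \<open>Q\<close> to \<open>Y\<close>, and the restriction of \<open>h\<close>
  along \<open>\<sigma>\<close> has values in the image of \<open>f\<close>. That restriction lifts to \<open>X\<close> and extends there along \<open>\<sigma>\<close>;
  since extensions to \<open>Y\<close> are unique, \<open>h\<close> itself factors through \<open>f\<close> and dies in \<open>C\<close>.
\<close>

lemma Y_class_cokernel:
  assumes X: "X \<in> D_class A P Q \<sigma>" and Y: "Y \<in> Y_class A P Q \<sigma> T" and f: "f \<in> Hom A X Y"
    and C: "right_module A C" and c: "surj_hom A Y C c" and ker: "a_kernel Y C c = f ` carrier X"
  shows "C \<in> Y_class A P Q \<sigma> T"
proof -
  have YD: "Y \<in> D_class A P Q \<sigma>" and Yp: "Y \<in> perp_class A T" using Y by (auto simp: Y_class_def)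
  note XM = D_class_module[OF X] and YM = D_class_module[OF YD]
  interpret Y: right_module A Y by (rule YM)
  have cH: "c \<in> Hom A Y C" using c by (simp add: surj_hom_def)
  have cf: "c (f x) = \<zero>\<^bsub>C\<^esub>" if "x \<in> carrier X" for x
    using ker that by (auto simp: a_kernel_def')
  have "C \<in> perp_class A T"
    unfolding perp_class_iff
  proof (intro conjI ballI C)
    fix u t assume u: "u \<in> Hom A T C" and t: "t \<in> carrier T"
    obtain h where h: "h \<in> Hom A Q Y" "\<And>q. q \<in> carrier Q \<Longrightarrow> c (h q) = compose (carrier Q) u \<pi> q"
      using free_retract_lift[OF free_Q Q YM C c Hom_compose[OF \<pi> u Q]] by blast
    let ?h\<sigma> = "compose (carrier P) h \<sigma>"
    have h\<sigma>: "?h\<sigma> \<in> Hom A P Y" by (rule Hom_compose[OF \<sigma> h(1) P])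
    have im: "?h\<sigma> p \<in> f ` carrier X" if p: "p \<in> carrier P" for p
    proof -
      note \<sigma>p = Hom_closed[OF \<sigma> p]
      have "\<pi> (\<sigma> p) = \<zero>\<^bsub>T\<^esub>" using exact[OF \<sigma>p] p by blast
      then have "c (h (\<sigma> p)) = \<zero>\<^bsub>C\<^esub>"
        using h(2)[OF \<sigma>p] \<sigma>p Hom_zero[OF u T C] by (simp add: compose_def)
      then show ?thesis
        using p Hom_closed[OF h(1) \<sigma>p] ker by (auto simp: a_kernel_def' compose_def)
    qed
    have sub: "rsubmodule A Y (f ` carrier X)" by (rule rsubmodule_image[OF f XM YM])
    obtain v where v: "v \<in> Hom A P X" "\<And>p. p \<in> carrier P \<Longrightarrow> f (v p) = ?h\<sigma> p"
      using free_retract_lift[OF free_P P XM right_module_submodule[OF sub YM] surj_hom_onto_image[OF f]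
          Hom_into_submodule[OF h\<sigma> im]] by blast
    obtain k where k: "k \<in> Hom A Q X" "\<And>p. p \<in> carrier P \<Longrightarrow> k (\<sigma> p) = v p"
      using D_class_extend[OF X v(1)] by blast
    let ?fk = "compose (carrier Q) f k"
    have fk: "?fk \<in> Hom A Q Y" by (rule Hom_compose[OF k(1) f Q])
    have eq: "h q = f (k q)" if q: "q \<in> carrier Q" for q
    proof -
      have "(\<lambda>q\<in>carrier Q. h q \<ominus>\<^bsub>Y\<^esub> ?fk q) q = \<zero>\<^bsub>Y\<^esub>"
      proof (rule perp_class_cancel_\<sigma>[OF Yp Hom_minus_Hom[OF h(1) fk Q YM] _ q])
        fix p assume p: "p \<in> carrier P"
        note \<sigma>p = Hom_closed[OF \<sigma> p]
        have "f (k (\<sigma> p)) = h (\<sigma> p)" using k(2)[OF p] v(2)[OF p] p by (simp add: compose_def)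
        then show "(\<lambda>q\<in>carrier Q. h q \<ominus>\<^bsub>Y\<^esub> ?fk q) (\<sigma> p) = \<zero>\<^bsub>Y\<^esub>"
          using \<sigma>p Hom_closed[OF h(1) \<sigma>p] by (simp add: compose_def a_minus_def[of Y] Y.r_neg)
      qed
      then have "h q \<ominus>\<^bsub>Y\<^esub> f (k q) = \<zero>\<^bsub>Y\<^esub>" using q by (simp add: compose_def)
      then show ?thesis
        by (rule Y.minus_eq_zeroD[OF _ Hom_closed[OF h(1) q] Hom_closed[OF f Hom_closed[OF k(1) q]]])
    qed
    obtain q where q: "q \<in> carrier Q" "t = \<pi> q"
      using t \<pi>_surj by (auto simp: surj_hom_def)
    have "u t = c (h q)" using h(2)[OF q(1)] q by (simp add: compose_def)
    also have "\<dots> = \<zero>\<^bsub>C\<^esub>" using eq[OF q(1)] cf Hom_closed[OF k(1) q(1)] by simp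
    finally show "u t = \<zero>\<^bsub>C\<^esub>" .
  qed
  then show ?thesis using D_class_quotient[OF YD c C] by (simp add: Y_class_def)
qed

end

section \<open>Approximations and traces\<close>

lemma canonical_map_eq_copair:
  "canonical_map A P X = copair (Hom A P X) (\<lambda>_. P) X (\<lambda>f. f)"
  by (simp only: canonical_map_def copair_def hom_copower_def)

lemma copower_map_eq_direct_sum_map:
  "copower_map A P X \<sigma> = direct_sum_map (Hom A P X) (\<lambda>_. P) (\<lambda>_. \<sigma>)"
  by (simp only: copower_map_def direct_sum_map_def hom_copower_def)

lemma right_module_hom_copower:
  assumes "right_module A Q"
  shows "right_module A (hom_copower A P X Q)"
proof -
  interpret Q: right_module A Q by fact
  show ?thesis unfolding hom_copower_def by (rule right_module_direct_sum[OF Q.R.ring_axioms assms])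
qed

lemma canonical_map_Hom:
  assumes P: "right_module A P" and X: "right_module A X"
  shows "canonical_map A P X \<in> Hom A (hom_copower A P X P) X"
proof -
  interpret P: right_module A P by fact
  show ?thesis
    unfolding canonical_map_eq_copair hom_copower_def
    by (rule copair_Hom[OF P.R.ring_axioms P X])
qed

lemma canonical_map_inj:
  assumes P: "right_module A P" and X: "right_module A X" and f: "f \<in> Hom A P X" and p: "p \<in> carrier P"
  shows "canonical_map A P X (direct_sum_inj (Hom A P X) (\<lambda>_. P) f p) = f p"
proof -
  interpret P: right_module A P by fact
  show ?thesis
    unfolding canonical_map_eq_copair
    by (rule copair_inj[OF P.R.ring_axioms P X _ f p])
qed

context presentation
begin

context
  fixes X :: "('a, 'x) rmodule"
  assumes X: "right_module A X"
begin

lemma approx_pushout: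
  "pushout_data A (hom_copower A P X P) X (hom_copower A P X Q) (canonical_map A P X) (copower_map A P X \<sigma>)"
proof (rule pushout_data.intro)
  show "canonical_map A P X \<in> Hom A (hom_copower A P X P) X" by (rule canonical_map_Hom[OF P X])
  show "copower_map A P X \<sigma> \<in> Hom A (hom_copower A P X P) (hom_copower A P X Q)"
    unfolding copower_map_eq_direct_sum_map hom_copower_def
    by (rule direct_sum_map_Hom[OF ring P Q \<sigma>])
qed (intro right_module_hom_copower P Q X)+

interpretation PO: pushout_data A "hom_copower A P X P" X "hom_copower A P X Q"
  "canonical_map A P X" "copower_map A P X \<sigma>"
  by (rule approx_pushout)

lemma right_module_approx: "right_module A (approx_module A P Q \<sigma> X)"
  unfolding approx_module_def by (rule PO.right_module_pushout)

lemma approx_map_Hom: "approx_map A P Q \<sigma> X \<in> Hom A X (approx_module A P Q \<sigma> X)"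
  unfolding approx_module_def approx_map_def by (rule PO.pushout_map_Hom)

lemma approx_module_cover:
  obtains c where "surj_hom A (binary_sum X (hom_copower A P X Q)) (approx_module A P Q \<sigma> X) c"
  unfolding approx_module_def using PO.c_surj that by blast

text \<open>
  The pushout is made for this: the copy of \<open>\<sigma>\<close> with index \<open>h\<close> is part of the pushout square.
\<close>

lemma approx_map_extends:
  assumes h: "h \<in> Hom A P X"
  obtains k where "k \<in> Hom A Q (approx_module A P Q \<sigma> X)"
    "\<And>p. p \<in> carrier P \<Longrightarrow> k (\<sigma> p) = approx_map A P Q \<sigma> X (h p)"
proof -
  let ?I = "Hom A P X"
  let ?iQ = "direct_sum_inj ?I (\<lambda>_. Q) h" and ?iP = "direct_sum_inj ?I (\<lambda>_. P) h"
  have iQ: "?iQ \<in> Hom A Q (hom_copower A P X Q)"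
    unfolding hom_copower_def by (rule direct_sum_inj_Hom[OF ring Q h])
  have iP: "?iP \<in> Hom A P (hom_copower A P X P)"
    unfolding hom_copower_def by (rule direct_sum_inj_Hom[OF ring P h])
  let ?k = "compose (carrier Q) PO.cospan_map ?iQ"
  have k: "?k \<in> Hom A Q (approx_module A P Q \<sigma> X)"
    unfolding approx_module_def by (rule Hom_compose[OF iQ PO.cospan_map_Hom Q])
  have "?k (\<sigma> p) = approx_map A P Q \<sigma> X (h p)" if p: "p \<in> carrier P" for p
  proof -
    note iPp = Hom_closed[OF iP p]
    have "copower_map A P X \<sigma> (?iP p) = (\<lambda>f\<in>?I. \<sigma> (?iP p f))"
      using iPp by (simp only: copower_map_def restrict_apply if_True)
    also have "\<dots> = ?iQ (\<sigma> p)"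
      using p Hom_closed[OF \<sigma> p] Hom_zero[OF \<sigma> P Q] by (auto simp: direct_sum_inj_def intro!: restrict_ext)
    finally have "?k (\<sigma> p) = PO.cospan_map (copower_map A P X \<sigma> (?iP p))"
      using Hom_closed[OF \<sigma> p] by (simp add: compose_def)
    also have "\<dots> = approx_map A P Q \<sigma> X (canonical_map A P X (?iP p))"
      unfolding approx_map_def by (rule PO.pushout_commutes[OF iPp, symmetric])
    also have "canonical_map A P X (?iP p) = h p" by (rule canonical_map_inj[OF P X h p])
    finally show ?thesis .
  qed
  then show thesis using that k by blast
qed

text \<open>
  Choosing for every \<open>h\<close> an extension of \<open>f \<circ> h\<close> along \<open>\<sigma>\<close> gives a homomorphism on the copower of \<open>Q\<close>
  that is compatible with \<open>f\<close>.
\<close>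

lemma approx_map_factor:
  assumes N: "N \<in> D_class A P Q \<sigma>" and f: "f \<in> Hom A X N"
  obtains g where "g \<in> Hom A (approx_module A P Q \<sigma> X) N"
    "\<And>x. x \<in> carrier X \<Longrightarrow> g (approx_map A P Q \<sigma> X x) = f x"
proof -
  let ?I = "Hom A P X"
  note NM = D_class_module[OF N]
  have fh: "compose (carrier P) f h \<in> Hom A P N" if "h \<in> ?I" for h
    by (rule Hom_compose[OF that f P])
  have "\<exists>e. e \<in> Hom A Q N \<and> (\<forall>p\<in>carrier P. e (\<sigma> p) = f (h p))" if h: "h \<in> ?I" for h
  proof -
    obtain e where "e \<in> Hom A Q N" "\<And>p. p \<in> carrier P \<Longrightarrow> e (\<sigma> p) = compose (carrier P) f h p"
      using D_class_extend[OF N fh[OF h]] by blast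
    then show ?thesis by (auto simp: compose_def)
  qed
  then obtain e where e: "\<And>h. h \<in> ?I \<Longrightarrow> e h \<in> Hom A Q N"
    "\<And>h p. h \<in> ?I \<Longrightarrow> p \<in> carrier P \<Longrightarrow> e h (\<sigma> p) = f (h p)" by metis
  let ?k = "copair ?I (\<lambda>_. Q) N e"
  have k: "?k \<in> Hom A (hom_copower A P X Q) N"
    unfolding hom_copower_def by (rule copair_Hom[OF ring Q NM e(1)])
  have eq: "f (canonical_map A P X u) = ?k (copower_map A P X \<sigma> u)"
    if u: "u \<in> carrier (hom_copower A P X P)" for u
  proof -
    have u': "u \<in> carrier (direct_sum ?I (\<lambda>_. P))" using u by (simp only: hom_copower_def)
    have "f (canonical_map A P X u) = copair ?I (\<lambda>_. P) N (\<lambda>h. compose (carrier P) f h) u"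
      unfolding canonical_map_eq_copair
      by (rule Hom_copair[OF f u' P X NM _ fh]) (simp_all add: compose_def)
    also have "\<dots> = ?k (copower_map A P X \<sigma> u)"
      unfolding copower_map_eq_direct_sum_map
      by (rule copair_direct_sum_map[OF ring P Q NM \<sigma> e(1) fh _ u', symmetric])
         (simp_all add: compose_def e(2))
    finally show ?thesis .
  qed
  show thesis
    using PO.pushout_universal[OF f k NM eq] that unfolding approx_module_def approx_map_def by metis
qed

text \<open>
  Pushouts preserve cokernels, and the cokernel of the copower of \<open>\<sigma>\<close> is formed componentwise.
\<close>

lemma approx_map_cokernel:
  obtains e where "surj_hom A (approx_module A P Q \<sigma> X) (direct_sum (Hom A P X) (\<lambda>_. T)) e"
    "\<And>m. m \<in> carrier (approx_module A P Q \<sigma> X) \<Longrightarrow>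
      e m = \<zero>\<^bsub>direct_sum (Hom A P X) (\<lambda>_. T)\<^esub> \<longleftrightarrow> m \<in> approx_map A P Q \<sigma> X ` carrier X"
proof -
  let ?I = "Hom A P X"
  let ?W = "direct_sum ?I (\<lambda>_. T)" and ?d = "direct_sum_map ?I (\<lambda>_. Q) (\<lambda>_. \<pi>)"
  have W: "right_module A ?W" by (rule right_module_direct_sum[OF ring T])
  have d: "?d \<in> Hom A (hom_copower A P X Q) ?W"
    unfolding hom_copower_def by (rule direct_sum_map_Hom[OF ring Q T \<pi>])
  have d_app: "?d v = (\<lambda>f\<in>?I. \<pi> (v f))" if "v \<in> carrier (hom_copower A P X Q)" for v
    using that by (simp only: direct_sum_map_def hom_copower_def restrict_apply if_True)
  have "w \<in> ?d ` carrier (hom_copower A P X Q)" if w: "w \<in> carrier ?W" for w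
  proof -
    have "w f \<in> \<pi> ` carrier Q" if "f \<in> ?I" for f
      using w that \<pi>_surj by (auto simp: surj_hom_def)
    then obtain v where "v \<in> carrier (direct_sum ?I (\<lambda>_. Q))" "?d v = w"
      using direct_sum_map_exact[OF ring Q T \<pi> w] by blast
    then show ?thesis unfolding hom_copower_def by blast
  qed
  then have d_surj: "surj_hom A (hom_copower A P X Q) ?W ?d"
    using d Hom_closed[OF d] unfolding surj_hom_def by blast
  have ker: "?d v = \<zero>\<^bsub>?W\<^esub> \<longleftrightarrow> v \<in> copower_map A P X \<sigma> ` carrier (hom_copower A P X P)"
    if v: "v \<in> carrier (hom_copower A P X Q)" for v
  proof
    have v': "v \<in> carrier (direct_sum ?I (\<lambda>_. Q))" using v by (simp only: hom_copower_def)
    have vQ: "v f \<in> carrier Q" if "f \<in> ?I" for f using v' that by auto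
    assume "?d v = \<zero>\<^bsub>?W\<^esub>"
    then have "(\<lambda>f\<in>?I. \<pi> (v f)) = (\<lambda>f\<in>?I. \<zero>\<^bsub>T\<^esub>)" using d_app[OF v] by simp
    then have "\<pi> (v f) = \<zero>\<^bsub>T\<^esub>" if "f \<in> ?I" for f using that by (metis restrict_apply')
    then have "v f \<in> \<sigma> ` carrier P" if "f \<in> ?I" for f using that exact[OF vQ] by blast
    then obtain u where "u \<in> carrier (direct_sum ?I (\<lambda>_. P))" "direct_sum_map ?I (\<lambda>_. P) (\<lambda>_. \<sigma>) u = v"
      using direct_sum_map_exact[OF ring P Q \<sigma> v'] by blast
    then show "v \<in> copower_map A P X \<sigma> ` carrier (hom_copower A P X P)"
      unfolding copower_map_eq_direct_sum_map hom_copower_def by blast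
  next
    assume "v \<in> copower_map A P X \<sigma> ` carrier (hom_copower A P X P)"
    then obtain u where u: "u \<in> carrier (hom_copower A P X P)" "v = copower_map A P X \<sigma> u" by blast
    have "\<pi> (v f) = \<zero>\<^bsub>T\<^esub>" if "f \<in> ?I" for f
    proof -
      have "v f = \<sigma> (u f)" using u that by (simp only: copower_map_def restrict_apply if_True)
      moreover have uf: "u f \<in> carrier P" using u(1) that by (auto simp: hom_copower_def)
      ultimately show ?thesis using exact[OF Hom_closed[OF \<sigma> uf]] by simp
    qed
    then show "?d v = \<zero>\<^bsub>?W\<^esub>" unfolding d_app[OF v] by (auto intro: restrict_ext)
  qed
  show thesis
    using PO.pushout_cokernel[OF d_surj W ker] that unfolding approx_module_def approx_map_def by metis
qed

text \<open>
  Copowers of \<open>T\<close> are first known to lie in \<open>\<D>\<^sub>\<sigma>\<close> for index sets of bounded cardinality only, whence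
  the hypothesis.
\<close>

lemma approx_module_D_class:
  assumes "direct_sum (Hom A P X) (\<lambda>_. T) \<in> D_class A P Q \<sigma>"
  shows "approx_module A P Q \<sigma> X \<in> D_class A P Q \<sigma>"
proof -
  obtain e where e: "surj_hom A (approx_module A P Q \<sigma> X) (direct_sum (Hom A P X) (\<lambda>_. T)) e"
    "\<And>m. m \<in> carrier (approx_module A P Q \<sigma> X) \<Longrightarrow>
      e m = \<zero>\<^bsub>direct_sum (Hom A P X) (\<lambda>_. T)\<^esub> \<longleftrightarrow> m \<in> approx_map A P Q \<sigma> X ` carrier X"
    using approx_map_cokernel by blast
  show ?thesis
  proof (rule D_class_extension[OF X right_module_approx assms approx_map_Hom e(1)])
    show "m \<in> approx_map A P Q \<sigma> X ` carrier X"
      if "m \<in> carrier (approx_module A P Q \<sigma> X)" "e m = \<zero>\<^bsub>direct_sum (Hom A P X) (\<lambda>_. T)\<^esub>" for m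
      using e(2)[OF that(1)] that(2) by blast
    show "\<exists>k\<in>Hom A Q (approx_module A P Q \<sigma> X). \<forall>p\<in>carrier P. k (\<sigma> p) = approx_map A P Q \<sigma> X (h p)"
      if "h \<in> Hom A P X" for h
      using approx_map_extends[OF that] by metis
  qed
qed

end

lemma trace_submodule:
  assumes M: "right_module A M"
  shows "rsubmodule A M (trace A T M)"
  unfolding trace_def
  by (rule rsubmodule_image[OF canonical_map_Hom[OF T M] right_module_hom_copower[OF T] M])

lemma trace_contains_images:
  assumes M: "right_module A M" and f: "f \<in> Hom A T M" and t: "t \<in> carrier T"
  shows "f t \<in> trace A T M"
proof -
  have "direct_sum_inj (Hom A T M) (\<lambda>_. T) f t \<in> carrier (hom_copower A T M T)"
    unfolding hom_copower_def by (rule Hom_closed[OF direct_sum_inj_Hom[OF ring T f] t])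
  then show ?thesis
    unfolding trace_def using canonical_map_inj[OF T M f t] by (metis imageI)
qed

text \<open>
  A homomorphism out of a copower of \<open>T\<close> is determined by its components, and these vanish.
\<close>

lemma perp_class_copower_vanish:
  assumes N: "N \<in> perp_class A T" and w: "w \<in> Hom A (direct_sum I (\<lambda>_. T)) N"
    and v: "v \<in> carrier (direct_sum I (\<lambda>_. T))"
  shows "w v = \<zero>\<^bsub>N\<^esub>"
proof -
  have NM: "right_module A N" using N by (simp add: perp_class_iff)
  interpret N: right_module A N by (rule NM)
  let ?W = "direct_sum I (\<lambda>_. T)" and ?inj = "direct_sum_inj I (\<lambda>_. T)"
  have W: "right_module A ?W" by (rule right_module_direct_sum[OF ring T])
  have inj: "?inj i \<in> Hom A T ?W" if "i \<in> I" for i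
    by (rule direct_sum_inj_Hom[OF ring T that])
  have "w v = w (copair I (\<lambda>_. T) ?W ?inj v)"
    by (simp only: copair_direct_sum_inj[OF ring T v])
  also have "\<dots> = copair I (\<lambda>_. T) N (\<lambda>_. zero_hom T N) v"
  proof (rule Hom_copair[OF w v T W NM inj zero_hom_Hom[OF T NM]])
    fix i t assume i: "i \<in> I" and t: "t \<in> carrier T"
    show "w (?inj i t) = zero_hom T N t"
      using perp_class_vanish[OF N Hom_compose[OF inj[OF i] w T] t] t
      by (simp add: compose_def zero_hom_def)
  qed
  also have "\<dots> = (\<Oplus>\<^bsub>N\<^esub>i\<in>{i \<in> I. v i \<noteq> \<zero>\<^bsub>T\<^esub>}. zero_hom T N (v i))"
    using v by (simp only: copair_def restrict_apply if_True)
  also have "\<dots> = \<zero>\<^bsub>N\<^esub>"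
    by (rule N.add.finprod_one_eqI) (use v in \<open>auto simp: zero_hom_def\<close>)
  finally show ?thesis .
qed

lemma trace_vanish:
  assumes M: "right_module A M" and N: "N \<in> perp_class A T" and f: "f \<in> Hom A M N"
    and m: "m \<in> trace A T M"
  shows "f m = \<zero>\<^bsub>N\<^esub>"
proof -
  obtain u where u: "u \<in> carrier (hom_copower A T M T)" "m = canonical_map A T M u"
    using m unfolding trace_def by blast
  have "compose (carrier (hom_copower A T M T)) f (canonical_map A T M) u = \<zero>\<^bsub>N\<^esub>"
    using Hom_compose[OF canonical_map_Hom[OF T M] f right_module_hom_copower[OF T]] u(1)
    unfolding hom_copower_def by (rule perp_class_copower_vanish[OF N])
  then show ?thesis using u by (simp only: compose_eq)
qed

end


section \<open>Coproducts\<close>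

locale silting = presentation A P Q T \<sigma> \<pi>
  for A :: "'a ring" and P :: "('a, 'p) rmodule" and Q :: "('a, 'q) rmodule"
    and T :: "('a, 't) rmodule" and \<sigma> :: "'p \<Rightarrow> 'q" and \<pi> :: "'q \<Rightarrow> 't" +
  assumes T_D: "T \<in> D_class A P Q \<sigma>"
    and coproducts:
      "closed_under_coproducts A (D_class A P Q \<sigma> :: ('a, ('a, 'p, 'q) universe) rmodule set)"
begin

abbreviation \<U> :: "('a, 'p, 'q) universe set" where "\<U> \<equiv> UNIV"

text \<open>
  The summands, and then their coproduct, are replaced by copies inside the universe in which
  closure under coproducts is given.
\<close>

lemma D_class_small_direct_sum:
  fixes X :: "'i \<Rightarrow> ('a, 'm) rmodule"
  assumes I: "|I| \<le>o |\<U>|" and X: "\<And>i. i \<in> I \<Longrightarrow> X i \<in> D_class A P Q \<sigma>"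
    and small: "|\<Union>i\<in>I. carrier (X i)| \<le>o |\<U>|"
  shows "direct_sum I X \<in> D_class A P Q \<sigma>"
proof -
  note XM = D_class_module[OF X]
  obtain j :: "'i \<Rightarrow> ('a, 'p, 'q) universe" where j: "inj_on j I"
    using I by (auto simp: card_of_ordLeq[symmetric])
  have "\<exists>(X' :: ('a, ('a, 'p, 'q) universe) rmodule) e e'. right_module A X' \<and> surj_hom A (X i) X' e \<and> surj_hom A X' (X i) e' \<and>
      (\<forall>x\<in>carrier (X i). e' (e x) = x)"
    if i: "i \<in> I" for i
  proof -
    have "|carrier (X i)| \<le>o |\<Union>i\<in>I. carrier (X i)|" by (rule card_of_mono1) (use i in blast)
    then have "|carrier (X i)| \<le>o |\<U>|" using small by (rule ordLeq_transitive)
    then show ?thesis using small_module_copy[OF XM[OF i], where 'u = "('a, 'p, 'q) universe"] by metis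
  qed
  then obtain X' :: "'i \<Rightarrow> ('a, ('a, 'p, 'q) universe) rmodule" and e e' where
    X'M: "\<And>i. i \<in> I \<Longrightarrow> right_module A (X' i)" and e: "\<And>i. i \<in> I \<Longrightarrow> surj_hom A (X i) (X' i) (e i)"
    and e': "\<And>i. i \<in> I \<Longrightarrow> surj_hom A (X' i) (X i) (e' i)"
    and e'e: "\<And>i x. i \<in> I \<Longrightarrow> x \<in> carrier (X i) \<Longrightarrow> e' i (e i x) = x" by metis
  have eH: "e i \<in> Hom A (X i) (X' i)" and e'H: "e' i \<in> Hom A (X' i) (X i)" if "i \<in> I" for i
    using e[OF that] e'[OF that] by (simp_all add: surj_hom_def)
  define I' where "I' = j ` I"
  define k where "k = inv_into I j"
  define Y where "Y i' = X' (k i')" for i'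
  have k: "k i' \<in> I" "j (k i') = i'" if "i' \<in> I'" for i'
    using that by (auto simp: I'_def k_def inv_into_into f_inv_into_f)
  have kj: "k (j i) = i" "j i \<in> I'" if "i \<in> I" for i
    using that j by (auto simp: I'_def k_def)
  have Yj: "Y (j i) = X' i" if "i \<in> I" for i using kj(1)[OF that] by (simp add: Y_def)
  have YM: "right_module A (Y i')" if "i' \<in> I'" for i' using X'M[OF k(1)[OF that]] by (simp add: Y_def)
  have Y: "Y i' \<in> D_class A P Q \<sigma>" if "i' \<in> I'" for i'
    using D_class_quotient[OF X[OF k(1)[OF that]] e[OF k(1)[OF that]] X'M[OF k(1)[OF that]]] by (simp add: Y_def)
  let ?S = "direct_sum I' Y"
  have SM: "right_module A ?S" using ring YM by (rule right_module_direct_sum)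
  have "|carrier ?S| \<le>o |\<U>|"
    by (rule card_of_direct_sum[OF infinite_universe]) (simp_all add: card_of_mono1)
  then obtain Z :: "('a, ('a, 'p, 'q) universe) rmodule" and z z' where Z: "right_module A Z"
    "surj_hom A ?S Z z" "surj_hom A Z ?S z'" "\<And>x. x \<in> carrier ?S \<Longrightarrow> z' (z x) = x"
    using small_module_copy[OF SM, where 'u = "('a, 'p, 'q) universe"] by metis
  have "inj_on z (carrier ?S)" by (rule inj_on_inverseI[of _ z' z]) (rule Z(4))
  then have "module_iso A ?S Z"
    using Z(2) by (auto simp: module_iso_def surj_hom_def bij_betw_def)
  then have "Z \<in> D_class A P Q \<sigma>"
    using coproducts[unfolded closed_under_coproducts_def, rule_format, of I' Y Z] Y Z(1)
    by (simp add: Modules_def)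
  then have S: "?S \<in> D_class A P Q \<sigma>" using Z(3) SM by (rule D_class_quotient)
  let ?proj = "\<lambda>i. \<lambda>u\<in>carrier ?S. u (j i)"
  let ?f = "\<lambda>i. compose (carrier ?S) (e' i) (?proj i)"
  have f: "?f i \<in> Hom A ?S (X i)" if i: "i \<in> I" for i
  proof (rule Hom_compose[OF _ e'H[OF i] SM])
    have "(\<lambda>u\<in>carrier ?S. (\<lambda>u\<in>carrier ?S. u) u (j i)) \<in> Hom A ?S (Y (j i))"
      by (rule Hom_direct_product_component[OF Hom_direct_sum_product[OF id_Hom[OF SM]] kj(2)[OF i] SM])
    also have "(\<lambda>u\<in>carrier ?S. (\<lambda>u\<in>carrier ?S. u) u (j i)) = ?proj i"
      by (rule restrict_ext) (simp only: restrict_apply if_True)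
    finally show "?proj i \<in> Hom A ?S (X' i)" by (simp only: Yj[OF i])
  qed
  have fu: "?f i u = e' i (u (j i))" if "u \<in> carrier ?S" for i u
    using that by (simp only: compose_def restrict_apply if_True)
  define \<alpha> where "\<alpha> = (\<lambda>u\<in>carrier ?S. \<lambda>i\<in>I. ?f i u)"
  have \<alpha>: "\<alpha> \<in> Hom A ?S (direct_sum I X)"
    unfolding \<alpha>_def
  proof (rule Hom_into_direct_sum[OF f SM])
    fix u assume u: "u \<in> carrier ?S"
    have "{i \<in> I. ?f i u \<noteq> \<zero>\<^bsub>X i\<^esub>} \<subseteq> k ` {i' \<in> I'. u i' \<noteq> \<zero>\<^bsub>Y i'\<^esub>}"
    proof
      fix i assume "i \<in> {i \<in> I. ?f i u \<noteq> \<zero>\<^bsub>X i\<^esub>}"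
      then have i: "i \<in> I" "e' i (u (j i)) \<noteq> \<zero>\<^bsub>X i\<^esub>" using fu[OF u] by auto
      then have "u (j i) \<noteq> \<zero>\<^bsub>X' i\<^esub>"
        using Hom_zero[OF e'H[OF i(1)] X'M[OF i(1)] XM[OF i(1)]] by auto
      then have "j i \<in> {i' \<in> I'. u i' \<noteq> \<zero>\<^bsub>Y i'\<^esub>}" using kj[OF i(1)] by (simp add: Y_def)
      then show "i \<in> k ` {i' \<in> I'. u i' \<noteq> \<zero>\<^bsub>Y i'\<^esub>}" by (rule image_eqI[rotated]) (simp add: kj(1)[OF i(1)])
    qed
    then show "finite {i \<in> I. ?f i u \<noteq> \<zero>\<^bsub>X i\<^esub>}"
      using u by (elim finite_subset) simp
  qed
  have "v \<in> \<alpha> ` carrier ?S" if v: "v \<in> carrier (direct_sum I X)" for v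
  proof
    have vi: "v i \<in> carrier (X i)" if "i \<in> I" for i using v that by auto
    define u where "u = (\<lambda>i'\<in>I'. e (k i') (v (k i')))"
    have "{i' \<in> I'. u i' \<noteq> \<zero>\<^bsub>Y i'\<^esub>} \<subseteq> j ` {i \<in> I. v i \<noteq> \<zero>\<^bsub>X i\<^esub>}"
    proof
      fix i' assume "i' \<in> {i' \<in> I'. u i' \<noteq> \<zero>\<^bsub>Y i'\<^esub>}"
      then have i': "i' \<in> I'" and ui': "u i' \<noteq> \<zero>\<^bsub>Y i'\<^esub>" by blast+
      have ne: "e (k i') (v (k i')) \<noteq> \<zero>\<^bsub>X' (k i')\<^esub>" using ui' i' by (simp add: u_def Y_def)
      note ki = k[OF i']
      have "e (k i') \<zero>\<^bsub>X (k i')\<^esub> = \<zero>\<^bsub>X' (k i')\<^esub>"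
        by (rule Hom_zero[OF eH[OF ki(1)] XM[OF ki(1)] X'M[OF ki(1)]])
      then have "v (k i') \<noteq> \<zero>\<^bsub>X (k i')\<^esub>" using ne by metis
      then have "k i' \<in> {i \<in> I. v i \<noteq> \<zero>\<^bsub>X i\<^esub>}" using ki(1) by simp
      then show "i' \<in> j ` {i \<in> I. v i \<noteq> \<zero>\<^bsub>X i\<^esub>}" by (rule image_eqI[rotated]) (simp add: ki(2))
    qed
    then have "finite {i' \<in> I'. u i' \<noteq> \<zero>\<^bsub>Y i'\<^esub>}"
      using v by (elim finite_subset) simp
    moreover have "u i' \<in> carrier (Y i')" if "i' \<in> I'" for i'
      using Hom_closed[OF eH[OF k(1)[OF that]] vi[OF k(1)[OF that]]] that by (simp add: u_def Y_def)
    moreover have "u \<in> extensional I'" by (simp add: u_def)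
    ultimately show u: "u \<in> carrier ?S" by (simp add: PiE_def Pi_def)
    have "\<alpha> u = (\<lambda>i\<in>I. e' i (u (j i)))"
      using u by (simp only: \<alpha>_def fu restrict_apply if_True)
    also have "\<dots> = (\<lambda>i\<in>I. v i)"
      by (rule restrict_ext) (simp add: u_def kj e'e vi)
    also have "\<dots> = v" using v by (auto intro: PiE_restrict)
    finally show "v = \<alpha> u" by simp
  qed
  then have "surj_hom A ?S (direct_sum I X) \<alpha>"
    using \<alpha> Hom_closed[OF \<alpha>] unfolding surj_hom_def by blast
  moreover have "right_module A (direct_sum I X)" using ring XM by (rule right_module_direct_sum)
  ultimately show ?thesis by (rule D_class_quotient[OF S])
qed

text \<open>
  Each homomorphism \<open>f\<close> from \<open>P\<close> to a module of \<open>\<D>\<^sub>\<sigma>\<close> factors through the approximation of \<open>P\<close>. This one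
  module belongs to \<open>\<D>\<^sub>\<sigma>\<close> and has bounded cardinality, and both properties pass to its image in \<open>N\<close>.
\<close>

lemma small_image_cover:
  assumes N: "N \<in> D_class A P Q \<sigma>" and f: "f \<in> Hom A P N"
  obtains S where "rsubmodule A N S" "N\<lparr>carrier := S\<rparr> \<in> D_class A P Q \<sigma>" "|S| \<le>o |\<U>|"
    "\<And>p. p \<in> carrier P \<Longrightarrow> f p \<in> S"
proof -
  let ?I = "Hom A P P" and ?C = "approx_module A P Q \<sigma> P"
  note NM = D_class_module[OF N]
  have CM: "right_module A ?C" by (rule right_module_approx[OF P])
  have "direct_sum ?I (\<lambda>_. T) \<in> D_class A P Q \<sigma>"
  proof (rule D_class_small_direct_sum[OF small_endofunctions T_D])
    have "|\<Union>i\<in>?I. carrier T| \<le>o |carrier T|" by (rule card_of_mono1) blast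
    also have "|carrier T| \<le>o |\<U>|" by (rule card_of_surj_hom[OF \<pi>_surj small_Q_elements])
    finally show "|\<Union>i\<in>?I. carrier T| \<le>o |\<U>|" .
  qed
  then have C: "?C \<in> D_class A P Q \<sigma>" by (rule approx_module_D_class[OF P])
  obtain c where c: "surj_hom A (binary_sum P (hom_copower A P P Q)) ?C c"
    using approx_module_cover[OF P] by blast
  have "|\<Union>i\<in>?I. carrier Q| \<le>o |\<U>|" by (rule small_Q_elements)
  then have "|carrier (hom_copower A P P Q)| \<le>o |\<U>|"
    unfolding hom_copower_def by (rule card_of_direct_sum[OF infinite_universe small_endofunctions])
  then have "|carrier P \<times> carrier (hom_copower A P P Q)| \<le>o |\<U>|"
    by (intro card_of_Sigma_ordLeq_infinite[OF infinite_universe small_P_elements]) auto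
  then have C_small: "|carrier ?C| \<le>o |\<U>|" by (intro card_of_surj_hom[OF c]) simp
  obtain g where g: "g \<in> Hom A ?C N" "\<And>p. p \<in> carrier P \<Longrightarrow> g (approx_map A P Q \<sigma> P p) = f p"
    using approx_map_factor[OF P N f] by blast
  let ?S = "g ` carrier ?C"
  have S: "rsubmodule A N ?S" by (rule rsubmodule_image[OF g(1) CM NM])
  show thesis
  proof (rule that[OF S])
    show "N\<lparr>carrier := ?S\<rparr> \<in> D_class A P Q \<sigma>"
      by (rule D_class_quotient[OF C surj_hom_onto_image[OF g(1)] right_module_submodule[OF S NM]])
    show "|?S| \<le>o |\<U>|" using card_of_image C_small by (rule ordLeq_transitive)
    show "f p \<in> ?S" if "p \<in> carrier P" for p
      using g(2)[OF that] Hom_closed[OF approx_map_Hom[OF P] that] by (metis imageI)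
  qed
qed

text \<open>
  Each element of \<open>P\<close> is sent to finitely many nonzero entries, so a homomorphism from \<open>P\<close> has few
  nonzero components, and each of them lands in a small submodule that belongs to \<open>\<D>\<^sub>\<sigma>\<close>. It thus takes
  values in a small coproduct, inside which it extends along \<open>\<sigma>\<close>.
\<close>

lemma D_class_direct_sum:
  fixes X :: "'i \<Rightarrow> ('a, 'm) rmodule"
  assumes X: "\<And>i. i \<in> I \<Longrightarrow> X i \<in> D_class A P Q \<sigma>"
  shows "direct_sum I X \<in> D_class A P Q \<sigma>"
  unfolding D_class_iff
proof (intro conjI ballI)
  note XM = D_class_module[OF X]
  show "right_module A (direct_sum I X)" using ring XM by (rule right_module_direct_sum)
  fix f assume f: "f \<in> Hom A P (direct_sum I X)"
  have fp: "f p \<in> carrier (direct_sum I X)" if "p \<in> carrier P" for p by (rule Hom_closed[OF f that])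
  let ?f = "\<lambda>i. \<lambda>p\<in>carrier P. f p i"
  have fi: "?f i \<in> Hom A P (X i)" if "i \<in> I" for i
    by (rule Hom_direct_product_component[OF Hom_direct_sum_product[OF f] that P])
  define J where "J = (\<Union>p\<in>carrier P. {i \<in> I. f p i \<noteq> \<zero>\<^bsub>X i\<^esub>})"
  have JI: "J \<subseteq> I" by (auto simp: J_def)
  have J: "|J| \<le>o |\<U>|"
    unfolding J_def
  proof (rule card_of_UNION_ordLeq_infinite[OF infinite_universe small_P_elements], intro ballI)
    fix p assume "p \<in> carrier P"
    then have "finite {i \<in> I. f p i \<noteq> \<zero>\<^bsub>X i\<^esub>}" using fp by simp
    then show "|{i \<in> I. f p i \<noteq> \<zero>\<^bsub>X i\<^esub>}| \<le>o |\<U>|"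
      using infinite_universe by (rule card_of_finite_ordLeq_infinite)
  qed
  have "\<exists>S. rsubmodule A (X i) S \<and> (X i)\<lparr>carrier := S\<rparr> \<in> D_class A P Q \<sigma> \<and> |S| \<le>o |\<U>| \<and>
      (\<forall>p\<in>carrier P. f p i \<in> S)" if i: "i \<in> J" for i
  proof -
    have iI: "i \<in> I" using i JI by blast
    obtain S where S: "rsubmodule A (X i) S" "(X i)\<lparr>carrier := S\<rparr> \<in> D_class A P Q \<sigma>" "|S| \<le>o |\<U>|"
      "\<And>p. p \<in> carrier P \<Longrightarrow> ?f i p \<in> S"
      using small_image_cover[OF X[OF iI] fi[OF iI]] by blast
    have "\<forall>p\<in>carrier P. f p i \<in> S" using S(4) by simp
    then show ?thesis using S(1-3) by blast
  qed
  then obtain S where S: "\<And>i. i \<in> J \<Longrightarrow> rsubmodule A (X i) (S i)"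
    "\<And>i. i \<in> J \<Longrightarrow> (X i)\<lparr>carrier := S i\<rparr> \<in> D_class A P Q \<sigma>" "\<And>i. i \<in> J \<Longrightarrow> |S i| \<le>o |\<U>|"
    "\<And>i p. i \<in> J \<Longrightarrow> p \<in> carrier P \<Longrightarrow> f p i \<in> S i" by metis
  define Y where "Y i = (X i)\<lparr>carrier := S i\<rparr>" for i
  have Y: "Y i \<in> D_class A P Q \<sigma>" if "i \<in> J" for i using S(2)[OF that] by (simp add: Y_def)
  have YD: "direct_sum J Y \<in> D_class A P Q \<sigma>"
  proof (rule D_class_small_direct_sum[OF J Y])
    show "|\<Union>i\<in>J. carrier (Y i)| \<le>o |\<U>|"
      by (rule card_of_UNION_ordLeq_infinite[OF infinite_universe J]) (simp add: Y_def S(3))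
  qed
  have fY: "?f i \<in> Hom A P (Y i)" if i: "i \<in> J" for i
    unfolding Y_def by (rule Hom_into_submodule[OF fi]) (use i JI S(4) in auto)
  define f' where "f' = (\<lambda>p\<in>carrier P. \<lambda>i\<in>J. ?f i p)"
  have f': "f' \<in> Hom A P (direct_sum J Y)"
    unfolding f'_def
  proof (rule Hom_into_direct_sum[OF fY P])
    fix p assume p: "p \<in> carrier P"
    have "{i \<in> J. ?f i p \<noteq> \<zero>\<^bsub>Y i\<^esub>} \<subseteq> {i \<in> I. f p i \<noteq> \<zero>\<^bsub>X i\<^esub>}"
      using p JI by (auto simp: Y_def)
    then show "finite {i \<in> J. ?f i p \<noteq> \<zero>\<^bsub>Y i\<^esub>}" using fp[OF p] by (elim finite_subset) simp
  qed
  obtain g' where g': "g' \<in> Hom A Q (direct_sum J Y)" "\<And>p. p \<in> carrier P \<Longrightarrow> g' (\<sigma> p) = f' p"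
    using D_class_extend[OF YD f'] by blast
  \<comment> \<open>the extension within the small coproduct, with zero entries at the remaining indices\<close>
  define h where "h i = (if i \<in> J then \<lambda>q\<in>carrier Q. g' q i else zero_hom Q (X i))" for i
  have h: "h i \<in> Hom A Q (X i)" if i: "i \<in> I" for i
  proof (cases "i \<in> J")
    case True
    have "(\<lambda>q\<in>carrier Q. g' q i) \<in> Hom A Q (Y i)"
      by (rule Hom_direct_product_component[OF Hom_direct_sum_product[OF g'(1)] True Q])
    then have "(\<lambda>q\<in>carrier Q. g' q i) \<in> Hom A Q (X i)"
      unfolding Y_def by (rule Hom_from_submodule) (use S(1)[OF True] in \<open>simp add: rsubmodule_def\<close>)
    then show ?thesis using True by (simp add: h_def)
  next
    case False
    then show ?thesis using zero_hom_Hom[OF Q XM[OF i]] by (simp add: h_def)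
  qed
  let ?g = "\<lambda>q\<in>carrier Q. \<lambda>i\<in>I. h i q"
  have "?g \<in> Hom A Q (direct_sum I X)"
  proof (rule Hom_into_direct_sum[OF h Q])
    fix q assume q: "q \<in> carrier Q"
    have "{i \<in> I. h i q \<noteq> \<zero>\<^bsub>X i\<^esub>} \<subseteq> {i \<in> J. g' q i \<noteq> \<zero>\<^bsub>Y i\<^esub>}"
      using q by (auto simp: h_def Y_def zero_hom_def split: if_splits)
    then show "finite {i \<in> I. h i q \<noteq> \<zero>\<^bsub>X i\<^esub>}"
      using Hom_closed[OF g'(1) q] by (elim finite_subset) simp
  qed
  moreover have "?g (\<sigma> p) = f p" if p: "p \<in> carrier P" for p
  proof -
    note \<sigma>p = Hom_closed[OF \<sigma> p]
    have "h i (\<sigma> p) = f p i" if i: "i \<in> I" for i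
    proof (cases "i \<in> J")
      case True
      then show ?thesis using \<sigma>p p by (simp add: h_def g'(2) f'_def)
    next
      case False
      then have "f p i = \<zero>\<^bsub>X i\<^esub>" using i p by (auto simp: J_def)
      then show ?thesis using False \<sigma>p by (simp add: h_def zero_hom_def)
    qed
    then have "?g (\<sigma> p) = (\<lambda>i\<in>I. f p i)" using \<sigma>p by (auto intro: restrict_ext)
    also have "\<dots> = f p" using fp[OF p] by (auto intro: PiE_restrict)
    finally show ?thesis .
  qed
  ultimately show "\<exists>g\<in>Hom A Q (direct_sum I X). \<forall>p\<in>carrier P. g (\<sigma> p) = f p" by blast
qed


section \<open>The reflection\<close>

lemma trace_D_class:
  assumes M: "right_module A M"
  shows "M\<lparr>carrier := trace A T M\<rparr> \<in> D_class A P Q \<sigma>"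
proof (rule D_class_quotient)
  show "hom_copower A T M T \<in> D_class A P Q \<sigma>"
    unfolding hom_copower_def by (rule D_class_direct_sum[OF T_D])
  show "surj_hom A (hom_copower A T M T) (M\<lparr>carrier := trace A T M\<rparr>) (canonical_map A T M)"
    unfolding trace_def by (rule surj_hom_onto_image[OF canonical_map_Hom[OF T M]])
  show "right_module A (M\<lparr>carrier := trace A T M\<rparr>)"
    by (rule right_module_submodule[OF trace_submodule[OF M] M])
qed

text \<open>
  A homomorphism from \<open>T\<close> to the quotient lifts to \<open>h\<close> from \<open>Q\<close> to \<open>M\<close>, which maps the image of \<open>\<sigma>\<close>
  into the trace. As the trace belongs to \<open>\<D>\<^sub>\<sigma>\<close>, there is \<open>k\<close> from \<open>Q\<close> to the trace that agrees with \<open>h\<close>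
  along \<open>\<sigma>\<close>. The difference \<open>h - k\<close> factors through \<open>T\<close>, so its values lie in the trace; hence so do
  those of \<open>h\<close>.
\<close>

lemma quotient_by_trace_Y_class:
  assumes M: "M \<in> D_class A P Q \<sigma>"
  shows "quotient_module M (trace A T M) \<in> Y_class A P Q \<sigma> T"
proof -
  note MM = D_class_module[OF M]
  interpret M: right_module A M by (rule MM)
  let ?\<tau> = "trace A T M"
  let ?Z = "quotient_module M ?\<tau>" and ?c = "quotient_map M ?\<tau>"
  note sub = trace_submodule[OF MM]
  note Z = quotient_module[OF sub MM]
  have cH: "?c \<in> Hom A M ?Z" using Z(2) by (simp add: surj_hom_def)
  have ker: "?c m = \<zero>\<^bsub>?Z\<^esub> \<longleftrightarrow> m \<in> ?\<tau>" if "m \<in> carrier M" for m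
    using Z(3) that unfolding a_kernel_def' by blast
  have \<tau>D: "M\<lparr>carrier := ?\<tau>\<rparr> \<in> D_class A P Q \<sigma>" by (rule trace_D_class[OF MM])
  have \<tau>M: "?\<tau> \<subseteq> carrier M" using sub by (simp add: rsubmodule_def)
  have "?Z \<in> perp_class A T"
    unfolding perp_class_iff
  proof (intro conjI ballI Z(1))
    fix u t assume u: "u \<in> Hom A T ?Z" and t: "t \<in> carrier T"
    obtain h where h: "h \<in> Hom A Q M" "\<And>q. q \<in> carrier Q \<Longrightarrow> ?c (h q) = compose (carrier Q) u \<pi> q"
      using free_retract_lift[OF free_Q Q MM Z(1) Z(2) Hom_compose[OF \<pi> u Q]] by blast
    have h\<sigma>: "compose (carrier P) h \<sigma> \<in> Hom A P (M\<lparr>carrier := ?\<tau>\<rparr>)"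
    proof (rule Hom_into_submodule[OF Hom_compose[OF \<sigma> h(1) P]])
      fix p assume p: "p \<in> carrier P"
      note \<sigma>p = Hom_closed[OF \<sigma> p]
      have "\<pi> (\<sigma> p) = \<zero>\<^bsub>T\<^esub>" using exact[OF \<sigma>p] p by blast
      then have "?c (h (\<sigma> p)) = \<zero>\<^bsub>?Z\<^esub>"
        using h(2)[OF \<sigma>p] \<sigma>p Hom_zero[OF u T Z(1)] by (simp add: compose_def)
      then show "compose (carrier P) h \<sigma> p \<in> ?\<tau>"
        using ker[OF Hom_closed[OF h(1) \<sigma>p]] p by (simp add: compose_def)
    qed
    obtain k where k: "k \<in> Hom A Q (M\<lparr>carrier := ?\<tau>\<rparr>)"
      "\<And>p. p \<in> carrier P \<Longrightarrow> k (\<sigma> p) = compose (carrier P) h \<sigma> p"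
      using D_class_extend[OF \<tau>D h\<sigma>] by blast
    have kM: "k \<in> Hom A Q M" by (rule Hom_from_submodule[OF k(1) \<tau>M])
    define d where "d = (\<lambda>q\<in>carrier Q. h q \<ominus>\<^bsub>M\<^esub> k q)"
    have d: "d \<in> Hom A Q M" unfolding d_def by (rule Hom_minus_Hom[OF h(1) kM Q MM])
    have "d (\<sigma> p) = \<zero>\<^bsub>M\<^esub>" if p: "p \<in> carrier P" for p
      using k(2)[OF p] p Hom_closed[OF \<sigma> p] Hom_closed[OF h(1) Hom_closed[OF \<sigma> p]]
      by (simp add: d_def compose_def a_minus_def[of M] M.r_neg)
    then obtain s where s: "s \<in> Hom A T M" "\<And>q. q \<in> carrier Q \<Longrightarrow> s (\<pi> q) = d q"
      using Hom_kills_\<sigma>_factor[OF d MM] by blast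
    obtain q where q: "q \<in> carrier Q" "t = \<pi> q"
      using t \<pi>_surj by (auto simp: surj_hom_def)
    have dq: "d q \<in> ?\<tau>" using trace_contains_images[OF MM s(1) t] s(2)[OF q(1)] q(2) by simp
    have kq: "k q \<in> ?\<tau>" using Hom_closed[OF k(1) q(1)] by simp
    have hq: "h q \<in> carrier M" "k q \<in> carrier M" using Hom_closed[OF h(1) q(1)] kq \<tau>M by auto
    have "?c (d q) = \<zero>\<^bsub>?Z\<^esub>" "?c (k q) = \<zero>\<^bsub>?Z\<^esub>"
      using ker dq kq \<tau>M by blast+
    moreover have "?c (d q) = ?c (h q) \<ominus>\<^bsub>?Z\<^esub> ?c (k q)"
      using q(1) Hom_minus[OF cH MM Z(1) hq] by (simp add: d_def)
    ultimately have "?c (h q) = \<zero>\<^bsub>?Z\<^esub>"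
      using right_module.minus_eq_zeroD[OF Z(1)] Hom_closed[OF cH] hq by metis
    then show "u t = \<zero>\<^bsub>?Z\<^esub>" using h(2)[OF q(1)] q by (simp add: compose_def)
  qed
  then show ?thesis using D_class_quotient[OF M Z(2,1)] by (simp add: Y_class_def)
qed

text \<open>
  Existence of factorisations: the approximation property gives one over \<open>M\<^sub>X\<close>, which kills the trace.
  Uniqueness: the difference of two factorisations vanishes on the image of \<open>X\<close>, so over \<open>M\<^sub>X\<close> it
  factors through a copower of \<open>T\<close>, from which there are no nonzero homomorphisms to \<open>N\<close>.
\<close>

lemma reflection:
  fixes X :: "('a, 'x) rmodule"
  assumes X: "right_module A X"
  shows "is_reflection A (Y_class A P Q \<sigma> T) (Y_class A P Q \<sigma> T :: ('a, 'n) rmodule set)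
    X (reflection_module A P Q \<sigma> T X) (reflection_map A P Q \<sigma> T X)"
proof -
  let ?M = "approx_module A P Q \<sigma> X" and ?\<phi> = "approx_map A P Q \<sigma> X"
  let ?\<tau> = "trace A T ?M"
  let ?Z = "quotient_module ?M ?\<tau>" and ?c = "quotient_map ?M ?\<tau>"
  let ?\<psi> = "compose (carrier X) ?c ?\<phi>"
  have MM: "right_module A ?M" by (rule right_module_approx[OF X])
  have M: "?M \<in> D_class A P Q \<sigma>"
    by (rule approx_module_D_class[OF X D_class_direct_sum[OF T_D]])
  have Z: "?Z \<in> Y_class A P Q \<sigma> T" by (rule quotient_by_trace_Y_class[OF M])
  note quot = quotient_module[OF trace_submodule[OF MM] MM]
  have c: "?c \<in> Hom A ?M ?Z" using quot(2) by (simp add: surj_hom_def)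
  note \<phi> = approx_map_Hom[OF X]
  have \<psi>: "?\<psi> \<in> Hom A X ?Z" by (rule Hom_compose[OF \<phi> c X])
  have "bij_betw (\<lambda>g. compose (carrier X) g ?\<psi>) (Hom A ?Z N) (Hom A X N)"
    if "N \<in> (Y_class A P Q \<sigma> T :: ('a, 'n) rmodule set)" for N
  proof -
    have ND: "N \<in> D_class A P Q \<sigma>" and Np: "N \<in> perp_class A T" using that by (auto simp: Y_class_def)
    note NM = D_class_module[OF ND]
    interpret N: right_module A N by (rule NM)
    have comp: "compose (carrier X) g ?\<psi> x = g (?c (?\<phi> x))" if "x \<in> carrier X" for g x
      using that by (simp add: compose_def)
    show ?thesis
      unfolding bij_betw_def
    proof
      show "inj_on (\<lambda>g. compose (carrier X) g ?\<psi>) (Hom A ?Z N)"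
      proof (rule inj_onI)
        fix g g' assume g: "g \<in> Hom A ?Z N" and g': "g' \<in> Hom A ?Z N"
          and eq: "compose (carrier X) g ?\<psi> = compose (carrier X) g' ?\<psi>"
        define d where "d = (\<lambda>m\<in>carrier ?M. compose (carrier ?M) g ?c m \<ominus>\<^bsub>N\<^esub> compose (carrier ?M) g' ?c m)"
        have d: "d \<in> Hom A ?M N"
          unfolding d_def by (intro Hom_minus_Hom[OF _ _ MM NM] Hom_compose[OF c _ MM] g g')
        have dm: "d m = g (?c m) \<ominus>\<^bsub>N\<^esub> g' (?c m)" if "m \<in> carrier ?M" for m
          using that by (simp add: d_def compose_def)
        obtain e where e: "surj_hom A ?M (direct_sum (Hom A P X) (\<lambda>_. T)) e"
          "\<And>m. m \<in> carrier ?M \<Longrightarrow> e m = \<zero>\<^bsub>direct_sum (Hom A P X) (\<lambda>_. T)\<^esub> \<longleftrightarrow> m \<in> ?\<phi> ` carrier X"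
          using approx_map_cokernel[OF X] by blast
        let ?W = "direct_sum (Hom A P X) (\<lambda>_. T)"
        have W: "right_module A ?W" by (rule right_module_direct_sum[OF ring T])
        have "d m = \<zero>\<^bsub>N\<^esub>" if m: "m \<in> carrier ?M" "e m = \<zero>\<^bsub>?W\<^esub>" for m
        proof -
          obtain x where x: "x \<in> carrier X" "m = ?\<phi> x" using e(2) m by blast
          have "g (?c m) = g' (?c m)" using fun_cong[OF eq, of x] unfolding comp[OF x(1)] x(2) .
          moreover have "g' (?c m) \<in> carrier N" by (rule Hom_closed[OF g' Hom_closed[OF c m(1)]])
          ultimately show ?thesis by (simp add: dm[OF m(1)] a_minus_def[of N] N.r_neg)
        qed
        then obtain w where w: "w \<in> Hom A ?W N" "\<And>m. m \<in> carrier ?M \<Longrightarrow> w (e m) = d m"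
          using Hom_factor_surj[OF e(1) d MM W NM] by blast
        have w0: "w v = \<zero>\<^bsub>N\<^esub>" if "v \<in> carrier ?W" for v
          by (rule perp_class_copower_vanish[OF Np w(1) that])
        show "g = g'"
        proof (rule Hom_eqI[OF g g'])
          fix z assume "z \<in> carrier ?Z"
          then obtain m where m: "m \<in> carrier ?M" "z = ?c m"
            using quot(2) by (auto simp: surj_hom_def)
          have "e m \<in> carrier ?W" using e(1) m(1) unfolding surj_hom_def by blast
          then have "d m = \<zero>\<^bsub>N\<^esub>" using w0 w(2)[OF m(1)] by metis
          then show "g z = g' z"
            unfolding m(2) dm[OF m(1)]
            by (rule N.minus_eq_zeroD) (rule Hom_closed[OF _ Hom_closed[OF c m(1)]], fact)+
        qed
      qed
    next
      show "(\<lambda>g. compose (carrier X) g ?\<psi>) ` Hom A ?Z N = Hom A X N"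
      proof (intro subset_antisym subsetI)
        fix f assume "f \<in> (\<lambda>g. compose (carrier X) g ?\<psi>) ` Hom A ?Z N"
        then show "f \<in> Hom A X N" using Hom_compose[OF \<psi> _ X] by blast
      next
        fix f assume f: "f \<in> Hom A X N"
        obtain g where g: "g \<in> Hom A ?M N" "\<And>x. x \<in> carrier X \<Longrightarrow> g (?\<phi> x) = f x"
          using approx_map_factor[OF X ND f] by blast
        have "g m = \<zero>\<^bsub>N\<^esub>" if m: "m \<in> carrier ?M" "?c m = \<zero>\<^bsub>?Z\<^esub>" for m
        proof -
          have "m \<in> ?\<tau>" using quot(3) m unfolding a_kernel_def' by blast
          then show ?thesis by (rule trace_vanish[OF MM Np g(1)])
        qed
        then obtain h where h: "h \<in> Hom A ?Z N" "\<And>m. m \<in> carrier ?M \<Longrightarrow> h (?c m) = g m"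
          using Hom_factor_surj[OF quot(2) g(1) MM quot(1) NM] by blast
        have eq: "compose (carrier X) h ?\<psi> = f"
        proof (rule Hom_eqI[OF Hom_compose[OF \<psi> h(1) X] f])
          fix x assume x: "x \<in> carrier X"
          show "compose (carrier X) h ?\<psi> x = f x"
            by (simp only: comp[OF x] h(2)[OF Hom_closed[OF \<phi> x]] g(2)[OF x])
        qed
        show "f \<in> (\<lambda>g. compose (carrier X) g ?\<psi>) ` Hom A ?Z N"
        proof (rule image_eqI[where x = h])
          show "f = compose (carrier X) h ?\<psi>" by (rule eq[symmetric])
        qed (rule h(1))
      qed
    qed
  qed
  then show ?thesis
    using Z \<psi> unfolding is_reflection_def reflection_module_def reflection_map_def by blast
qed

lemma Y_class_bireflective: "bireflective A (Y_class A P Q \<sigma> T :: ('a, 'u) rmodule set)"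
  unfolding bireflective_def
proof (intro conjI)
  let ?Y = "Y_class A P Q \<sigma> T :: ('a, 'u) rmodule set"
  show "?Y \<subseteq> Modules A" by (auto simp: Y_class_def perp_class_def)
  have iso: "Z \<in> ?Y"
    if W: "W \<in> D_class A P Q \<sigma>" "W \<in> perp_class A T" and Z: "Z \<in> Modules A" and iso: "module_iso A W Z"
    for W :: "('a, 'w) rmodule" and Z
  proof -
    have WM: "right_module A W" and ZM: "right_module A Z"
      using D_class_module[OF W(1)] Z by (simp_all add: Modules_def)
    obtain f where f: "f \<in> Hom A W Z" "bij_betw f (carrier W) (carrier Z)"
      using iso by (auto simp: module_iso_def)
    have f_surj: "surj_hom A W Z f" and f_inj: "inj_hom A W Z f"
      using f by (auto simp: surj_hom_def inj_hom_def bij_betw_def)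
    obtain h where h: "h \<in> Hom A Z W" "\<And>z. z \<in> carrier Z \<Longrightarrow> f (h z) = (\<lambda>z\<in>carrier Z. z) z"
      using Hom_factor_inj[OF f_inj id_Hom[OF ZM] ZM WM] f(2) by (auto simp: bij_betw_def)
    have "inj_hom A Z W h"
      using h by (auto simp: inj_hom_def intro!: inj_on_inverseI[of _ f])
    then show ?thesis
      using D_class_quotient[OF W(1) f_surj ZM] perp_class_inj[OF W(2) _ ZM] by (auto simp: Y_class_def)
  qed
  show "closed_under_products A ?Y"
    unfolding closed_under_products_def
  proof (intro allI impI ballI)
    fix I :: "'u set" and X and Z :: "('a, 'u) rmodule"
    assume X: "\<forall>i\<in>I. X i \<in> ?Y" and Z: "Z \<in> Modules A" "module_iso A (direct_product I X) Z"
    show "Z \<in> ?Y"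
      by (rule iso[OF D_class_product perp_class_product Z]) (use X in \<open>auto simp: Y_class_def\<close>)
  qed
  show "closed_under_coproducts A ?Y"
    unfolding closed_under_coproducts_def
  proof (intro allI impI ballI)
    fix I :: "'u set" and X and Z :: "('a, 'u) rmodule"
    assume X: "\<forall>i\<in>I. X i \<in> ?Y" and Z: "Z \<in> Modules A" "module_iso A (direct_sum I X) Z"
    show "Z \<in> ?Y"
      by (rule iso[OF D_class_direct_sum perp_class_direct_sum Z]) (use X in \<open>auto simp: Y_class_def\<close>)
  qed
  show "closed_under_kernels A ?Y"
    unfolding closed_under_kernels_def
  proof (intro allI impI ballI)
    fix X Z K :: "('a, 'u) rmodule" and f k
    assume "X \<in> ?Y" "Z \<in> ?Y" "f \<in> Hom A X Z" "K \<in> Modules A"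
      "inj_hom A K X k \<and> k ` carrier K = a_kernel X Z f"
    then show "K \<in> ?Y"
      by (intro Y_class_kernel[of X Z f K k]) (auto simp: Y_class_def Modules_def)
  qed
  show "closed_under_cokernels A ?Y"
    unfolding closed_under_cokernels_def
  proof (intro allI impI ballI)
    fix X Z C :: "('a, 'u) rmodule" and f c
    assume "X \<in> ?Y" "Z \<in> ?Y" "f \<in> Hom A X Z" "C \<in> Modules A"
      "surj_hom A Z C c \<and> a_kernel Z C c = f ` carrier X"
    then show "C \<in> ?Y"
      by (intro Y_class_cokernel[of X Z f C c]) (auto simp: Y_class_def Modules_def)
  qed
qed

lemma Y_class_extension_closed: "extension_closed A (Y_class A P Q \<sigma> T :: ('a, 'u) rmodule set)"
  unfolding extension_closed_def
proof (intro allI impI ballI)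
  fix K W E :: "('a, 'u) rmodule" and i e
  assume K: "K \<in> Y_class A P Q \<sigma> T" and W: "W \<in> Y_class A P Q \<sigma> T" and E: "E \<in> Modules A"
    and ex: "short_exact A K E W i e"
  have KD: "K \<in> D_class A P Q \<sigma>" and Kp: "K \<in> perp_class A T"
    and WD: "W \<in> D_class A P Q \<sigma>" and Wp: "W \<in> perp_class A T" and EM: "right_module A E"
    using K W E by (auto simp: Y_class_def Modules_def)
  have i: "i \<in> Hom A K E" and e: "surj_hom A E W e" and ker: "i ` carrier K = a_kernel E W e"
    using ex by (auto simp: short_exact_def inj_hom_def)
  have "E \<in> D_class A P Q \<sigma>"
  proof (rule D_class_extension[OF D_class_module[OF KD] EM WD i e])
    show "x \<in> i ` carrier K" if "x \<in> carrier E" "e x = \<zero>\<^bsub>W\<^esub>" for x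
      using that unfolding ker by (simp add: a_kernel_def')
    fix h assume h: "h \<in> Hom A P K"
    obtain k where k: "k \<in> Hom A Q K" "\<And>p. p \<in> carrier P \<Longrightarrow> k (\<sigma> p) = h p"
      using D_class_extend[OF KD h] by blast
    have "\<forall>p\<in>carrier P. compose (carrier Q) i k (\<sigma> p) = i (h p)"
      using k(2) Hom_closed[OF \<sigma>] by (simp add: compose_def)
    then show "\<exists>k\<in>Hom A Q E. \<forall>p\<in>carrier P. k (\<sigma> p) = i (h p)"
      using Hom_compose[OF k(1) i Q] by blast
  qed
  then show "E \<in> Y_class A P Q \<sigma> T"
    using perp_class_extension[OF Kp EM Wp ex] by (simp add: Y_class_def)
qed

end

lemma partial_silting_imp_silting:
  fixes A :: "'a ring" and P :: "('a, 'p) rmodule" and Q :: "('a, 'q) rmodule" and T :: "('a, 't) rmodule"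
  assumes ring: "ring A" and "partial_silting A P Q T \<sigma> \<pi>"
  shows "silting A P Q T \<sigma> \<pi>"
proof -
  have pres: "projective_presentation A P Q T \<sigma> \<pi>" and T_D: "T \<in> D_class A P Q \<sigma>"
    and tors: "torsion_class A (D_class A P Q \<sigma> :: ('a, ('a, 'p, 'q) universe) rmodule set)"
    using assms(2) by (simp_all add: partial_silting_def)
  have projP: "projective TYPE(('a, 'p, 'q) universe) A P" and projQ: "projective TYPE(('a, 'p, 'q) universe) A Q"
    and T: "right_module A T" and \<sigma>: "\<sigma> \<in> Hom A P Q" and \<pi>: "surj_hom A Q T \<pi>"
    and im: "\<sigma> ` carrier P = a_kernel Q T \<pi>"
    using pres by (simp_all add: projective_presentation_def Modules_def)
  have free: "|carrier (free_module A S)| \<le>o |UNIV :: ('a, 'p, 'q) universe set|"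
    if "|S| \<le>o |UNIV :: ('a, 'p, 'q) universe set|" for S :: "'b set"
    unfolding free_module_def
    by (rule card_of_direct_sum[OF infinite_universe that small_ring_elements])
  show ?thesis
  proof (intro silting.intro presentation.intro silting_axioms.intro)
    show "free_retract A P"
      by (rule projective_imp_free_retract[OF ring projP small_P_elements free[OF small_P_elements]])
    show "free_retract A Q"
      by (rule projective_imp_free_retract[OF ring projQ small_Q_elements free[OF small_Q_elements]])
    show "right_module A P" "right_module A Q"
      using projP projQ by (simp_all add: projective_def Modules_def)
    show "\<pi> q = \<zero>\<^bsub>T\<^esub> \<longleftrightarrow> q \<in> \<sigma> ` carrier P" if "q \<in> carrier Q" for q
      using that unfolding im by (simp add: a_kernel_def')
    show "closed_under_coproducts A (D_class A P Q \<sigma> :: ('a, ('a, 'p, 'q) universe) rmodule set)"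
      using tors by (simp add: torsion_class_def)
  qed fact+
qed

theorem proposition3p3:
  fixes A :: "'a ring"
    and P :: "('a, 'p) rmodule" and Q :: "('a, 'q) rmodule" and T\<^sub>1 :: "('a, 't) rmodule"
    and \<sigma> :: "'p \<Rightarrow> 'q" and \<pi> :: "'q \<Rightarrow> 't"
  assumes "ring A"
    and "partial_silting A P Q T\<^sub>1 \<sigma> \<pi>"
  shows "bireflective A (Y_class A P Q \<sigma> T\<^sub>1 :: ('a, 'u) rmodule set) \<and>
    extension_closed A (Y_class A P Q \<sigma> T\<^sub>1 :: ('a, 'u) rmodule set) \<and>
    (\<forall>(X :: ('a, 'x) rmodule)\<in>Modules A.
       is_reflection A (Y_class A P Q \<sigma> T\<^sub>1) (Y_class A P Q \<sigma> T\<^sub>1 :: ('a, 'n) rmodule set)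
         X (reflection_module A P Q \<sigma> T\<^sub>1 X) (reflection_map A P Q \<sigma> T\<^sub>1 X))"
proof -
  interpret silting A P Q T\<^sub>1 \<sigma> \<pi>
    using assms by (rule partial_silting_imp_silting)
  show ?thesis
  proof (intro conjI ballI)
    show "bireflective A (Y_class A P Q \<sigma> T\<^sub>1 :: ('a, 'u) rmodule set)"
      by (rule Y_class_bireflective)
    show "extension_closed A (Y_class A P Q \<sigma> T\<^sub>1 :: ('a, 'u) rmodule set)"
      by (rule Y_class_extension_closed)
    fix X :: "('a, 'x) rmodule" assume "X \<in> Modules A"
    then have "right_module A X" by (simp add: Modules_def)
    then show "is_reflection A (Y_class A P Q \<sigma> T\<^sub>1) (Y_class A P Q \<sigma> T\<^sub>1 :: ('a, 'n) rmodule set)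
        X (reflection_module A P Q \<sigma> T\<^sub>1 X) (reflection_map A P Q \<sigma> T\<^sub>1 X)"
      by (rule reflection)
  qed
qed

end
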